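(* Let $n\ge 1$, $l\ge 2$, let $\mathbf{q}=(q_1,\dots,q_n)$ be integers relatively prime to $l$, and let $\gamma_{2n+1}\colon\mathbb{S}^{2n+1}\to L^{2n+1}(l;\mathbf{q})$ be the quotient map onto the lens space. Then: (1) $G_1(L^{2n+1}(l;\mathbf{q}))=G_1^{\gamma_{2n+1}}(L^{2n+1}(l;\mathbf{q}))=\mathbb{Z}_l$; (2) $P_1(L^{2n+1}(l;\mathbf{q}))=P_1^{\gamma_{2n+1}}(L^{2n+1}(l;\mathbf{q}))=\mathbb{Z}_l$; (3) $G_m^{\gamma_{2n+1}}(L^{2n+1}(l;\mathbf{q}))=P_m^{\gamma_{2n+1}}(L^{2n+1}(l;\mathbf{q}))=\operatorname{Ker}[\gamma_{2n+1},-]$ for $m\ge 1$; (4) $P_m^{\gamma_{2n+1}}(L^{2n+1}(l;\mathbf{q}))=P_m(L^{2n+1}(l;\mathbf{q}))=\gamma_{2n+1*}G_m(\mathbb{S}^{2n+1})$ for $m>1$; (5) in the case $n=1$, $G_m^{\gamma_3}(L^3(l;\mathbf{q}))=P_m^{\gamma_3}(L^3(l;\mathbf{q}))=G_m(L^3(l;\mathbf{q}))=P_m(L^3(l;\mathbf{q}))=\gamma_{3*}\pi_m(\mathbb{S}^3)$ for $m>1$.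
   Context: All maps and homotopies are based. $L^{2n+1}(l;\mathbf{q})=\mathbb{S}^{2n+1}/\mathbb{Z}_l$ is the orbit space of the free action of the cyclic group $\mathbb{Z}_l=\langle g\rangle$ on the unit sphere $\mathbb{S}^{2n+1}\subset\mathbb{C}^{n+1}$ given by $g\cdot(z_0,z_1,\dots,z_n)=(e^{2\pi i/l}z_0,e^{2\pi iq_1/l}z_1,\dots,e^{2\pi iq_n/l}z_n)$; its fundamental group is identified with $\mathbb{Z}_l$. For a map $f\colon A\to X$ and $m\ge 1$: $G_m^f(X)$ is the subgroup of $\pi_m(X)$ consisting of all elements which can be represented by a map $\alpha\colon\mathbb{S}^m\to X$ such that $f\vee\alpha\colon A\vee\mathbb{S}^m\to X$ extends (up to homotopy) to a map $A\times\mathbb{S}^m\to X$; $P_m^f(X)$ is the subgroup of all $\alpha\in\pi_m(X)$ such that the Whitehead product $[\alpha,f\beta]$ is zero for all $\beta\in\pi_k(A)$, $k\ge 1$. Moreover $G_m(X)=G_m^{\mathrm{id}_X}(X)$ and $P_m(X)=P_m^{\mathrm{id}_X}(X)$. For $\gamma\in\pi_k(X)$, $\operatorname{Ker}[\gamma,-]$ (in degree $m$) is the set of $\alpha\in\pi_m(X)$ with $[\gamma,\alpha]=0$. *)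

theory Defs
  imports "HOL-Analysis.Analysis" "HOL-Algebra.Elementary_Groups"
begin

section \<open>Homotopy groups\<close>

text \<open>
  Spheres are the library's \<open>nsphere m\<close>, the unit sphere in the first \<open>m + 1\<close> coordinates of
  \<open>nat \<Rightarrow> real\<close>.  Its base point is the first unit vector.
\<close>

definition sphere_pt :: "nat \<Rightarrow> real" where
  "sphere_pt = (\<lambda>i. if i = 0 then 1 else 0)"

definition sphere_map :: "nat \<Rightarrow> 'b topology \<Rightarrow> 'b \<Rightarrow> ((nat \<Rightarrow> real) \<Rightarrow> 'b) \<Rightarrow> bool" where
  "sphere_map m X x0 f \<longleftrightarrow> continuous_map (nsphere m) X f \<and> f sphere_pt = x0"

definition sphere_class ::
    "nat \<Rightarrow> 'b topology \<Rightarrow> 'b \<Rightarrow> ((nat \<Rightarrow> real) \<Rightarrow> 'b) \<Rightarrow> ((nat \<Rightarrow> real) \<Rightarrow> 'b) set" where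
  "sphere_class m X x0 f = {g. homotopic_with (\<lambda>h. h sphere_pt = x0) (nsphere m) X f g}"

text \<open>
  For \<open>m \<ge> 1\<close>, \<open>sphere_fold\<close> collapses the equator \<open>x 1 = 0\<close> to the base point and maps each of the
  two open hemispheres homeomorphically, and with degree one, onto the complement of the base
  point; so it is the pinch map to the wedge of two spheres followed by the folding map.  For
  \<open>m = 1\<close> it doubles the angle, and \<open>sphere_mult\<close> is concatenation of loops.
\<close>

definition sphere_fold :: "(nat \<Rightarrow> real) \<Rightarrow> nat \<Rightarrow> real" where
  "sphere_fold x = (\<lambda>i. if i = 0 then 1 - 2 * (x 1)\<^sup>2
                        else if i = 1 then 2 * x 1 * x 0
                        else 2 * \<bar>x 1\<bar> * x i)"

definition sphere_mult ::
    "((nat \<Rightarrow> real) \<Rightarrow> 'b) \<Rightarrow> ((nat \<Rightarrow> real) \<Rightarrow> 'b) \<Rightarrow> (nat \<Rightarrow> real) \<Rightarrow> 'b" where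
  "sphere_mult f g x = (if x 1 \<ge> 0 then f (sphere_fold x) else g (sphere_fold x))"

definition homotopy_group ::
    "nat \<Rightarrow> 'b topology \<Rightarrow> 'b \<Rightarrow> ((nat \<Rightarrow> real) \<Rightarrow> 'b) set monoid" where
  "homotopy_group m X x0 =
     \<lparr>carrier = sphere_class m X x0 ` {f. sphere_map m X x0 f},
      mult = (\<lambda>c d. \<Union>f\<in>c. \<Union>g\<in>d. sphere_class m X x0 (sphere_mult f g)),
      one = sphere_class m X x0 (\<lambda>_. x0)\<rparr>"

text \<open>The homomorphism into \<open>\<pi>\<^sub>m(X, x0)\<close> induced by a based map \<open>f\<close>.\<close>

definition homotopy_induced ::
    "nat \<Rightarrow> 'b topology \<Rightarrow> 'b \<Rightarrow> ('a \<Rightarrow> 'b) \<Rightarrow> ((nat \<Rightarrow> real) \<Rightarrow> 'a) set \<Rightarrow> ((nat \<Rightarrow> real) \<Rightarrow> 'b) set"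
  where
  "homotopy_induced m X x0 f c = (\<Union>\<alpha>\<in>c. sphere_class m X x0 (f \<circ> \<alpha>))"


section \<open>Whitehead products\<close>

definition enorm :: "nat \<Rightarrow> (nat \<Rightarrow> real) \<Rightarrow> real" where
  "enorm m x = sqrt (\<Sum>i<m. (x i)\<^sup>2)"

text \<open>
  The relative homeomorphism from the closed unit ball of \<open>\<real>\<^sup>m\<close> modulo its boundary onto
  \<open>nsphere m\<close> modulo its base point.
\<close>

definition ball_collapse :: "nat \<Rightarrow> (nat \<Rightarrow> real) \<Rightarrow> nat \<Rightarrow> real" where
  "ball_collapse m x =
     (\<lambda>i. if i = 0 then 2 * (enorm m x)\<^sup>2 - 1
          else if i \<le> m then 2 * sqrt (1 - (enorm m x)\<^sup>2) * x (i - 1)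
          else 0)"

text \<open>
  The Whitehead product of \<open>\<alpha>\<close> on \<open>nsphere k\<close> and \<open>\<beta>\<close> on \<open>nsphere m\<close>, for \<open>k, m \<ge> 1\<close>, is the map
  on the boundary of \<open>D\<^sup>k \<times> D\<^sup>m\<close> sending \<open>(u, v)\<close> to \<open>\<alpha> u\<close> if \<open>v\<close> is in the boundary of \<open>D\<^sup>m\<close>, and to
  \<open>\<beta> v\<close> if \<open>u\<close> is in the boundary of \<open>D\<^sup>k\<close>.  The unit sphere of \<open>\<real>\<^sup>k \<times> \<real>\<^sup>m\<close> is
  identified with that boundary by dividing \<open>(u, v)\<close> by the larger of the norms of \<open>u\<close> and \<open>v\<close>.
  The orthogonal change of coordinates in the first two coordinates puts the base point of
  \<open>nsphere (k + m - 1)\<close> at a point where both norms are equal; there the map takes the value at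
  the base point.  Orientation conventions affect the product only up to sign.
\<close>

definition whitehead_map ::
    "nat \<Rightarrow> nat \<Rightarrow> ((nat \<Rightarrow> real) \<Rightarrow> 'b) \<Rightarrow> ((nat \<Rightarrow> real) \<Rightarrow> 'b) \<Rightarrow> (nat \<Rightarrow> real) \<Rightarrow> 'b" where
  "whitehead_map k m \<alpha> \<beta> z =
     (let u = (\<lambda>i. if i = 0 then (z 0 + z 1) / sqrt 2 else z (i + 1));
          v = (\<lambda>i. if i = 0 then (z 0 - z 1) / sqrt 2 else z (k + i));
          a = enorm k u;
          b = enorm m v
      in if a \<ge> b then \<beta> (ball_collapse m (\<lambda>i. v i / a))
         else \<alpha> (ball_collapse k (\<lambda>i. u i / b)))"

definition whitehead_product ::
    "nat \<Rightarrow> nat \<Rightarrow> 'b topology \<Rightarrow> 'b \<Rightarrow>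
     ((nat \<Rightarrow> real) \<Rightarrow> 'b) set \<Rightarrow> ((nat \<Rightarrow> real) \<Rightarrow> 'b) set \<Rightarrow> ((nat \<Rightarrow> real) \<Rightarrow> 'b) set" where
  "whitehead_product k m X x0 c d =
     (\<Union>\<alpha>\<in>c. \<Union>\<beta>\<in>d. sphere_class (k + m - 1) X x0 (whitehead_map k m \<alpha> \<beta>))"

definition whitehead_kernel ::
    "nat \<Rightarrow> nat \<Rightarrow> 'b topology \<Rightarrow> 'b \<Rightarrow> ((nat \<Rightarrow> real) \<Rightarrow> 'b) set \<Rightarrow> ((nat \<Rightarrow> real) \<Rightarrow> 'b) set set"
  where
  "whitehead_kernel k m X x0 c =
     {d \<in> carrier (homotopy_group m X x0).
        whitehead_product k m X x0 c d = \<one>\<^bsub>homotopy_group (k + m - 1) X x0\<^esub>}"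


section \<open>Gottlieb groups and Whitehead center groups\<close>

text \<open>The wedge of \<open>A\<close> and \<open>nsphere m\<close> is the union of the two axes in their product.\<close>

definition sphere_wedge :: "nat \<Rightarrow> 'a topology \<Rightarrow> 'a \<Rightarrow> ('a \<times> (nat \<Rightarrow> real)) topology" where
  "sphere_wedge m A a0 =
     subtopology (prod_topology A (nsphere m)) {(a, s). s = sphere_pt \<or> a = a0}"

definition wedge_map :: "('a \<Rightarrow> 'b) \<Rightarrow> ((nat \<Rightarrow> real) \<Rightarrow> 'b) \<Rightarrow> 'a \<times> (nat \<Rightarrow> real) \<Rightarrow> 'b" where
  "wedge_map f \<alpha> = (\<lambda>(a, s). if s = sphere_pt then f a else \<alpha> s)"

definition gottlieb_along ::
    "nat \<Rightarrow> 'a topology \<Rightarrow> 'a \<Rightarrow> 'b topology \<Rightarrow> 'b \<Rightarrow> ('a \<Rightarrow> 'b) \<Rightarrow> ((nat \<Rightarrow> real) \<Rightarrow> 'b) set set" where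
  "gottlieb_along m A a0 X x0 f =
     {c \<in> carrier (homotopy_group m X x0). \<exists>\<alpha>\<in>c. \<exists>F.
        continuous_map (prod_topology A (nsphere m)) X F \<and>
        homotopic_with (\<lambda>h. h (a0, sphere_pt) = x0) (sphere_wedge m A a0) X F (wedge_map f \<alpha>)}"

definition whitehead_along ::
    "nat \<Rightarrow> 'a topology \<Rightarrow> 'a \<Rightarrow> 'b topology \<Rightarrow> 'b \<Rightarrow> ('a \<Rightarrow> 'b) \<Rightarrow> ((nat \<Rightarrow> real) \<Rightarrow> 'b) set set" where
  "whitehead_along m A a0 X x0 f =
     {c \<in> carrier (homotopy_group m X x0).
        \<forall>k\<ge>1. \<forall>d \<in> carrier (homotopy_group k A a0).
          whitehead_product m k X x0 c (homotopy_induced k X x0 f d)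
            = \<one>\<^bsub>homotopy_group (m + k - 1) X x0\<^esub>}"

definition gottlieb :: "nat \<Rightarrow> 'b topology \<Rightarrow> 'b \<Rightarrow> ((nat \<Rightarrow> real) \<Rightarrow> 'b) set set" where
  "gottlieb m X x0 = gottlieb_along m X x0 X x0 id"

definition whitehead_center :: "nat \<Rightarrow> 'b topology \<Rightarrow> 'b \<Rightarrow> ((nat \<Rightarrow> real) \<Rightarrow> 'b) set set" where
  "whitehead_center m X x0 = whitehead_along m X x0 X x0 id"


section \<open>Lens spaces\<close>

text \<open>
  The sphere in \<open>\<complex>\<^sup>n\<^sup>+\<^sup>1\<close> is \<open>nsphere (2 * n + 1)\<close>, where the \<open>j\<close>-th complex coordinate of \<open>x\<close> is
  \<open>Complex (x (2 * j)) (x (2 * j + 1))\<close>.  The weight of the coordinate \<open>0\<close> is \<open>1\<close>, so the value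
  \<open>q 0\<close> is not used.
\<close>

definition lens_generator :: "nat \<Rightarrow> (nat \<Rightarrow> int) \<Rightarrow> (nat \<Rightarrow> real) \<Rightarrow> nat \<Rightarrow> real" where
  "lens_generator l q x =
     (\<lambda>i. let j = i div 2;
              w = (if j = 0 then 1 else q j);
              z = exp (2 * of_real pi * \<i> * of_int w / of_nat l) * Complex (x (2 * j)) (x (2 * j + 1))
          in if even i then Re z else Im z)"

text \<open>The quotient map, sending a point to its orbit under the powers of the generator.\<close>

definition lens_proj :: "nat \<Rightarrow> (nat \<Rightarrow> int) \<Rightarrow> (nat \<Rightarrow> real) \<Rightarrow> (nat \<Rightarrow> real) set" where
  "lens_proj l q x = {(lens_generator l q ^^ k) x | k. k < l}"

definition lens_space :: "nat \<Rightarrow> nat \<Rightarrow> (nat \<Rightarrow> int) \<Rightarrow> (nat \<Rightarrow> real) set topology" where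
  "lens_space n l q =
     topology (\<lambda>U. U \<subseteq> lens_proj l q ` topspace (nsphere (2 * n + 1)) \<and>
       openin (nsphere (2 * n + 1)) {x \<in> topspace (nsphere (2 * n + 1)). lens_proj l q x \<in> U})"

lemma openin_lens_space:
  "openin (lens_space n l q) U \<longleftrightarrow>
     U \<subseteq> lens_proj l q ` topspace (nsphere (2 * n + 1)) \<and>
     openin (nsphere (2 * n + 1)) {x \<in> topspace (nsphere (2 * n + 1)). lens_proj l q x \<in> U}"
proof -
  let ?S = "nsphere (2 * n + 1)" and ?p = "lens_proj l q"
  have "istopology (\<lambda>U. U \<subseteq> ?p ` topspace ?S \<and> openin ?S {x \<in> topspace ?S. ?p x \<in> U})"
    unfolding istopology_def
  proof (intro conjI allI impI)
    fix U V
    assume "U \<subseteq> ?p ` topspace ?S \<and> openin ?S {x \<in> topspace ?S. ?p x \<in> U}"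
      and "V \<subseteq> ?p ` topspace ?S \<and> openin ?S {x \<in> topspace ?S. ?p x \<in> V}"
    moreover have "{x \<in> topspace ?S. ?p x \<in> U \<inter> V}
        = {x \<in> topspace ?S. ?p x \<in> U} \<inter> {x \<in> topspace ?S. ?p x \<in> V}" by auto
    ultimately show "U \<inter> V \<subseteq> ?p ` topspace ?S" "openin ?S {x \<in> topspace ?S. ?p x \<in> U \<inter> V}"
      by auto
  next
    fix K
    assume K: "\<forall>U\<in>K. U \<subseteq> ?p ` topspace ?S \<and> openin ?S {x \<in> topspace ?S. ?p x \<in> U}"
    then show "\<Union>K \<subseteq> ?p ` topspace ?S" by blast
    have "{x \<in> topspace ?S. ?p x \<in> \<Union>K} = (\<Union>U\<in>K. {x \<in> topspace ?S. ?p x \<in> U})" by auto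
    then show "openin ?S {x \<in> topspace ?S. ?p x \<in> \<Union>K}"
      using K by auto
  qed
  then show ?thesis
    by (simp add: lens_space_def topology_inverse')
qed

lemma quotient_map_lens_proj:
  "quotient_map (nsphere (2 * n + 1)) (lens_space n l q) (lens_proj l q)"
proof -
  have "topspace (lens_space n l q) = lens_proj l q ` topspace (nsphere (2 * n + 1))"
  proof
    show "topspace (lens_space n l q) \<subseteq> lens_proj l q ` topspace (nsphere (2 * n + 1))"
      using openin_lens_space openin_topspace by blast
    have "{x \<in> topspace (nsphere (2 * n + 1)).
             lens_proj l q x \<in> lens_proj l q ` topspace (nsphere (2 * n + 1))}
          = topspace (nsphere (2 * n + 1))" by auto
    then show "lens_proj l q ` topspace (nsphere (2 * n + 1)) \<subseteq> topspace (lens_space n l q)"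
      by (intro openin_subset) (simp add: openin_lens_space)
  qed
  then show ?thesis
    by (auto simp: quotient_map_def openin_lens_space)
qed

end

theory Submission
  imports Defs
begin

text \<open>
  The proof rests on three principles, valid well beyond lens spaces, and on one construction that
  is special to dimension three.

  The first principle is that \<open>[\<alpha>, \<beta>] = 0\<close> if and only if the map \<open>\<alpha> \<or> \<beta>\<close> extends over the product
  of the two spheres (\<open>whitehead_product_trivial_iff\<close>).  Indeed \<open>D\<^sup>k \<times> D\<^sup>m\<close> is the cone over its
  boundary, the domain of the Whitehead product, and collapsing the boundary of each disc turns a map
  on this cone that restricts to the Whitehead product into a map on the product of spheres that
  restricts to \<open>\<alpha>\<close> and \<open>\<beta>\<close> on the axes.  In this form the vanishing of Whitehead products is symmetric,
  the inclusion of every Gottlieb group in the corresponding Whitehead center group is a composition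
  of maps (\<open>gottlieb_along_subset_whitehead_along\<close>), and for a map \<open>f\<close> whose domain is itself a
  sphere both groups are the kernel of \<open>[f, -]\<close>, because the identity of the sphere is among the
  classes to be tested (\<open>gottlieb_whitehead_kernel_sphere\<close>).  The description of the groups along
  \<open>\<gamma>\<close> as the kernel of \<open>[\<gamma>, -]\<close> is the case \<open>f = \<gamma>\<close>.

  The second principle is covering theory.  A covering \<open>p : E \<rightarrow> B\<close> induces isomorphisms of homotopy
  groups above degree one, and a null-homotopy of a Whitehead product of maps that lift can itself be
  lifted.  Hence the center \<open>P\<^sub>m\<close> along \<open>p\<close> is the image of the Whitehead center \<open>P\<^sub>m\<close> of \<open>E\<close>
  (\<open>whitehead_along_covering\<close>).  It is also the Whitehead center of \<open>B\<close> as soon as products with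
  \<open>\<pi>\<^sub>1(B)\<close> vanish (\<open>whitehead_along_covering_eq_center\<close>), since only the classes of degree one are
  not images from \<open>E\<close>.  For the sphere, Whitehead center and Gottlieb group agree, by the first
  principle for its identity map; this gives the groups of the lens space in degrees above one.

  The third principle supplies that hypothesis.  The cyclic group acts on the sphere through a circle
  action, with weights \<open>1, q 1, \<dots>, q n\<close>, and this circle action descends to the lens space.  The
  paths along it from the base point to its translates under the group become loops that represent
  all of \<open>\<pi>\<^sub>1\<close>, and the action extends them to maps \<open>L \<times> S\<^sup>1 \<rightarrow> L\<close> that are the identity on \<open>L\<close>; so
  the first Gottlieb group is all of \<open>\<pi>\<^sub>1\<close> (\<open>gottlieb_1_lens\<close>), and with it every group in degree one.  That
  \<open>\<pi>\<^sub>1\<close> is cyclic of order \<open>l\<close> (\<open>fundamental_group_lens\<close>), and that these loops exhaust it, follows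
  because a loop in \<open>L\<close> is determined up to homotopy by the end point of its lift: paths in a sphere
  of dimension at least two with the same end points are homotopic (\<open>nsphere_path_homotopic\<close>).

  For \<open>n = 1\<close> it remains to see that every class of the three-sphere has a Gottlieb class as its
  image.  Let \<open>S\<^sup>3\<close> be the unit quaternions.  Right multiplication by \<open>w\<close> need not commute with the
  group, but if \<open>C\<close> is a quaternion-valued map of \<open>z\<close> with suitable behaviour under the group, then
  \<open>z \<mapsto> z (C(z) w C(z)\<^sup>-\<^sup>1)\<close> does; it fixes \<open>z\<close> for \<open>w = 1\<close> and sends \<open>1\<close> to \<open>w\<close>.  Geometrically this
  is an equivariant framing of \<open>S\<^sup>3\<close>, that is, a parallelization of the lens space.  The
  components of \<open>C\<close> can be taken to be monomials \<open>z\<^sub>0\<^sup>a\<close> and \<open>z\<^sub>1\<^sup>b\<close> (\<open>gottlieb_lens_3\<close>).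
\<close>

section \<open>Spheres and discs\<close>

lemma sum_sq_enorm: "(\<Sum>i<m. (x i)\<^sup>2) = (enorm m x)\<^sup>2"
  by (simp add: enorm_def sum_nonneg)

lemma topspace_nsphere_iff:
  "x \<in> topspace (nsphere n) \<longleftrightarrow> enorm (Suc n) x = 1 \<and> (\<forall>i>n. x i = 0)"
  by (auto simp: nsphere enorm_def lessThan_Suc_atMost)

lemma enorm_nonneg [simp]: "0 \<le> enorm m x"
  by (simp add: enorm_def sum_nonneg)

lemma enorm_L2_set: "enorm m x = L2_set x {..<m}"
  by (simp add: enorm_def L2_set_def)

lemma enorm_scale: "enorm m (\<lambda>i. s * x i) = \<bar>s\<bar> * enorm m x"
  by (simp add: enorm_def power_mult_distrib sum_distrib_left [symmetric] real_sqrt_mult)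

lemma enorm_triangle: "enorm m (\<lambda>i. x i + y i) \<le> enorm m x + enorm m y"
  unfolding enorm_L2_set by (rule L2_set_triangle_ineq)

lemma enorm_cong: "(\<And>i. i < m \<Longrightarrow> x i = y i) \<Longrightarrow> enorm m x = enorm m y"
  by (simp add: enorm_def)

lemma abs_le_enorm: "i < m \<Longrightarrow> \<bar>x i\<bar> \<le> enorm m x"
  unfolding enorm_L2_set using member_le_L2_set[of "{..<m}" i "\<lambda>i. \<bar>x i\<bar>"]
  by (simp add: L2_set_def)

lemma enorm_eq_0: "enorm m x = 0 \<Longrightarrow> i < m \<Longrightarrow> x i = 0"
  using abs_le_enorm[of i m x] by simp

text \<open>
  The support condition makes \<open>disc k\<close> a copy of the unit ball of \<open>\<real>\<^sup>k\<close>, so that it is Hausdorff and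
  compact and \<open>ball_collapse\<close> has the expected fibres on it.
\<close>

definition disc :: "nat \<Rightarrow> (nat \<Rightarrow> real) topology" where
  "disc k = subtopology (powertop_real UNIV) {x. enorm k x \<le> 1 \<and> (\<forall>i\<ge>k. x i = 0)}"

lemma topspace_disc_iff:
  "x \<in> topspace (disc k) \<longleftrightarrow> enorm k x \<le> 1 \<and> (\<forall>i\<ge>k. x i = 0)"
  by (auto simp: disc_def)

lemma continuous_map_coordinatewise:
  shows "continuous_map X (nsphere n) f \<longleftrightarrow>
      (\<forall>i. continuous_map X euclideanreal (\<lambda>x. f x i)) \<and> f \<in> topspace X \<rightarrow> topspace (nsphere n)"
    and "continuous_map X (disc k) g \<longleftrightarrow>
      (\<forall>i. continuous_map X euclideanreal (\<lambda>x. g x i)) \<and> g \<in> topspace X \<rightarrow> topspace (disc k)"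
  by (simp_all add: nsphere disc_def continuous_map_in_subtopology continuous_map_componentwise_UNIV
      image_subset_iff_funcset)

lemma continuous_map_coordinate:
  "continuous_map X (nsphere n) f \<Longrightarrow> continuous_map X euclideanreal (\<lambda>x. f x i)"
  "continuous_map X (disc k) f \<Longrightarrow> continuous_map X euclideanreal (\<lambda>x. f x i)"
  by (simp_all add: continuous_map_coordinatewise)

lemma continuous_map_in_topspace: "continuous_map X Y f \<Longrightarrow> x \<in> topspace X \<Longrightarrow> f x \<in> topspace Y"
  using continuous_map_image_subset_topspace by fastforce

lemma continuous_map_sqrt: 
  assumes "continuous_map X euclideanreal f"
  shows "continuous_map X euclideanreal (\<lambda>x. sqrt (f x))"
proof -
  have "continuous_map X euclideanreal (sqrt \<circ> f)"
    by (rule continuous_map_compose[OF assms]) (auto intro: continuous_intros)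
  then show ?thesis by (simp add: o_def)
qed

lemma continuous_map_enorm:
  assumes "\<And>i. i < m \<Longrightarrow> continuous_map X euclideanreal (\<lambda>x. f x i)"
  shows "continuous_map X euclideanreal (\<lambda>x. enorm m (f x))"
  unfolding enorm_def
  by (intro continuous_map_sqrt continuous_map_sum continuous_map_real_pow assms) auto

lemma continuous_map_interval_fst:
  "continuous_map (prod_topology (top_of_set {0..1::real}) X) euclideanreal fst"
  using continuous_map_fst[of "top_of_set {0..1}" X] continuous_map_in_subtopology by blast

lemma compact_space_bounded:
  assumes "closed C" "\<And>x i. x \<in> C \<Longrightarrow> \<bar>x i\<bar> \<le> (1::real)"
  shows "compact_space (subtopology (powertop_real UNIV) (C :: (nat \<Rightarrow> real) set))"
proof (rule compact_space_subtopology)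
  show "compactin (powertop_real UNIV) C"
  proof (rule closed_compactin)
    show "compactin (powertop_real UNIV) (PiE UNIV (\<lambda>i::nat. {-1..1}))"
      by (simp add: compactin_PiE)
    show "C \<subseteq> (\<Pi>\<^sub>E i\<in>UNIV. {-1..1})" using assms(2) by (fastforce simp: abs_le_iff)
    show "closedin (powertop_real UNIV) C" using assms(1) by (simp add: euclidean_product_topology)
  qed
qed

lemma continuous_on_enorm: "continuous_on S (enorm m)"
  unfolding enorm_def
  by (intro continuous_intros continuous_on_subset[OF continuous_on_product_coordinates]) auto

lemma closed_vanishing: "closed {x::nat \<Rightarrow> real. \<forall>i\<ge>k. x i = 0}"
proof -
  have "{x::nat \<Rightarrow> real. \<forall>i\<ge>k. x i = 0} = (\<Inter>i\<in>{k..}. {x. x i = 0})" by auto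
  moreover have "closed {x::nat \<Rightarrow> real. x i = 0}" for i
    by (intro closed_Collect_eq continuous_on_product_coordinates continuous_on_const)
  ultimately show ?thesis by auto
qed

lemma compact_space_disc: "compact_space (disc k)"
  unfolding disc_def
proof (rule compact_space_bounded)
  have "{x. enorm k x \<le> 1 \<and> (\<forall>i\<ge>k. x i = 0)} = {x. enorm k x \<le> 1} \<inter> {x. \<forall>i\<ge>k. x i = 0}" by auto
  then show "closed {x. enorm k x \<le> 1 \<and> (\<forall>i\<ge>k. x i = 0)}"
    by (auto intro!: closed_Int closed_vanishing closed_Collect_le continuous_on_enorm continuous_on_const)
  fix x i assume "x \<in> {x. enorm k x \<le> 1 \<and> (\<forall>i\<ge>k. x i = 0)}"
  then show "\<bar>x i\<bar> \<le> 1" using abs_le_enorm[of i k x] by (cases "i < k") auto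
qed

lemma compact_space_nsphere: "compact_space (nsphere n)"
  unfolding nsphere
proof (rule compact_space_bounded)
  have *: "{x. (\<Sum>i\<le>n. x i ^ 2) = 1 \<and> (\<forall>i>n. x i = 0)} = {x. enorm (Suc n) x = 1} \<inter> {x. \<forall>i\<ge>Suc n. x i = 0}"
    by (auto simp: enorm_def lessThan_Suc_atMost Suc_le_eq)
  then show "closed {x. (\<Sum>i\<le>n. (x i::real) ^ 2) = 1 \<and> (\<forall>i>n. x i = 0)}"
    by (auto intro!: closed_Int closed_vanishing closed_Collect_eq continuous_on_enorm continuous_on_const)
  fix x i assume "x \<in> {x. (\<Sum>i\<le>n. (x i::real) ^ 2) = 1 \<and> (\<forall>i>n. x i = 0)}"
  then have "x \<in> {x. enorm (Suc n) x = 1} \<inter> {x. \<forall>i\<ge>Suc n. x i = 0}" unfolding * .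
  then show "\<bar>x i\<bar> \<le> 1" using abs_le_enorm[of i "Suc n" x] by (cases "i < Suc n") auto
qed

lemma Hausdorff_space_nsphere: "Hausdorff_space (nsphere n)"
  by (simp add: nsphere Hausdorff_space_subtopology Hausdorff_space_product_topology)

lemma sphere_pt_in: "sphere_pt \<in> topspace (nsphere n)"
  by (simp add: sphere_pt_def in_topspace_nsphere)

lemma enorm_sphere_pt: "enorm (Suc n) sphere_pt = 1"
  using sphere_pt_in topspace_nsphere_iff by blast

lemma sphere_pt_in_disc: "k \<ge> 1 \<Longrightarrow> sphere_pt \<in> topspace (disc k)"
  using enorm_sphere_pt[of "k - 1"] by (auto simp: topspace_disc_iff sphere_pt_def)

text \<open>
  Segments in a disc are used twice: towards a boundary point, to contract Whitehead products and to
  lift maps of spheres, and between arbitrary points, to see that spheres are connected.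
\<close>

lemma convex_disc:
  assumes "x \<in> topspace (disc k)" "y \<in> topspace (disc k)" "0 \<le> t" "t \<le> 1"
  shows "(\<lambda>i. (1 - t) * x i + t * y i) \<in> topspace (disc k)"
proof -
  have "enorm k (\<lambda>i. (1 - t) * x i + t * y i) \<le> (1 - t) * enorm k x + t * enorm k y"
    using enorm_triangle[of k "\<lambda>i. (1 - t) * x i" "\<lambda>i. t * y i"] assms by (simp add: enorm_scale)
  also have "\<dots> \<le> (1 - t) * 1 + t * 1"
    using assms by (intro add_mono mult_left_mono) (auto simp: topspace_disc_iff)
  finally show ?thesis using assms by (simp add: topspace_disc_iff)
qed

lemma ball_collapse_in:
  assumes "x \<in> topspace (disc k)"
  shows "ball_collapse k x \<in> topspace (nsphere k)"
proof -
  let ?r = "enorm k x"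
  have r: "0 \<le> ?r" "?r \<le> 1" "?r\<^sup>2 \<le> 1" using assms by (auto simp: topspace_disc_iff power_le_one)
  have "(\<Sum>i<Suc k. (ball_collapse k x i)\<^sup>2) =
      (ball_collapse k x 0)\<^sup>2 + (\<Sum>i<k. (ball_collapse k x (Suc i))\<^sup>2)"
    by (rule sum.lessThan_Suc_shift)
  also have "(\<Sum>i<k. (ball_collapse k x (Suc i))\<^sup>2) = (\<Sum>i<k. 4 * (1 - ?r\<^sup>2) * (x i)\<^sup>2)"
    using r by (intro sum.cong) (auto simp: ball_collapse_def power_mult_distrib)
  also have "\<dots> = 4 * (1 - ?r\<^sup>2) * ?r\<^sup>2"
    by (simp add: sum_distrib_left [symmetric] sum_sq_enorm)
  also have "(ball_collapse k x 0)\<^sup>2 + 4 * (1 - ?r\<^sup>2) * ?r\<^sup>2 = 1"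
    by (simp add: ball_collapse_def power2_eq_square algebra_simps)
  finally show ?thesis
    by (simp add: topspace_nsphere_iff ball_collapse_def enorm_def)
qed

lemma ball_collapse_boundary:
  "enorm k x = 1 \<Longrightarrow> ball_collapse k x = sphere_pt"
  by (auto simp: ball_collapse_def sphere_pt_def)

lemma enorm_sphere_pt': "k \<ge> 1 \<Longrightarrow> enorm k sphere_pt = 1"
  using enorm_sphere_pt[of "k - 1"] by simp

lemma ball_collapse_sphere_pt: "k \<ge> 1 \<Longrightarrow> ball_collapse k sphere_pt = sphere_pt"
  by (rule ball_collapse_boundary[OF enorm_sphere_pt'])

lemma ball_collapse_eq_pt:
  assumes "ball_collapse k x = sphere_pt" shows "enorm k x = 1"
proof -
  have "ball_collapse k x 0 = 1" using assms by (simp add: sphere_pt_def)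
  then have "(enorm k x)\<^sup>2 = 1" by (simp add: ball_collapse_def)
  then show ?thesis using power2_eq_1_iff[of "enorm k x"] enorm_nonneg[of k x] by linarith
qed

text \<open>
  The norm of a point can be read off the coordinate \<open>0\<close> of its image, and off the boundary the
  other coordinates then determine the point.
\<close>

lemma ball_collapse_eq_iff:
  assumes "x \<in> topspace (disc k)" "y \<in> topspace (disc k)"
  shows "ball_collapse k x = ball_collapse k y \<longleftrightarrow> x = y \<or> enorm k x = 1 \<and> enorm k y = 1"
proof
  assume eq: "ball_collapse k x = ball_collapse k y"
  have "ball_collapse k x 0 = ball_collapse k y 0" using eq by simp
  then have r: "enorm k x = enorm k y" by (simp add: ball_collapse_def power2_eq_iff_nonneg)
  show "x = y \<or> enorm k x = 1 \<and> enorm k y = 1"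
  proof (cases "enorm k x = 1")
    case False
    then have lt: "enorm k x < 1" using assms by (auto simp: topspace_disc_iff)
    have "x i = y i" for i
    proof (cases "i < k")
      case True
      have "ball_collapse k x (Suc i) = ball_collapse k y (Suc i)" using eq by simp
      moreover have "\<bar>enorm k y\<bar> < 1" using lt unfolding r by simp
      then have "(enorm k y)\<^sup>2 < 1" by (rule abs_square_less_1 [THEN iffD2])
      ultimately show ?thesis using True unfolding ball_collapse_def r by simp
    qed (use assms in \<open>auto simp: topspace_disc_iff\<close>)
    then show ?thesis by blast
  qed (use r in auto)
next
  assume "x = y \<or> enorm k x = 1 \<and> enorm k y = 1"
  then show "ball_collapse k x = ball_collapse k y" by (auto simp only: ball_collapse_boundary)
qed

lemma continuous_map_ball_collapse: "continuous_map (disc k) (nsphere k) (ball_collapse k)"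
proof -
  have "continuous_map (disc k) euclideanreal (\<lambda>x. x i)" for i
    using continuous_map_coordinate(2)[OF continuous_map_id, of k i] by simp
  then have "continuous_map (disc k) euclideanreal (\<lambda>x. ball_collapse k x i)" for i
    unfolding ball_collapse_def
    by (cases "i = 0"; cases "i \<le> k"; simp; intro continuous_intros continuous_map_sqrt continuous_map_enorm) auto
  then show ?thesis
    by (auto simp: continuous_map_coordinatewise ball_collapse_in)
qed

lemma ball_collapse_surj:
  assumes "k \<ge> 1" and y: "y \<in> topspace (nsphere k)"
  shows "\<exists>x \<in> topspace (disc k). ball_collapse k x = y"
proof (cases "y 0 = 1")
  case True
  have "(\<Sum>i<Suc k. (y i)\<^sup>2) = 1" using y by (simp add: topspace_nsphere_iff sum_sq_enorm del: sum.lessThan_Suc)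
  then have "(\<Sum>i<k. (y (Suc i))\<^sup>2) = 0" using True by (subst (asm) sum.lessThan_Suc_shift) simp
  then have *: "y (Suc i) = 0" if "i < k" for i using that by (subst (asm) sum_nonneg_eq_0_iff) auto
  have "y = sphere_pt"
  proof
    fix i show "y i = sphere_pt i"
      using True *[of "i - 1"] y by (cases "i \<le> k") (auto simp: sphere_pt_def topspace_nsphere_iff)
  qed
  moreover have "enorm k sphere_pt = 1" using enorm_sphere_pt[of "k - 1"] assms by simp
  ultimately show ?thesis using assms by (auto intro!: bexI[of _ sphere_pt] sphere_pt_in_disc simp: ball_collapse_boundary)
next
  case False
  have y0: "\<bar>y 0\<bar> \<le> 1" using abs_le_enorm[of 0 "Suc k" y] y by (simp add: topspace_nsphere_iff)
  then have lt: "1 - y 0 > 0" using False by simp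
  \<comment> \<open>The preimage must satisfy \<open>\<bar>x\<bar>\<^sup>2 = (1 + y 0) / 2\<close>, so
    \<open>c\<close> is the factor \<open>2 sqrt (1 - \<bar>x\<bar>\<^sup>2)\<close> of
    \<open>ball_collapse\<close>.\<close>
  define c where "c = 2 * sqrt ((1 - y 0) / 2)"
  define x where "x = (\<lambda>i. if i < k then (1 / c) * y (Suc i) else 0)"
  have c: "c > 0" "c\<^sup>2 = 2 * (1 - y 0)" using lt by (auto simp: c_def power_mult_distrib)
  have "(\<Sum>i<Suc k. (y i)\<^sup>2) = 1" using y by (simp add: topspace_nsphere_iff sum_sq_enorm del: sum.lessThan_Suc)
  then have s: "(enorm k (\<lambda>i. y (Suc i)))\<^sup>2 = 1 - (y 0)\<^sup>2"
    by (subst (asm) sum.lessThan_Suc_shift) (simp add: sum_sq_enorm)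
  have "enorm k x = enorm k (\<lambda>i. (1/c) * y (Suc i))" by (rule enorm_cong) (simp add: x_def)
  then have "(enorm k x)\<^sup>2 = (1 - (y 0)\<^sup>2) / c\<^sup>2"
    by (simp only: enorm_scale s power_mult_distrib) (simp add: power_divide)
  also have "\<dots> = (1 + y 0) / 2" using lt unfolding c(2) by (simp add: power2_eq_square field_simps)
  finally have r: "(enorm k x)\<^sup>2 = (1 + y 0) / 2" .
  then have "(enorm k x)\<^sup>2 \<le> 1\<^sup>2" using y0 by simp
  then have "enorm k x \<le> 1" by (rule power2_le_imp_le) simp
  then have "x \<in> topspace (disc k)" by (simp add: topspace_disc_iff x_def)
  moreover have "ball_collapse k x = y"
  proof
    fix i
    have "1 - (1 + y 0) / 2 = (1 - y 0) / 2" by (simp add: field_simps)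
    then have "2 * sqrt (1 - (enorm k x)\<^sup>2) = c" by (simp add: r c_def)
    then show "ball_collapse k x i = y i"
      using r c y by (auto simp: ball_collapse_def x_def topspace_nsphere_iff)
  qed
  ultimately show ?thesis by blast
qed

lemma ball_collapse_image: "k \<ge> 1 \<Longrightarrow> ball_collapse k ` topspace (disc k) = topspace (nsphere k)"
  using ball_collapse_surj ball_collapse_in by fastforce

section \<open>The boundary of a product of two discs\<close>

text \<open>
  The coordinates \<open>u\<close> and \<open>v\<close> of \<open>whitehead_map\<close>, set to \<open>0\<close> beyond the dimensions of the two discs.
  They form a linear isometry of \<open>\<real>\<^sup>k\<^sup>+\<^sup>m\<close> onto \<open>\<real>\<^sup>k \<times> \<real>\<^sup>m\<close> with inverse \<open>join_coords\<close>.
\<close>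

definition left_coords :: "nat \<Rightarrow> (nat \<Rightarrow> real) \<Rightarrow> nat \<Rightarrow> real" where
  "left_coords k z = (\<lambda>i. if i < k then (if i = 0 then (z 0 + z 1) / sqrt 2 else z (i + 1)) else 0)"

definition right_coords :: "nat \<Rightarrow> nat \<Rightarrow> (nat \<Rightarrow> real) \<Rightarrow> nat \<Rightarrow> real" where
  "right_coords k m z = (\<lambda>i. if i < m then (if i = 0 then (z 0 - z 1) / sqrt 2 else z (k + i)) else 0)"

definition join_coords :: "nat \<Rightarrow> nat \<Rightarrow> (nat \<Rightarrow> real) \<Rightarrow> (nat \<Rightarrow> real) \<Rightarrow> nat \<Rightarrow> real" where
  "join_coords k m u v = (\<lambda>i. if i = 0 then (u 0 + v 0) / sqrt 2 else if i = 1 then (u 0 - v 0) / sqrt 2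
      else if i \<le> k then u (i - 1) else if i < k + m then v (i - k) else 0)"

lemma sum_lessThan_add: "(\<Sum>i<a + b. f i) = (\<Sum>i<a. f i) + (\<Sum>i<b. f (a + i :: nat) :: real)"
  by (induction b) auto

lemma enorm_coords:
  assumes "k \<ge> 1" "m \<ge> 1"
  shows "(enorm (k + m) z)\<^sup>2 = (enorm k (left_coords k z))\<^sup>2 + (enorm m (right_coords k m z))\<^sup>2"
proof -
  obtain a b where ab: "k = Suc a" "m = Suc b" using assms by (metis Suc_le_D One_nat_def)
  have "(enorm k (left_coords k z))\<^sup>2 = (z 0 + z 1)\<^sup>2 / 2 + (\<Sum>i<a. (z (i + 2))\<^sup>2)"
    unfolding ab sum_sq_enorm [symmetric] sum.lessThan_Suc_shift
    by (simp add: left_coords_def power_divide)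
  moreover have "(enorm m (right_coords k m z))\<^sup>2 = (z 0 - z 1)\<^sup>2 / 2 + (\<Sum>i<b. (z (a + i + 2))\<^sup>2)"
    unfolding ab sum_sq_enorm [symmetric] sum.lessThan_Suc_shift
    by (simp add: right_coords_def power_divide)
  moreover have "(enorm (k + m) z)\<^sup>2 = (z 0)\<^sup>2 + (z 1)\<^sup>2 + ((\<Sum>i<a. (z (i + 2))\<^sup>2) + (\<Sum>i<b. (z (a + i + 2))\<^sup>2))"
  proof -
    have "k + m = Suc (Suc (a + b))" using ab by simp
    then have "(enorm (k + m) z)\<^sup>2 = (z 0)\<^sup>2 + (z 1)\<^sup>2 + (\<Sum>i<a + b. (z (i + 2))\<^sup>2)"
      by (simp only: sum_sq_enorm [symmetric] sum.lessThan_Suc_shift) simp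
    then show ?thesis by (simp add: sum_lessThan_add)
  qed
  moreover have "(z 0 + z 1)\<^sup>2 / 2 + (z 0 - z 1)\<^sup>2 / 2 = (z 0)\<^sup>2 + (z 1)\<^sup>2"
    by (simp add: power2_eq_square field_simps)
  ultimately show ?thesis by simp
qed

lemma left_join [simp]:
  assumes "k \<ge> 1" "m \<ge> 1" "\<forall>i\<ge>k. u i = 0" shows "left_coords k (join_coords k m u v) = u"
proof
  fix i
  have "((u 0 + v 0) / sqrt 2 + (u 0 - v 0) / sqrt 2) / sqrt 2 = u 0" by (simp add: field_simps)
  then show "left_coords k (join_coords k m u v) i = u i"
    using assms by (auto simp: left_coords_def join_coords_def)
qed

lemma right_join [simp]:
  assumes "k \<ge> 1" "m \<ge> 1" "\<forall>i\<ge>m. v i = 0" shows "right_coords k m (join_coords k m u v) = v"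
proof
  fix i
  have "((u 0 + v 0) / sqrt 2 - (u 0 - v 0) / sqrt 2) / sqrt 2 = v 0" by (simp add: field_simps)
  then show "right_coords k m (join_coords k m u v) i = v i"
    using assms by (auto simp: right_coords_def join_coords_def)
qed

lemma join_coords_eq:
  assumes "k \<ge> 1" "m \<ge> 1" "\<forall>i\<ge>k + m. z i = 0"
  shows "join_coords k m (left_coords k z) (right_coords k m z) = z"
proof
  fix i
  have "((z 0 + z 1) / sqrt 2 + (z 0 - z 1) / sqrt 2) / sqrt 2 = z 0"
       "((z 0 + z 1) / sqrt 2 - (z 0 - z 1) / sqrt 2) / sqrt 2 = z 1" by (simp_all add: field_simps)
  then show "join_coords k m (left_coords k z) (right_coords k m z) i = z i"
    using assms by (auto simp: left_coords_def right_coords_def join_coords_def)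
qed

lemma coords_scale:
  "left_coords k (\<lambda>i. s * z i) = (\<lambda>i. s * left_coords k z i)"
  "right_coords k m (\<lambda>i. s * z i) = (\<lambda>i. s * right_coords k m z i)"
  by (auto simp: left_coords_def right_coords_def algebra_simps fun_eq_iff)

definition coords_max :: "nat \<Rightarrow> nat \<Rightarrow> (nat \<Rightarrow> real) \<Rightarrow> real" where
  "coords_max k m z = max (enorm k (left_coords k z)) (enorm m (right_coords k m z))"

text \<open>
  Together with \<open>right_bd\<close>, the radial homeomorphism from the sphere onto the boundary of
  \<open>D\<^sup>k \<times> D\<^sup>m\<close>.
\<close>

definition left_bd :: "nat \<Rightarrow> nat \<Rightarrow> (nat \<Rightarrow> real) \<Rightarrow> nat \<Rightarrow> real" where
  "left_bd k m z = (\<lambda>i. left_coords k z i / coords_max k m z)"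

definition right_bd :: "nat \<Rightarrow> nat \<Rightarrow> (nat \<Rightarrow> real) \<Rightarrow> nat \<Rightarrow> real" where
  "right_bd k m z = (\<lambda>i. right_coords k m z i / coords_max k m z)"

lemma enorm_divide: "enorm m (\<lambda>i. x i / s) = enorm m x / \<bar>s\<bar>"
  using enorm_scale[of m "1 / s" x] by simp

lemma coords_max_pos:
  assumes "k \<ge> 1" "m \<ge> 1" "z \<in> topspace (nsphere (k + m - 1))"
  shows "coords_max k m z > 0"
proof -
  have "enorm (k + m) z = 1" using assms by (simp add: topspace_nsphere_iff)
  then have "(enorm k (left_coords k z))\<^sup>2 + (enorm m (right_coords k m z))\<^sup>2 = 1"
    using enorm_coords[of k m z] assms by simp
  then have "enorm k (left_coords k z) \<noteq> 0 \<or> enorm m (right_coords k m z) \<noteq> 0" by auto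
  then show ?thesis unfolding coords_max_def
    using enorm_nonneg[of k "left_coords k z"] enorm_nonneg[of m "right_coords k m z"] by linarith
qed

lemma bd_in_disc:
  assumes "k \<ge> 1" "m \<ge> 1" "z \<in> topspace (nsphere (k + m - 1))"
  shows "left_bd k m z \<in> topspace (disc k)" "right_bd k m z \<in> topspace (disc m)"
    "max (enorm k (left_bd k m z)) (enorm m (right_bd k m z)) = 1"
proof -
  have c: "coords_max k m z > 0" by (rule coords_max_pos[OF assms])
  have "enorm k (left_bd k m z) = enorm k (left_coords k z) / coords_max k m z"
    "enorm m (right_bd k m z) = enorm m (right_coords k m z) / coords_max k m z"
    using c by (simp_all add: left_bd_def right_bd_def enorm_divide)
  then have *: "max (enorm k (left_bd k m z)) (enorm m (right_bd k m z)) = coords_max k m z / coords_max k m z"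
    using c max_divide_distrib_right[of "enorm k (left_coords k z)" "enorm m (right_coords k m z)" "coords_max k m z"]
    by (simp add: coords_max_def)
  then show "max (enorm k (left_bd k m z)) (enorm m (right_bd k m z)) = 1" using c by simp
  then show "left_bd k m z \<in> topspace (disc k)" "right_bd k m z \<in> topspace (disc m)"
    by (auto simp: topspace_disc_iff left_bd_def right_bd_def left_coords_def right_coords_def)
qed

lemma ball_collapse_cong: "(\<And>i. i < k \<Longrightarrow> x i = y i) \<Longrightarrow> ball_collapse k x = ball_collapse k y"
  using enorm_cong[of k x y] by (auto simp: ball_collapse_def fun_eq_iff)

lemma whitehead_map_alt:
  "whitehead_map k m \<alpha> \<beta> z =
     (if enorm m (right_coords k m z) \<le> enorm k (left_coords k z)
      then \<beta> (ball_collapse m (\<lambda>i. right_coords k m z i / enorm k (left_coords k z)))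
      else \<alpha> (ball_collapse k (\<lambda>i. left_coords k z i / enorm m (right_coords k m z))))"
proof -
  define u where "u = (\<lambda>i. if i = 0 then (z 0 + z 1) / sqrt 2 else z (i + 1))"
  define v where "v = (\<lambda>i. if i = 0 then (z 0 - z 1) / sqrt 2 else z (k + i))"
  have e: "enorm k u = enorm k (left_coords k z)" "enorm m v = enorm m (right_coords k m z)"
    by (rule enorm_cong; simp add: u_def v_def left_coords_def right_coords_def)+
  have b: "ball_collapse k (\<lambda>i. u i / s) = ball_collapse k (\<lambda>i. left_coords k z i / s)"
      "ball_collapse m (\<lambda>i. v i / s) = ball_collapse m (\<lambda>i. right_coords k m z i / s)" for s
    by (rule ball_collapse_cong; simp add: u_def v_def left_coords_def right_coords_def)+
  show ?thesis
    unfolding whitehead_map_def Let_def u_def [symmetric] v_def [symmetric] e b by simp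
qed

text \<open>
  The map \<open>\<alpha> \<or> \<beta>\<close> on the union of the two axes of a product of spheres.
\<close>

definition axes_map :: "((nat \<Rightarrow> real) \<Rightarrow> 'b) \<Rightarrow> ((nat \<Rightarrow> real) \<Rightarrow> 'b) \<Rightarrow> (nat \<Rightarrow> real) \<times> (nat \<Rightarrow> real) \<Rightarrow> 'b" where
  "axes_map \<alpha> \<beta> p = (if fst p = sphere_pt then \<beta> (snd p) else \<alpha> (fst p))"

text \<open>
  The universal example: a Whitehead product is the map \<open>\<alpha> \<or> \<beta>\<close> after the attaching map of the top
  cell of the product of two spheres.
\<close>

lemma whitehead_map_eq_axes_map:
  assumes "k \<ge> 1" "m \<ge> 1" "z \<in> topspace (nsphere (k + m - 1))"
  shows "whitehead_map k m \<alpha> \<beta> z =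
    axes_map \<alpha> \<beta> (ball_collapse k (left_bd k m z), ball_collapse m (right_bd k m z))"
proof -
  have c: "coords_max k m z > 0" by (rule coords_max_pos[OF assms])
  have n: "enorm k (left_bd k m z) = enorm k (left_coords k z) / coords_max k m z"
    using c by (simp add: left_bd_def enorm_divide)
  show ?thesis
  proof (cases "enorm m (right_coords k m z) \<le> enorm k (left_coords k z)")
    case True
    then have m: "coords_max k m z = enorm k (left_coords k z)" by (simp add: coords_max_def)
    then have "ball_collapse k (left_bd k m z) = sphere_pt"
      using n c by (intro ball_collapse_boundary) simp
    then show ?thesis using True m by (simp add: whitehead_map_alt axes_map_def right_bd_def)
  next
    case False
    then have m: "coords_max k m z = enorm m (right_coords k m z)" by (simp add: coords_max_def)
    then have "enorm k (left_bd k m z) \<noteq> 1" using n c False by auto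
    then have "ball_collapse k (left_bd k m z) \<noteq> sphere_pt" using ball_collapse_eq_pt by blast
    then show ?thesis using False m by (simp add: whitehead_map_alt axes_map_def left_bd_def)
  qed
qed

lemma continuous_map_coords:
  assumes "\<And>i. continuous_map X euclideanreal (\<lambda>x. f x i)"
  shows "continuous_map X euclideanreal (\<lambda>x. left_coords k (f x) i)"
    "continuous_map X euclideanreal (\<lambda>x. right_coords k m (f x) i)"
proof -
  show "continuous_map X euclideanreal (\<lambda>x. left_coords k (f x) i)"
    unfolding left_coords_def
    by (cases "i < k"; cases "i = 0"; simp; intro continuous_intros assms) auto
  show "continuous_map X euclideanreal (\<lambda>x. right_coords k m (f x) i)"
    unfolding right_coords_def
    by (cases "i < m"; cases "i = 0"; simp; intro continuous_intros assms) auto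
qed

lemma continuous_map_enorm_coords:
  assumes "\<And>i. continuous_map X euclideanreal (\<lambda>x. f x i)"
  shows "continuous_map X euclideanreal (\<lambda>x. enorm k (left_coords k (f x)))"
    "continuous_map X euclideanreal (\<lambda>x. enorm m (right_coords k m (f x)))"
  by (intro continuous_map_enorm continuous_map_coords assms)+

lemma continuous_map_max:
  assumes "continuous_map X euclideanreal f" "continuous_map X euclideanreal g"
  shows "continuous_map X euclideanreal (\<lambda>x. max (f x) (g x))"
proof -
  have "continuous_map X euclideanreal (\<lambda>x. (f x + g x + \<bar>f x - g x\<bar>) / 2)"
    by (intro continuous_intros assms) auto
  moreover have "(f x + g x + \<bar>f x - g x\<bar>) / 2 = max (f x) (g x)" for x by (simp add: max_def)
  ultimately show ?thesis by simp
qed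

lemma continuous_map_bd:
  assumes "k \<ge> 1" "m \<ge> 1"
  shows "continuous_map (nsphere (k + m - 1)) (disc k) (left_bd k m)"
    "continuous_map (nsphere (k + m - 1)) (disc m) (right_bd k m)"
proof -
  have co: "continuous_map (nsphere (k + m - 1)) euclideanreal (\<lambda>x. x i)" for i
    by (rule continuous_map_nsphere_projection)
  have "continuous_map (nsphere (k + m - 1)) euclideanreal (coords_max k m)"
    unfolding coords_max_def
    by (intro continuous_map_max continuous_map_enorm_coords co)
  then have "continuous_map (nsphere (k + m - 1)) euclideanreal (\<lambda>z. left_bd k m z i)"
    "continuous_map (nsphere (k + m - 1)) euclideanreal (\<lambda>z. right_bd k m z i)" for i
    unfolding left_bd_def right_bd_def
    using coords_max_pos[OF assms]
    by (fastforce intro!: continuous_map_real_divide continuous_map_coords co)+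
  then show "continuous_map (nsphere (k + m - 1)) (disc k) (left_bd k m)"
    "continuous_map (nsphere (k + m - 1)) (disc m) (right_bd k m)"
    using bd_in_disc[OF assms] by (auto simp: continuous_map_coordinatewise)
qed

text \<open>
  The parameter space \<open>T\<close> is there to transport homotopies of \<open>\<alpha>\<close> and \<open>\<beta>\<close> to their Whitehead product.
  The boundary of \<open>D\<^sup>k \<times> D\<^sup>m\<close> is the union of two closed pieces, on whose intersection both formulas
  give the value at the base point.
\<close>

lemma continuous_map_whitehead_family:
  assumes km: "k \<ge> 1" "m \<ge> 1"
    and H: "continuous_map (prod_topology T (nsphere k)) X H"
    and K: "continuous_map (prod_topology T (nsphere m)) X K"
    and HK: "\<And>t. t \<in> topspace T \<Longrightarrow> H (t, sphere_pt) = K (t, sphere_pt)"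
  shows "continuous_map (prod_topology T (nsphere (k + m - 1))) X
           (\<lambda>(t, z). whitehead_map k m (\<lambda>x. H (t, x)) (\<lambda>y. K (t, y)) z)"
proof -
  let ?S = "nsphere (k + m - 1)"
  let ?P = "prod_topology T ?S"
  let ?a = "\<lambda>p. enorm k (left_bd k m (snd p))"
  let ?b = "\<lambda>p. enorm m (right_bd k m (snd p))"
  let ?l = "\<lambda>p. ball_collapse k (left_bd k m (snd p))"
  let ?r = "\<lambda>p. ball_collapse m (right_bd k m (snd p))"
  have cl: "continuous_map ?P (disc k) (\<lambda>p. left_bd k m (snd p))"
    and cr: "continuous_map ?P (disc m) (\<lambda>p. right_bd k m (snd p))"
    using continuous_map_compose[OF continuous_map_snd continuous_map_bd(1)[OF km], of T]
      continuous_map_compose[OF continuous_map_snd continuous_map_bd(2)[OF km], of T]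
    by (simp_all add: o_def)
  have l: "continuous_map ?P (nsphere k) ?l" and r: "continuous_map ?P (nsphere m) ?r"
    using continuous_map_compose[OF cl continuous_map_ball_collapse]
      continuous_map_compose[OF cr continuous_map_ball_collapse] by (simp_all add: o_def)
  have "continuous_map ?P X (\<lambda>p. if ?b p \<le> ?a p then K (fst p, ?r p) else H (fst p, ?l p))"
  proof (rule continuous_map_cases_le)
    show "continuous_map ?P euclideanreal ?b" "continuous_map ?P euclideanreal ?a"
      by (intro continuous_map_enorm continuous_map_coordinate(2)[OF cl] continuous_map_coordinate(2)[OF cr])+
    have "continuous_map ?P (prod_topology T (nsphere m)) (\<lambda>p. (fst p, ?r p))"
      "continuous_map ?P (prod_topology T (nsphere k)) (\<lambda>p. (fst p, ?l p))"
      by (intro continuous_map_pairedI continuous_map_fst l r)+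
    then have "continuous_map ?P X (K \<circ> (\<lambda>p. (fst p, ?r p)))" "continuous_map ?P X (H \<circ> (\<lambda>p. (fst p, ?l p)))"
      using continuous_map_compose K H by blast+
    then show "continuous_map (subtopology ?P {p \<in> topspace ?P. ?b p \<le> ?a p}) X (\<lambda>p. K (fst p, ?r p))"
      "continuous_map (subtopology ?P {p \<in> topspace ?P. ?a p \<le> ?b p}) X (\<lambda>p. H (fst p, ?l p))"
      by (auto simp: o_def intro: continuous_map_from_subtopology)
    fix p assume p: "p \<in> topspace ?P" "?b p = ?a p"
    then have "snd p \<in> topspace ?S" "fst p \<in> topspace T" by auto
    then have "?a p = 1" "?b p = 1" using p bd_in_disc(3)[OF km, of "snd p"] by simp_all
    then have "?l p = sphere_pt" "?r p = sphere_pt" by (simp_all add: ball_collapse_boundary)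
    then show "K (fst p, ?r p) = H (fst p, ?l p)" using HK \<open>fst p \<in> topspace T\<close> by simp
  qed
  then show ?thesis
  proof (rule continuous_map_eq)
    fix p assume "p \<in> topspace ?P"
    then have z: "snd p \<in> topspace ?S" and "fst p \<in> topspace T" by auto
    have m: "max (?a p) (?b p) = 1" by (rule bd_in_disc(3)[OF km z])
    have "(if ?b p \<le> ?a p then K (fst p, ?r p) else H (fst p, ?l p)) =
      axes_map (\<lambda>x. H (fst p, x)) (\<lambda>y. K (fst p, y)) (?l p, ?r p)"
    proof (cases "?b p \<le> ?a p")
      case True
      then have "?l p = sphere_pt" using m by (intro ball_collapse_boundary) simp
      then show ?thesis using True by (simp add: axes_map_def)
    next
      case False
      then have "?l p \<noteq> sphere_pt" using m ball_collapse_eq_pt[of k "left_bd k m (snd p)"] by auto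
      then show ?thesis using False by (simp add: axes_map_def)
    qed
    then show "(if ?b p \<le> ?a p then K (fst p, ?r p) else H (fst p, ?l p)) =
        (\<lambda>(t, z). whitehead_map k m (\<lambda>x. H (t, x)) (\<lambda>y. K (t, y)) z) p"
      by (simp add: case_prod_unfold whitehead_map_eq_axes_map[OF km z])
  qed
qed

section \<open>Whitehead products as extension problems\<close>

lemma compact_quotient_factor:
  assumes "continuous_map X Y q" "compact_space X" "Hausdorff_space Y" "q ` topspace X = topspace Y"
    and "continuous_map X Z h"
    and "\<And>x y. \<lbrakk>x \<in> topspace X; y \<in> topspace X; q x = q y\<rbrakk> \<Longrightarrow> h x = h y"
  obtains g where "continuous_map Y Z g" "\<And>x. x \<in> topspace X \<Longrightarrow> g (q x) = h x"
proof (rule quotient_map_lift_exists[OF continuous_imp_quotient_map[OF assms(1-4)] assms(5)])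
  show "h x = h y" if "x \<in> topspace X" "y \<in> topspace X" "q x = q y" for x y
    using that by (rule assms(6))
qed (rule that)

lemma compact_space_unit_prod: "compact_space X \<Longrightarrow> compact_space (prod_topology (top_of_set {0..1::real}) X)"
  by (simp add: compact_space_prod_topology compact_space_subtopology)

text \<open>
  The extension problem equivalent to the vanishing of \<open>[\<alpha>, \<beta>]\<close>.
\<close>

definition axes_extend :: "nat \<Rightarrow> nat \<Rightarrow> 'b topology \<Rightarrow> ((nat \<Rightarrow> real) \<Rightarrow> 'b) \<Rightarrow> ((nat \<Rightarrow> real) \<Rightarrow> 'b) \<Rightarrow> bool" where
  "axes_extend k m X \<alpha> \<beta> \<longleftrightarrow>
     (\<exists>F. continuous_map (prod_topology (nsphere k) (nsphere m)) X F \<and>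
        (\<forall>x\<in>topspace (nsphere k). F (x, sphere_pt) = \<alpha> x) \<and>
        (\<forall>y\<in>topspace (nsphere m). F (sphere_pt, y) = \<beta> y))"

lemma axes_extend_sym: 
  assumes "axes_extend k m X \<alpha> \<beta>" shows "axes_extend m k X \<beta> \<alpha>"
proof -
  obtain F where F: "continuous_map (prod_topology (nsphere k) (nsphere m)) X F"
    "\<forall>x\<in>topspace (nsphere k). F (x, sphere_pt) = \<alpha> x" "\<forall>y\<in>topspace (nsphere m). F (sphere_pt, y) = \<beta> y"
    using assms by (auto simp: axes_extend_def)
  have "continuous_map (prod_topology (nsphere m) (nsphere k)) X (F \<circ> (\<lambda>p. (snd p, fst p)))"
    by (rule continuous_map_compose[OF _ F(1)]) (intro continuous_map_pairedI continuous_map_fst continuous_map_snd)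
  then show ?thesis using F(2,3) unfolding axes_extend_def
    by (intro exI[of _ "F \<circ> (\<lambda>p. (snd p, fst p))"]) auto
qed

lemma sphere_pt_bd:
  assumes "k \<ge> 1" "m \<ge> 1"
  shows "left_bd k m sphere_pt = sphere_pt" "right_bd k m sphere_pt = sphere_pt"
proof -
  obtain a b where ab: "k = Suc a" "m = Suc b" using assms by (metis Suc_le_D One_nat_def)
  have l: "left_coords k sphere_pt = (\<lambda>i. (1 / sqrt 2) * sphere_pt i)"
    and r: "right_coords k m sphere_pt = (\<lambda>i. (1 / sqrt 2) * sphere_pt i)"
    using assms by (auto simp: left_coords_def right_coords_def sphere_pt_def fun_eq_iff)
  then have "coords_max k m sphere_pt = 1 / sqrt 2"
    unfolding coords_max_def l r enorm_scale by (simp add: ab enorm_sphere_pt)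
  then show "left_bd k m sphere_pt = sphere_pt" "right_bd k m sphere_pt = sphere_pt"
    unfolding left_bd_def right_bd_def l r by auto
qed

text \<open>
  The given map on the product of spheres, composed with the collapse, is defined on all of
  \<open>D\<^sup>k \<times> D\<^sup>m\<close>.  The boundary is contracted in this convex set to the boundary point that corresponds
  to the base point, rather than to the centre, so that the base point stays fixed.
\<close>

lemma nullhomotopic_of_axes_extend:
  assumes km: "k \<ge> 1" "m \<ge> 1" and ext: "axes_extend k m X \<alpha> \<beta>" and x0: "\<alpha> sphere_pt = x0"
  shows "homotopic_with (\<lambda>h. h sphere_pt = x0) (nsphere (k + m - 1)) X (whitehead_map k m \<alpha> \<beta>) (\<lambda>_. x0)"
proof -
  let ?S = "nsphere (k + m - 1)" and ?I = "top_of_set {0..1::real}"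
  obtain F where F: "continuous_map (prod_topology (nsphere k) (nsphere m)) X F"
    "\<And>x. x\<in>topspace (nsphere k) \<Longrightarrow> F (x, sphere_pt) = \<alpha> x"
    "\<And>y. y\<in>topspace (nsphere m) \<Longrightarrow> F (sphere_pt, y) = \<beta> y"
    using ext by (auto simp: axes_extend_def)
  have slide: "continuous_map (prod_topology ?I ?S) (nsphere j) (\<lambda>p. ball_collapse j (\<lambda>i. (1 - fst p) * f (snd p) i + fst p * sphere_pt i))"
    if f: "continuous_map ?S (disc j) f" and j: "j \<ge> 1" for f j
  proof -
    have fs: "continuous_map (prod_topology ?I ?S) (disc j) (\<lambda>p. f (snd p))"
      using continuous_map_compose[OF continuous_map_snd f] by (simp add: o_def)
    note fst = continuous_map_interval_fst[of ?S]
    have "(\<lambda>i. (1 - fst p) * f (snd p) i + fst p * sphere_pt i) \<in> topspace (disc j)"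
      if "p \<in> topspace (prod_topology ?I ?S)" for p
      using that fs sphere_pt_in_disc[OF j] by (intro convex_disc) (auto simp: continuous_map_def)
    then have "continuous_map (prod_topology ?I ?S) (disc j) (\<lambda>p i. (1 - fst p) * f (snd p) i + fst p * sphere_pt i)"
      unfolding continuous_map_coordinatewise(2)
      by (intro conjI allI Pi_I continuous_intros fst continuous_map_coordinate(2)[OF fs])
    from continuous_map_compose[OF this continuous_map_ball_collapse] show ?thesis by (simp add: o_def)
  qed
  define h where "h = F \<circ> (\<lambda>p. (ball_collapse k (\<lambda>i. (1 - fst p) * left_bd k m (snd p) i + fst p * sphere_pt i),
      ball_collapse m (\<lambda>i. (1 - fst p) * right_bd k m (snd p) i + fst p * sphere_pt i)))"
  have ch: "continuous_map (prod_topology ?I ?S) X h"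
    unfolding h_def
    by (rule continuous_map_compose[OF _ F(1)]) (intro continuous_map_pairedI slide continuous_map_bd km)
  note bp = ball_collapse_sphere_pt
  have Fp: "F (sphere_pt, sphere_pt) = x0" using F(2) x0 sphere_pt_in by blast
  show ?thesis
  proof (subst homotopic_with)
    show "\<exists>h. continuous_map (prod_topology ?I ?S) X h \<and>
        (\<forall>x\<in>topspace ?S. h (0, x) = whitehead_map k m \<alpha> \<beta> x) \<and>
        (\<forall>x\<in>topspace ?S. h (1, x) = x0) \<and> (\<forall>t\<in>{0..1}. h (t, sphere_pt) = x0)"
    proof (intro exI conjI ballI)
      show "continuous_map (prod_topology ?I ?S) X h" by (rule ch)
      fix z assume z: "z \<in> topspace ?S"
      let ?u = "left_bd k m z" and ?v = "right_bd k m z"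
      note bd = bd_in_disc[OF km z]
      have "F (ball_collapse k ?u, ball_collapse m ?v) = axes_map \<alpha> \<beta> (ball_collapse k ?u, ball_collapse m ?v)"
      proof (cases "ball_collapse k ?u = sphere_pt")
        case True then show ?thesis using F(3) ball_collapse_in[OF bd(2)] by (simp add: axes_map_def)
      next
        case False
        then have "enorm k ?u \<noteq> 1" using ball_collapse_boundary by blast
        then have "enorm m ?v = 1" using bd(3) by (auto simp: max_def split: if_splits)
        then show ?thesis using False F(2) ball_collapse_in[OF bd(1)]
          by (simp add: axes_map_def ball_collapse_boundary)
      qed
      then show "h (0, z) = whitehead_map k m \<alpha> \<beta> z"
        by (simp add: h_def whitehead_map_eq_axes_map[OF km z])
      show "h (1, z) = x0" using bp[OF km(1)] bp[OF km(2)] Fp by (simp add: h_def)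
    next
      fix t :: real assume "t \<in> {0..1}"
      have "(\<lambda>i. (1 - t) * sphere_pt i + t * sphere_pt i) = sphere_pt" by (auto simp: algebra_simps)
      then show "h (t, sphere_pt) = x0"
        using sphere_pt_bd[OF km] bp[OF km(1)] bp[OF km(2)] Fp by (simp add: h_def)
    qed
  qed (use sphere_pt_in in auto)
qed

text \<open>
  Every point of \<open>D\<^sup>k \<times> D\<^sup>m\<close> other than the centre lies on the ray through exactly one boundary
  point; \<open>bd_inj\<close> is the uniqueness.
\<close>

lemma bd_surj:
  assumes km: "k \<ge> 1" "m \<ge> 1" and U: "U \<in> topspace (disc k)" and V: "V \<in> topspace (disc m)"
    and \<rho>: "\<rho> = max (enorm k U) (enorm m V)" "\<rho> > 0"
  obtains z where "z \<in> topspace (nsphere (k + m - 1))"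
    "(\<lambda>i. \<rho> * left_bd k m z i) = U" "(\<lambda>i. \<rho> * right_bd k m z i) = V"
proof -
  define w where "w = join_coords k m U V"
  have w: "left_coords k w = U" "right_coords k m w = V"
    using U V km by (simp_all add: w_def topspace_disc_iff)
  define N where "N = enorm (k + m) w"
  have "N\<^sup>2 = (enorm k U)\<^sup>2 + (enorm m V)\<^sup>2" by (simp add: N_def enorm_coords[OF km] w)
  moreover have "(enorm k U)\<^sup>2 + (enorm m V)\<^sup>2 > 0" using \<rho> by (auto simp: max_def add_nonneg_pos add_pos_nonneg split: if_splits)
  ultimately have "N \<noteq> 0" by auto
  then have N: "N > 0" using enorm_nonneg[of "k + m" w] unfolding N_def by linarith
  define z where "z = (\<lambda>i. (1 / N) * w i)"
  have "enorm (k + m) z = 1" using N by (simp only: z_def enorm_scale N_def [symmetric]) simp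
  then have "z \<in> topspace (nsphere (k + m - 1))"
    using km by (auto simp: topspace_nsphere_iff z_def w_def join_coords_def)
  moreover have l: "left_coords k z = (\<lambda>i. (1 / N) * U i)" "right_coords k m z = (\<lambda>i. (1 / N) * V i)"
    by (simp_all only: z_def coords_scale w)
  moreover have "coords_max k m z = \<rho> / N"
    unfolding coords_max_def l enorm_scale \<rho>(1)
    using N max_divide_distrib_right[of "enorm k U" "enorm m V" N] by simp
  ultimately show ?thesis using that[of z] N \<rho>(2) by (simp add: left_bd_def right_bd_def)
qed

lemma bd_inj:
  assumes km: "k \<ge> 1" "m \<ge> 1" and z: "z \<in> topspace (nsphere (k + m - 1))" and y: "y \<in> topspace (nsphere (k + m - 1))"
    and eq: "left_bd k m z = left_bd k m y" "right_bd k m z = right_bd k m y"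
  shows "z = y"
proof -
  let ?c = "\<lambda>z. 1 / coords_max k m z"
  have c: "?c z > 0" "?c y > 0" using coords_max_pos[OF km] z y by simp_all
  have l: "left_coords k (\<lambda>i. ?c z * z i) = left_bd k m z" "right_coords k m (\<lambda>i. ?c z * z i) = right_bd k m z" for z
    unfolding coords_scale by (simp_all add: left_bd_def right_bd_def)
  have s: "enorm (k + m) x = 1" "\<forall>i\<ge>k+m. ?c x * x i = 0" if "x \<in> topspace (nsphere (k + m - 1))" for x
    using that km by (simp_all add: topspace_nsphere_iff)
  have e: "(\<lambda>i. ?c z * z i) = (\<lambda>i. ?c y * y i)"
    using join_coords_eq[OF km s(2)[OF z]] join_coords_eq[OF km s(2)[OF y]] l[of z] l[of y] eq by metis
  then have "enorm (k + m) (\<lambda>i. ?c z * z i) = enorm (k + m) (\<lambda>i. ?c y * y i)" by simp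
  then have "?c z = ?c y" unfolding enorm_scale s(1)[OF z] s(1)[OF y] using c by simp
  then have "z i = y i" for i using fun_cong[OF e, of i] c by auto
  then show ?thesis by blast
qed

text \<open>
  A null-homotopy of the Whitehead product is a map on the cone over the boundary of \<open>D\<^sup>k \<times> D\<^sup>m\<close>,
  which is \<open>D\<^sup>k \<times> D\<^sup>m\<close> itself.  On the boundary it has the value of \<open>\<alpha> \<or> \<beta>\<close> at the collapsed point, so
  it factors through the product of the two spheres.
\<close>

lemma axes_extend_of_nullhomotopic:
  assumes km: "k \<ge> 1" "m \<ge> 1" and x0: "\<alpha> sphere_pt = x0" "\<beta> sphere_pt = x0"
    and null: "homotopic_with (\<lambda>h. h sphere_pt = x0) (nsphere (k + m - 1)) X (whitehead_map k m \<alpha> \<beta>) (\<lambda>_. x0)"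
  shows "axes_extend k m X \<alpha> \<beta>"
proof -
  let ?S = "nsphere (k + m - 1)" and ?I = "top_of_set {0..1::real}"
  let ?U = "\<lambda>p i. (1 - fst p) * left_bd k m (snd p) i"
  let ?V = "\<lambda>p i. (1 - fst p) * right_bd k m (snd p) i"
  \<comment> \<open>\<open>(?U p, ?V p)\<close> is the point at the fraction \<open>1 - t\<close> of the ray
    from the centre of the product of discs to a boundary point, so that \<open>?Q\<close> is
    the map from the cylinder to the cone followed by the collapse.\<close>
  let ?Q = "\<lambda>p. (ball_collapse k (?U p), ball_collapse m (?V p))"
  let ?P = "prod_topology ?I ?S"
  obtain h where h: "continuous_map ?P X h" "\<And>x. h (0, x) = whitehead_map k m \<alpha> \<beta> x" "\<And>x. h (1, x) = x0"
    using null unfolding homotopic_with_def by blast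
  note fst = continuous_map_interval_fst[of ?S]
  have UV: "?U p \<in> topspace (disc k)" "?V p \<in> topspace (disc m)"
      "max (enorm k (?U p)) (enorm m (?V p)) = 1 - fst p" if p: "p \<in> topspace ?P" for p
  proof -
    have t: "0 \<le> fst p" "fst p \<le> 1" and z: "snd p \<in> topspace ?S" using p by auto
    note bd = bd_in_disc[OF km z]
    have "max (enorm k (?U p)) (enorm m (?V p)) =
        (1 - fst p) * max (enorm k (left_bd k m (snd p))) (enorm m (right_bd k m (snd p)))"
      using t by (simp only: enorm_scale) (simp add: max_mult_distrib_left)
    then show m: "max (enorm k (?U p)) (enorm m (?V p)) = 1 - fst p" using bd(3) by simp
    show "?U p \<in> topspace (disc k)" "?V p \<in> topspace (disc m)"
      using m t bd by (auto simp: topspace_disc_iff)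
  qed
  have cs: "continuous_map ?P (disc k) (\<lambda>p. left_bd k m (snd p))"
    "continuous_map ?P (disc m) (\<lambda>p. right_bd k m (snd p))"
    using continuous_map_compose[OF continuous_map_snd continuous_map_bd(1)[OF km], of ?I]
      continuous_map_compose[OF continuous_map_snd continuous_map_bd(2)[OF km], of ?I]
    by (simp_all add: o_def)
  have cU: "continuous_map ?P (disc k) ?U" and cV: "continuous_map ?P (disc m) ?V"
    unfolding continuous_map_coordinatewise(2)
    by (intro conjI allI Pi_I UV continuous_intros fst continuous_map_coordinate(2)[OF cs(1)]
        continuous_map_coordinate(2)[OF cs(2)]; assumption)+
  have cQ: "continuous_map ?P (prod_topology (nsphere k) (nsphere m)) ?Q"
    using continuous_map_compose[OF cU continuous_map_ball_collapse] continuous_map_compose[OF cV continuous_map_ball_collapse]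
    by (intro continuous_map_pairedI) (simp_all add: o_def)
  have hit: "\<exists>p\<in>topspace ?P. ?U p = U \<and> ?V p = V" if U: "U \<in> topspace (disc k)" and V: "V \<in> topspace (disc m)" for U V
  proof (cases "max (enorm k U) (enorm m V) = 0")
    case True
    then have "enorm k U = 0" "enorm m V = 0"
      using enorm_nonneg[of k U] enorm_nonneg[of m V] by linarith+
    then have "U i = 0" "V i = 0" for i
      using enorm_eq_0[of k U i] enorm_eq_0[of m V i] U V by (cases "i < k"; cases "i < m"; simp add: topspace_disc_iff)+
    then show ?thesis using sphere_pt_in by (intro bexI[of _ "(1, sphere_pt)"]) auto
  next
    case False
    define \<rho> where "\<rho> = max (enorm k U) (enorm m V)"
    have \<rho>: "\<rho> > 0" "\<rho> \<le> 1" using False enorm_nonneg[of k U] U V unfolding \<rho>_def topspace_disc_iff by linarith+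
    obtain z where z: "z \<in> topspace ?S" "(\<lambda>i. \<rho> * left_bd k m z i) = U" "(\<lambda>i. \<rho> * right_bd k m z i) = V"
      using bd_surj[OF km U V \<rho>_def \<rho>(1)] .
    then show ?thesis using \<rho> by (intro bexI[of _ "(1 - \<rho>, z)"]) auto
  qed
  have surj: "?Q ` topspace ?P = topspace (prod_topology (nsphere k) (nsphere m))"
  proof
    show "?Q ` topspace ?P \<subseteq> topspace (prod_topology (nsphere k) (nsphere m))"
      using cQ by (rule continuous_map_image_subset_topspace)
    show "topspace (prod_topology (nsphere k) (nsphere m)) \<subseteq> ?Q ` topspace ?P"
    proof clarsimp
      fix x y assume "x \<in> topspace (nsphere k)" "y \<in> topspace (nsphere m)"
      then obtain U V where "U \<in> topspace (disc k)" "V \<in> topspace (disc m)" "x = ball_collapse k U" "y = ball_collapse m V"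
        using ball_collapse_surj km by metis
      then show "(x, y) \<in> ?Q ` ({0..1} \<times> topspace (nsphere (k + m - Suc 0)))"
        using hit[of U V] by force
    qed
  qed
  have h0: "h (0, z) = axes_map \<alpha> \<beta> (?Q (0, z))" if "z \<in> topspace ?S" for z
    by (simp add: h(2) whitehead_map_eq_axes_map[OF km that])
  have fib: "h p = h p'" if p: "p \<in> topspace ?P" "p' \<in> topspace ?P" and eq: "?Q p = ?Q p'" for p p'
  proof -
    note u = UV[OF p(1)] and u' = UV[OF p(2)]
    have st: "fst p \<in> {0..1}" "fst p' \<in> {0..1}" "snd p \<in> topspace ?S" "snd p' \<in> topspace ?S" using p by auto
    have "?U p = ?U p' \<or> enorm k (?U p) = 1 \<and> enorm k (?U p') = 1"
      "?V p = ?V p' \<or> enorm m (?V p) = 1 \<and> enorm m (?V p') = 1"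
      using ball_collapse_eq_iff u(1,2) u'(1,2) eq by blast+
    \<comment> \<open>Two points of the cylinder with the same image give the same point of the product of discs,
      or both lie over its boundary.\<close>
    then consider "?U p = ?U p'" "?V p = ?V p'" | "fst p = 0" "fst p' = 0"
      using u(3) u'(3) st unfolding atLeastAtMost_iff by linarith
    then show ?thesis
    proof cases
      case 1
      then have f: "fst p = fst p'" using u(3) u'(3) by simp
      show ?thesis
      proof (cases "fst p = 1")
        case True then show ?thesis using f h(3) by (metis prod.collapse)
      next
        case False
        have "left_bd k m (snd p) = left_bd k m (snd p')" "right_bd k m (snd p) = right_bd k m (snd p')"
          using 1 False unfolding fun_eq_iff f by auto
        then have "snd p = snd p'" using bd_inj[OF km st(3,4)] by blast
        then show ?thesis using f by (metis prod.collapse)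
      qed
    next
      case 2
      then have "p = (0, snd p)" "p' = (0, snd p')" by (metis prod.collapse)+
      then show ?thesis using h0 st eq by metis
    qed
  qed
  obtain F where F: "continuous_map (prod_topology (nsphere k) (nsphere m)) X F"
    "\<And>p. p \<in> topspace ?P \<Longrightarrow> F (?Q p) = h p"
    by (rule compact_quotient_factor[OF cQ compact_space_unit_prod[OF compact_space_nsphere] _ surj h(1) fib])
      (auto simp: Hausdorff_space_prod_topology Hausdorff_space_nsphere)
  note bp = enorm_sphere_pt'
  have val: "F (ball_collapse k U, ball_collapse m V) = axes_map \<alpha> \<beta> (ball_collapse k U, ball_collapse m V)"
    if U: "U \<in> topspace (disc k)" and V: "V \<in> topspace (disc m)" and e: "enorm k U = 1 \<or> enorm m V = 1" for U V
  proof -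
    obtain p where p: "p \<in> topspace ?P" "?U p = U" "?V p = V" using hit[OF U V] by blast
    have "max (enorm k U) (enorm m V) = 1 - fst p" using UV(3)[OF p(1)] p(2,3) by simp
    moreover have "0 \<le> fst p" using p(1) by auto
    ultimately have "fst p = 0" using e by linarith
    then have "p = (0, snd p)" by (metis prod.collapse)
    moreover have "snd p \<in> topspace ?S" using p(1) by auto
    ultimately have "h p = axes_map \<alpha> \<beta> (?Q p)" using h0 by metis
    then show ?thesis using F(2)[OF p(1)] p(2,3) by simp
  qed
  show ?thesis
    unfolding axes_extend_def
  proof (intro exI conjI ballI)
    show "continuous_map (prod_topology (nsphere k) (nsphere m)) X F" by (rule F(1))
    fix x assume "x \<in> topspace (nsphere k)"
    then obtain U where U: "U \<in> topspace (disc k)" "x = ball_collapse k U" using ball_collapse_surj km by metis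
    then show "F (x, sphere_pt) = \<alpha> x"
      using val[of U sphere_pt] sphere_pt_in_disc[OF km(2)] bp[OF km(2)] x0
      by (auto simp: ball_collapse_boundary axes_map_def)
  next
    fix y assume "y \<in> topspace (nsphere m)"
    then obtain V where V: "V \<in> topspace (disc m)" "y = ball_collapse m V" using ball_collapse_surj km by metis
    then show "F (sphere_pt, y) = \<beta> y"
      using val[of sphere_pt V] sphere_pt_in_disc[OF km(1)] bp[OF km(1)]
      by (auto simp: ball_collapse_boundary axes_map_def)
  qed
qed

section \<open>Homotopy classes, Gottlieb groups and Whitehead centers\<close>

abbreviation based_homotopic ::
    "nat \<Rightarrow> 'b topology \<Rightarrow> 'b \<Rightarrow> ((nat \<Rightarrow> real) \<Rightarrow> 'b) \<Rightarrow> ((nat \<Rightarrow> real) \<Rightarrow> 'b) \<Rightarrow> bool" where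
  "based_homotopic m X x0 \<equiv> homotopic_with (\<lambda>h. h sphere_pt = x0) (nsphere m) X"

lemma based_homotopic_imp_sphere_map:
  assumes "based_homotopic m X x0 f g"
  shows "sphere_map m X x0 f" "sphere_map m X x0 g"
  using homotopic_with_imp_continuous_maps[OF assms] homotopic_with_imp_property[OF assms]
  by (auto simp: sphere_map_def)

lemma based_homotopic_refl: "sphere_map m X x0 f \<Longrightarrow> based_homotopic m X x0 f f"
  unfolding sphere_map_def homotopic_with_refl by blast

lemma sphere_class_eq_iff:
  assumes g: "sphere_map m X x0 g"
  shows "sphere_class m X x0 f = sphere_class m X x0 g \<longleftrightarrow> based_homotopic m X x0 f g"
proof
  assume "sphere_class m X x0 f = sphere_class m X x0 g"
  then have "g \<in> sphere_class m X x0 f"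
    using based_homotopic_refl[OF g] by (simp only: sphere_class_def mem_Collect_eq)
  then show "based_homotopic m X x0 f g" by (simp only: sphere_class_def mem_Collect_eq)
next
  assume fg: "based_homotopic m X x0 f g"
  have "based_homotopic m X x0 f h \<longleftrightarrow> based_homotopic m X x0 g h" for h
    using homotopic_with_trans[OF fg] homotopic_with_trans[OF homotopic_with_symD[OF fg]] by iprover
  then show "sphere_class m X x0 f = sphere_class m X x0 g"
    by (simp only: sphere_class_def)
qed

lemma in_homotopy_group_iff:
  "c \<in> carrier (homotopy_group m X x0) \<longleftrightarrow> (\<exists>f. sphere_map m X x0 f \<and> c = sphere_class m X x0 f)"
  by (auto simp: homotopy_group_def)

lemma sphere_class_self: "sphere_map m X x0 f \<Longrightarrow> f \<in> sphere_class m X x0 f"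
  unfolding sphere_class_def mem_Collect_eq by (rule based_homotopic_refl)

lemma based_homotopic_imp_class_eq:
  "based_homotopic m X x0 f g \<Longrightarrow> sphere_class m X x0 f = sphere_class m X x0 g"
  by (rule sphere_class_eq_iff[THEN iffD2]) (rule based_homotopic_imp_sphere_map(2))

lemma ball_homotopy_group:
  "(\<forall>d\<in>carrier (homotopy_group k A a0). P d) \<longleftrightarrow> (\<forall>\<beta>. sphere_map k A a0 \<beta> \<longrightarrow> P (sphere_class k A a0 \<beta>))"
  by (simp add: homotopy_group_def)

lemma in_sphere_class_imp:
  assumes "g \<in> sphere_class m X x0 f"
  shows "based_homotopic m X x0 f g" "sphere_map m X x0 g" "sphere_class m X x0 g = sphere_class m X x0 f"
proof -
  show *: "based_homotopic m X x0 f g" using assms by (simp add: sphere_class_def)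
  then show g: "sphere_map m X x0 g" by (rule based_homotopic_imp_sphere_map)
  show "sphere_class m X x0 g = sphere_class m X x0 f" using based_homotopic_imp_class_eq[OF *] by (rule sym)
qed

lemma homotopy_group_memberD:
  assumes "c \<in> carrier (homotopy_group m X x0)" "\<alpha> \<in> c"
  shows "sphere_map m X x0 \<alpha>" "c = sphere_class m X x0 \<alpha>"
proof -
  obtain g where g: "sphere_map m X x0 g \<and> c = sphere_class m X x0 g"
    using assms(1) unfolding in_homotopy_group_iff ..
  then have "\<alpha> \<in> sphere_class m X x0 g" using assms(2) by simp
  from in_sphere_class_imp(2,3)[OF this] g
  show "sphere_map m X x0 \<alpha>" "c = sphere_class m X x0 \<alpha>" by simp_all
qed

lemma homotopy_groupE:
  assumes "c \<in> carrier (homotopy_group m X x0)"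
  obtains \<alpha> where "sphere_map m X x0 \<alpha>" "c = sphere_class m X x0 \<alpha>"
proof -
  obtain g where "sphere_map m X x0 g \<and> c = sphere_class m X x0 g"
    using assms unfolding in_homotopy_group_iff ..
  then show ?thesis by (elim conjE) (rule that)
qed

lemma sphere_class_in_homotopy_group:
  "sphere_map m X x0 \<alpha> \<Longrightarrow> sphere_class m X x0 \<alpha> \<in> carrier (homotopy_group m X x0)"
  unfolding in_homotopy_group_iff by (rule exI[of _ \<alpha>], rule conjI, assumption, rule refl)

lemma whitehead_map_sphere_pt:
  assumes "k \<ge> 1" "m \<ge> 1"
  shows "whitehead_map k m \<alpha> \<beta> sphere_pt = \<beta> sphere_pt"
  using whitehead_map_eq_axes_map[OF assms sphere_pt_in, of \<alpha> \<beta>] sphere_pt_bd[OF assms]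
    ball_collapse_sphere_pt[OF assms(1)] ball_collapse_sphere_pt[OF assms(2)]
  by (simp add: axes_map_def)

lemma whitehead_map_homotopic:
  assumes km: "k \<ge> 1" "m \<ge> 1"
    and a: "based_homotopic k X x0 \<alpha> \<alpha>'" and b: "based_homotopic m X x0 \<beta> \<beta>'"
  shows "based_homotopic (k + m - 1) X x0 (whitehead_map k m \<alpha> \<beta>) (whitehead_map k m \<alpha>' \<beta>')"
proof -
  let ?I = "top_of_set {0..1::real}"
  obtain H where H: "continuous_map (prod_topology ?I (nsphere k)) X H"
    "\<And>x. H (0, x) = \<alpha> x" "\<And>x. H (1, x) = \<alpha>' x" "\<And>t. t \<in> {0..1} \<Longrightarrow> H (t, sphere_pt) = x0"
    using a unfolding homotopic_with_def by blast
  obtain K where K: "continuous_map (prod_topology ?I (nsphere m)) X K"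
    "\<And>x. K (0, x) = \<beta> x" "\<And>x. K (1, x) = \<beta>' x" "\<And>t. t \<in> {0..1} \<Longrightarrow> K (t, sphere_pt) = x0"
    using b unfolding homotopic_with_def by blast
  have "continuous_map (prod_topology ?I (nsphere (k + m - 1))) X
           (\<lambda>(t, z). whitehead_map k m (\<lambda>x. H (t, x)) (\<lambda>y. K (t, y)) z)"
    using km H(1) K(1) by (rule continuous_map_whitehead_family) (simp add: H K)
  then show ?thesis
    unfolding homotopic_with_def
    by (rule_tac x="\<lambda>(t, z). whitehead_map k m (\<lambda>x. H (t, x)) (\<lambda>y. K (t, y)) z" in exI)
      (simp add: H(2,3) K(2-4) whitehead_map_sphere_pt[OF km])
qed

text \<open>
  Products in \<open>homotopy_group\<close>, Whitehead products and induced maps are defined as unions over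
  representatives.  They are single classes because the class does not depend on the choice.
\<close>

lemma UN_constant_on:
  assumes "a \<in> c" "\<And>x. x \<in> c \<Longrightarrow> G x = S"
  shows "(\<Union>x\<in>c. G x) = S"
proof -
  have "(\<Union>x\<in>c. G x) = (\<Union>x\<in>c. S)" by (rule SUP_cong) (simp_all add: assms(2))
  also have "\<dots> = S" using assms(1) by auto
  finally show ?thesis .
qed

lemma UN2_constant:
  assumes "a \<in> c" "b \<in> d" "\<And>x y. \<lbrakk>x \<in> c; y \<in> d\<rbrakk> \<Longrightarrow> G x y = S"
  shows "(\<Union>x\<in>c. \<Union>y\<in>d. G x y) = S"
  by (rule UN_constant_on[OF assms(1)], rule UN_constant_on[OF assms(2)], rule assms(3))

lemma whitehead_product_class:
  assumes km: "k \<ge> 1" "m \<ge> 1" and a: "sphere_map k X x0 \<alpha>" and b: "sphere_map m X x0 \<beta>"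
  shows "whitehead_product k m X x0 (sphere_class k X x0 \<alpha>) (sphere_class m X x0 \<beta>)
    = sphere_class (k + m - 1) X x0 (whitehead_map k m \<alpha> \<beta>)"
proof -
  have eq: "sphere_class (k + m - 1) X x0 (whitehead_map k m \<alpha>' \<beta>') = sphere_class (k + m - 1) X x0 (whitehead_map k m \<alpha> \<beta>)"
    if "\<alpha>' \<in> sphere_class k X x0 \<alpha>" "\<beta>' \<in> sphere_class m X x0 \<beta>" for \<alpha>' \<beta>'
  proof -
    have "based_homotopic (k + m - 1) X x0 (whitehead_map k m \<alpha> \<beta>) (whitehead_map k m \<alpha>' \<beta>')"
      by (rule whitehead_map_homotopic[OF km in_sphere_class_imp(1)[OF that(1)] in_sphere_class_imp(1)[OF that(2)]])
    then show ?thesis by (rule based_homotopic_imp_class_eq [symmetric])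
  qed
  show ?thesis
    unfolding whitehead_product_def
    by (rule UN2_constant[OF sphere_class_self[OF a] sphere_class_self[OF b]]) (rule eq)
qed

text \<open>
  All representatives may be chosen freely, because both sides depend only on homotopy classes: the
  left side by \<open>whitehead_product_class\<close>, and the right side because it is equivalent to the left.
\<close>

theorem whitehead_product_trivial_iff:
  assumes km: "k \<ge> 1" "m \<ge> 1" and a: "sphere_map k X x0 \<alpha>" and b: "sphere_map m X x0 \<beta>"
  shows "whitehead_product k m X x0 (sphere_class k X x0 \<alpha>) (sphere_class m X x0 \<beta>)
      = \<one>\<^bsub>homotopy_group (k + m - 1) X x0\<^esub> \<longleftrightarrow> axes_extend k m X \<alpha> \<beta>"
proof -
  have "x0 \<in> topspace X" using a sphere_pt_in[of k] by (auto simp: sphere_map_def continuous_map_def)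
  then have c: "sphere_map (k + m - 1) X x0 (\<lambda>_. x0)" by (simp add: sphere_map_def)
  have pt: "\<alpha> sphere_pt = x0" "\<beta> sphere_pt = x0" using a b by (auto simp: sphere_map_def)
  have one: "\<one>\<^bsub>homotopy_group (k + m - 1) X x0\<^esub> = sphere_class (k + m - 1) X x0 (\<lambda>_. x0)"
    by (simp add: homotopy_group_def)
  show ?thesis
    unfolding whitehead_product_class[OF assms] one sphere_class_eq_iff[OF c]
    using axes_extend_of_nullhomotopic[where \<alpha> = \<alpha> and \<beta> = \<beta> and X = X, OF km pt]
      nullhomotopic_of_axes_extend[where \<alpha> = \<alpha> and \<beta> = \<beta> and X = X, OF km _ pt(1)] by blast
qed

lemma homotopy_induced_class:
  assumes f: "continuous_map A X f" "f a0 = x0" and a: "sphere_map k A a0 \<alpha>"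
  shows "homotopy_induced k X x0 f (sphere_class k A a0 \<alpha>) = sphere_class k X x0 (f \<circ> \<alpha>)"
proof -
  have eq: "sphere_class k X x0 (f \<circ> \<alpha>') = sphere_class k X x0 (f \<circ> \<alpha>)"
    if "\<alpha>' \<in> sphere_class k A a0 \<alpha>" for \<alpha>'
  proof -
    have "based_homotopic k X x0 (f \<circ> \<alpha>) (f \<circ> \<alpha>')"
      using in_sphere_class_imp(1)[OF that] f(1)
      by (rule homotopic_with_compose_continuous_map_left) (simp add: f(2))
    then show ?thesis by (rule based_homotopic_imp_class_eq [symmetric])
  qed
  show ?thesis
    unfolding homotopy_induced_def by (rule UN_constant_on[OF sphere_class_self[OF a]]) (rule eq)
qed

lemma sphere_map_compose:
  assumes "continuous_map A X f" "f a0 = x0" "sphere_map k A a0 \<alpha>"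
  shows "sphere_map k X x0 (f \<circ> \<alpha>)"
  using assms continuous_map_compose[of "nsphere k" A \<alpha> X f] by (auto simp: sphere_map_def)

text \<open>
  In this form a Whitehead center group is a family of extension problems, with no reference to
  classes on the right.
\<close>

lemma sphere_class_in_whitehead_along_iff:
  assumes m: "m \<ge> 1" and f: "continuous_map A X f" "f a0 = x0" and a: "sphere_map m X x0 \<alpha>"
  shows "sphere_class m X x0 \<alpha> \<in> whitehead_along m A a0 X x0 f \<longleftrightarrow>
    (\<forall>k\<ge>1. \<forall>\<beta>. sphere_map k A a0 \<beta> \<longrightarrow> axes_extend m k X \<alpha> (f \<circ> \<beta>))"
proof -
  have "sphere_class m X x0 \<alpha> \<in> carrier (homotopy_group m X x0)"
    using a by (rule sphere_class_in_homotopy_group)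
  moreover have "whitehead_product m k X x0 (sphere_class m X x0 \<alpha>) (homotopy_induced k X x0 f (sphere_class k A a0 \<beta>))
            = \<one>\<^bsub>homotopy_group (m + k - 1) X x0\<^esub> \<longleftrightarrow> axes_extend m k X \<alpha> (f \<circ> \<beta>)"
    if "k \<ge> 1" "sphere_map k A a0 \<beta>" for k \<beta>
    unfolding homotopy_induced_class[OF f that(2)]
    using m that(1) a sphere_map_compose[OF f that(2)] by (rule whitehead_product_trivial_iff)
  ultimately show ?thesis
    unfolding whitehead_along_def mem_Collect_eq ball_homotopy_group by simp
qed

lemma sphere_class_in_gottlieb_alongI:
  assumes a: "sphere_map m X x0 \<alpha>" and a0: "a0 \<in> topspace A" "f a0 = x0"
    and F: "continuous_map (prod_topology A (nsphere m)) X F"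
      "\<And>a. a \<in> topspace A \<Longrightarrow> F (a, sphere_pt) = f a"
      "\<And>s. s \<in> topspace (nsphere m) \<Longrightarrow> F (a0, s) = \<alpha> s"
  shows "sphere_class m X x0 \<alpha> \<in> gottlieb_along m A a0 X x0 f"
proof -
  have c: "continuous_map (sphere_wedge m A a0) X F"
    unfolding sphere_wedge_def by (rule continuous_map_from_subtopology[OF F(1)])
  have e: "F p = wedge_map f \<alpha> p" if "p \<in> topspace (sphere_wedge m A a0)" for p
    using that F(2,3) a a0 by (auto simp: sphere_wedge_def wedge_map_def sphere_map_def)
  have "homotopic_with (\<lambda>h. h (a0, sphere_pt) = x0) (sphere_wedge m A a0) X F (wedge_map f \<alpha>)"
    using c F(2)[OF a0(1)] a0(2)
    by (intro homotopic_with_equal) (auto simp: e wedge_map_def)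
  then have "\<exists>\<alpha>\<in>sphere_class m X x0 \<alpha>. \<exists>F.
        continuous_map (prod_topology A (nsphere m)) X F \<and>
        homotopic_with (\<lambda>h. h (a0, sphere_pt) = x0) (sphere_wedge m A a0) X F (wedge_map f \<alpha>)"
    by (intro bexI[OF _ sphere_class_self[OF a]] exI[of _ F] conjI F(1))
  moreover have "sphere_class m X x0 \<alpha> \<in> carrier (homotopy_group m X x0)"
    using a by (rule sphere_class_in_homotopy_group)
  ultimately show ?thesis unfolding gottlieb_along_def by simp
qed

lemma gottlieb_alongD:
  assumes c: "c \<in> gottlieb_along m A a0 X x0 f"
  obtains \<alpha> F where "c \<in> carrier (homotopy_group m X x0)" "\<alpha> \<in> c"
    "continuous_map (prod_topology A (nsphere m)) X F"
    "homotopic_with (\<lambda>h. h (a0, sphere_pt) = x0) (sphere_wedge m A a0) X F (wedge_map f \<alpha>)"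
proof -
  have c': "c \<in> carrier (homotopy_group m X x0)"
    and *: "\<exists>\<alpha>\<in>c. \<exists>F. continuous_map (prod_topology A (nsphere m)) X F \<and>
        homotopic_with (\<lambda>h. h (a0, sphere_pt) = x0) (sphere_wedge m A a0) X F (wedge_map f \<alpha>)"
    using c by (simp_all only: gottlieb_along_def mem_Collect_eq)
  from * obtain \<alpha> where \<alpha>: "\<alpha> \<in> c" and **: "\<exists>F. continuous_map (prod_topology A (nsphere m)) X F \<and>
        homotopic_with (\<lambda>h. h (a0, sphere_pt) = x0) (sphere_wedge m A a0) X F (wedge_map f \<alpha>)" ..
  from ** obtain F where F: "continuous_map (prod_topology A (nsphere m)) X F \<and>
        homotopic_with (\<lambda>h. h (a0, sphere_pt) = x0) (sphere_wedge m A a0) X F (wedge_map f \<alpha>)" ..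
  show thesis by (rule that[OF c' \<alpha> conjunct1[OF F] conjunct2[OF F]])
qed

text \<open>
  The homotopy in the definition of \<open>gottlieb_along\<close> lives on the wedge.  Restricted to the two axes
  it says that the axes of \<open>F\<close> are homotopic to \<open>f\<close> and to the given representative; so \<open>F\<close> may be
  assumed to restrict exactly to a representative \<open>\<alpha>\<close> and to a map \<open>f'\<close> homotopic to \<open>f\<close>.
\<close>

lemma gottlieb_alongE:
  assumes c: "c \<in> gottlieb_along m A a0 X x0 f" and a0: "a0 \<in> topspace A" "f a0 = x0"
  obtains F \<alpha> f' where "sphere_map m X x0 \<alpha>" "c = sphere_class m X x0 \<alpha>"
    "homotopic_with (\<lambda>h. h a0 = x0) A X f' f"
    "continuous_map (prod_topology A (nsphere m)) X F"
    "\<And>a. F (a, sphere_pt) = f' a" "\<And>s. F (a0, s) = \<alpha> s"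
proof -
  obtain \<alpha> F where \<alpha>: "c \<in> carrier (homotopy_group m X x0)" "\<alpha> \<in> c"
    and F: "continuous_map (prod_topology A (nsphere m)) X F"
    and h: "homotopic_with (\<lambda>h. h (a0, sphere_pt) = x0) (sphere_wedge m A a0) X F (wedge_map f \<alpha>)"
    by (rule gottlieb_alongD[OF c])
  note cl = homotopy_group_memberD[OF \<alpha>]
  have pt: "\<alpha> sphere_pt = x0" using cl by (simp add: sphere_map_def)
  have i1: "continuous_map A (sphere_wedge m A a0) (\<lambda>a. (a, sphere_pt))"
    and i2: "continuous_map (nsphere m) (sphere_wedge m A a0) (\<lambda>s. (a0, s))"
    unfolding sphere_wedge_def continuous_map_in_subtopology using sphere_pt_in a0
    by (auto intro!: continuous_map_pairedI)
  have "homotopic_with (\<lambda>h. h a0 = x0) A X (F \<circ> (\<lambda>a. (a, sphere_pt))) (wedge_map f \<alpha> \<circ> (\<lambda>a. (a, sphere_pt)))"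
    by (rule homotopic_with_compose_continuous_map_right[OF h i1]) simp
  then have hf: "homotopic_with (\<lambda>h. h a0 = x0) A X (\<lambda>a. F (a, sphere_pt)) f"
    by (simp add: o_def wedge_map_def)
  have "based_homotopic m X x0 (F \<circ> (\<lambda>s. (a0, s))) (wedge_map f \<alpha> \<circ> (\<lambda>s. (a0, s)))"
    by (rule homotopic_with_compose_continuous_map_right[OF h i2]) simp
  moreover have "wedge_map f \<alpha> \<circ> (\<lambda>s. (a0, s)) = \<alpha>"
    using pt a0 by (auto simp: wedge_map_def)
  ultimately have "based_homotopic m X x0 (\<lambda>s. F (a0, s)) \<alpha>" by (simp add: o_def)
  then have "sphere_map m X x0 (\<lambda>s. F (a0, s))" "c = sphere_class m X x0 (\<lambda>s. F (a0, s))"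
    by (auto simp: cl(2) based_homotopic_imp_sphere_map(1) based_homotopic_imp_class_eq)
  then show ?thesis using that[OF _ _ hf F] by blast
qed

lemma homotopic_post_compose_based:
  assumes h: "homotopic_with (\<lambda>h. h a0 = x0) A X f' f" and b: "sphere_map k A a0 \<beta>"
  shows "based_homotopic k X x0 (f' \<circ> \<beta>) (f \<circ> \<beta>)"
  using b by (intro homotopic_with_compose_continuous_map_right[OF h]) (auto simp: sphere_map_def)

lemma axes_extend_homotopic:
  assumes km: "k \<ge> 1" "m \<ge> 1"
    and a: "based_homotopic k X x0 \<alpha> \<alpha>'" and b: "based_homotopic m X x0 \<beta> \<beta>'"
    and e: "axes_extend k m X \<alpha> \<beta>"
  shows "axes_extend k m X \<alpha>' \<beta>'"
proof -
  note maps = based_homotopic_imp_sphere_map[OF a] based_homotopic_imp_sphere_map[OF b]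
  have "sphere_class k X x0 \<alpha> = sphere_class k X x0 \<alpha>'" "sphere_class m X x0 \<beta> = sphere_class m X x0 \<beta>'"
    by (rule based_homotopic_imp_class_eq[OF a], rule based_homotopic_imp_class_eq[OF b])
  then show ?thesis
    using whitehead_product_trivial_iff[OF km maps(1,3)] whitehead_product_trivial_iff[OF km maps(2,4)] e
    by simp
qed

text \<open>
  If \<open>F\<close> extends \<open>f \<or> \<alpha>\<close> over \<open>A \<times> S\<^sup>m\<close>, then \<open>(s, x) \<mapsto> F (\<beta> x, s)\<close> extends \<open>\<alpha> \<or> f \<circ> \<beta>\<close> over a product
  of spheres.
\<close>

theorem gottlieb_along_subset_whitehead_along:
  assumes m: "m \<ge> 1" and f: "continuous_map A X f" "f a0 = x0" and a0: "a0 \<in> topspace A"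
  shows "gottlieb_along m A a0 X x0 f \<subseteq> whitehead_along m A a0 X x0 f"
proof
  fix c assume "c \<in> gottlieb_along m A a0 X x0 f"
  then obtain F \<alpha> f' where \<alpha>: "sphere_map m X x0 \<alpha>" "c = sphere_class m X x0 \<alpha>"
    and f': "homotopic_with (\<lambda>h. h a0 = x0) A X f' f"
    and F: "continuous_map (prod_topology A (nsphere m)) X F"
      "\<And>a. F (a, sphere_pt) = f' a" "\<And>s. F (a0, s) = \<alpha> s"
    by (rule gottlieb_alongE[where f = f and ?a0.0 = a0, OF _ a0 f(2)]) (rule that; assumption)
  have "axes_extend m k X \<alpha> (f \<circ> \<beta>)" if k: "k \<ge> 1" and \<beta>: "sphere_map k A a0 \<beta>" for k \<beta>
  proof -
    have \<beta>': "continuous_map (nsphere k) A \<beta>" "\<beta> sphere_pt = a0" using \<beta> by (auto simp: sphere_map_def)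
    have "continuous_map (prod_topology (nsphere m) (nsphere k)) (prod_topology A (nsphere m)) (\<lambda>p. (\<beta> (snd p), fst p))"
      using continuous_map_compose[OF continuous_map_snd \<beta>'(1), of "nsphere m"]
      by (intro continuous_map_pairedI continuous_map_fst) (simp add: o_def)
    then have "continuous_map (prod_topology (nsphere m) (nsphere k)) X (F \<circ> (\<lambda>p. (\<beta> (snd p), fst p)))"
      using F(1) by (rule continuous_map_compose)
    then have "axes_extend m k X \<alpha> (f' \<circ> \<beta>)"
      unfolding axes_extend_def
      by (rule_tac x="F \<circ> (\<lambda>p. (\<beta> (snd p), fst p))" in exI) (simp add: F(2,3) \<beta>'(2))
    then show ?thesis
      using axes_extend_homotopic[OF m k based_homotopic_refl[OF \<alpha>(1)] homotopic_post_compose_based[OF f' \<beta>]] by blast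
  qed
  then show "c \<in> whitehead_along m A a0 X x0 f"
    using sphere_class_in_whitehead_along_iff[where f = f and ?a0.0 = a0, OF m f \<alpha>(1)]
    unfolding \<alpha>(2) by simp
qed

text \<open>
  A map \<open>F\<close> on \<open>X \<times> S\<^sup>m\<close> is pulled back along \<open>f\<close> in the first variable.
\<close>

lemma gottlieb_subset_gottlieb_along:
  assumes f: "continuous_map A X f" "f a0 = x0" and a0: "a0 \<in> topspace A"
  shows "gottlieb m X x0 \<subseteq> gottlieb_along m A a0 X x0 f"
proof
  fix c assume "c \<in> gottlieb m X x0"
  then obtain \<alpha> F where \<alpha>: "c \<in> carrier (homotopy_group m X x0)" "\<alpha> \<in> c"
    and F: "continuous_map (prod_topology X (nsphere m)) X F"
    and h: "homotopic_with (\<lambda>h. h (x0, sphere_pt) = x0) (sphere_wedge m X x0) X F (wedge_map id \<alpha>)"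
    unfolding gottlieb_def by (rule gottlieb_alongD)
  let ?f = "\<lambda>p. (f (fst p), snd p)"
  have cf: "continuous_map (prod_topology A (nsphere m)) (prod_topology X (nsphere m)) ?f"
    using continuous_map_compose[OF continuous_map_fst f(1), of "nsphere m"]
    by (intro continuous_map_pairedI continuous_map_snd) (simp add: o_def)
  have cw: "continuous_map (sphere_wedge m A a0) (sphere_wedge m X x0) ?f"
    unfolding sphere_wedge_def continuous_map_in_subtopology
    using continuous_map_from_subtopology[OF cf] f(2) by auto
  have "homotopic_with (\<lambda>h. h (a0, sphere_pt) = x0) (sphere_wedge m A a0) X (F \<circ> ?f) (wedge_map id \<alpha> \<circ> ?f)"
    by (rule homotopic_with_compose_continuous_map_right[OF h cw]) (simp add: f(2))
  moreover have "wedge_map id \<alpha> \<circ> ?f = wedge_map f \<alpha>"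
    by (auto simp: wedge_map_def)
  ultimately show "c \<in> gottlieb_along m A a0 X x0 f"
    unfolding gottlieb_along_def mem_Collect_eq
    by (intro conjI \<alpha>(1) bexI[OF _ \<alpha>(2)] exI[of _ "F \<circ> ?f"] continuous_map_compose[OF cf F]) simp
qed

lemma whitehead_center_subset_whitehead_along:
  assumes m: "m \<ge> 1" and f: "continuous_map A X f" "f a0 = x0"
  shows "whitehead_center m X x0 \<subseteq> whitehead_along m A a0 X x0 f"
proof
  fix c assume c: "c \<in> whitehead_center m X x0"
  then obtain \<alpha> where \<alpha>: "sphere_map m X x0 \<alpha>" "c = sphere_class m X x0 \<alpha>"
    unfolding whitehead_center_def whitehead_along_def mem_Collect_eq by (elim conjE homotopy_groupE) (rule that)
  have "axes_extend m k X \<alpha> (id \<circ> (f \<circ> \<beta>))" if "k \<ge> 1" "sphere_map k A a0 \<beta>" for k \<beta>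
    using c sphere_map_compose[where f = f and ?a0.0 = a0, OF f that(2)] that(1)
      sphere_class_in_whitehead_along_iff[where f = id and ?a0.0 = x0, OF m continuous_map_id _ \<alpha>(1)]
    unfolding whitehead_center_def \<alpha>(2) by simp
  then have "axes_extend m k X \<alpha> (f \<circ> \<beta>)" if "k \<ge> 1" "sphere_map k A a0 \<beta>" for k \<beta>
    using that by (simp add: id_o)
  then show "c \<in> whitehead_along m A a0 X x0 f"
    using sphere_class_in_whitehead_along_iff[where f = f and ?a0.0 = a0, OF m f \<alpha>(1)]
    unfolding \<alpha>(2) by simp
qed

text \<open>
  Extending \<open>f \<or> \<alpha>\<close> over \<open>S\<^sup>k \<times> S\<^sup>m\<close> is literally the extension problem for \<open>[f, \<alpha>]\<close>, and that
  product is among those tested by the Whitehead center along \<open>f\<close>, as \<open>f\<close> is the image of the identity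
  of \<open>S\<^sup>k\<close>.
\<close>

theorem gottlieb_whitehead_kernel_sphere:
  assumes k: "k \<ge> 1" and m: "m \<ge> 1" and f: "sphere_map k X x0 f"
  shows "gottlieb_along m (nsphere k) sphere_pt X x0 f = whitehead_along m (nsphere k) sphere_pt X x0 f"
    "whitehead_along m (nsphere k) sphere_pt X x0 f = whitehead_kernel k m X x0 (sphere_class k X x0 f)"
proof -
  have f': "continuous_map (nsphere k) X f" "f sphere_pt = x0" using f by (auto simp: sphere_map_def)
  have gw: "gottlieb_along m (nsphere k) sphere_pt X x0 f \<subseteq> whitehead_along m (nsphere k) sphere_pt X x0 f"
    using m f' sphere_pt_in by (rule gottlieb_along_subset_whitehead_along)
  have wk: "whitehead_along m (nsphere k) sphere_pt X x0 f \<subseteq> whitehead_kernel k m X x0 (sphere_class k X x0 f)"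
  proof
    fix c assume c: "c \<in> whitehead_along m (nsphere k) sphere_pt X x0 f"
    then obtain \<alpha> where \<alpha>: "sphere_map m X x0 \<alpha>" "c = sphere_class m X x0 \<alpha>"
      unfolding whitehead_along_def mem_Collect_eq by (elim conjE homotopy_groupE) (rule that)
    have "sphere_map k (nsphere k) sphere_pt id" by (simp add: sphere_map_def)
    then have "axes_extend m k X \<alpha> (f \<circ> id)"
      using c sphere_class_in_whitehead_along_iff[where f = f and ?a0.0 = sphere_pt, OF m f' \<alpha>(1)] k
      unfolding \<alpha>(2) by blast
    then have "axes_extend k m X f \<alpha>" using axes_extend_sym by fastforce
    then show "c \<in> whitehead_kernel k m X x0 (sphere_class k X x0 f)"
      using whitehead_product_trivial_iff[OF k m f \<alpha>(1)] sphere_class_in_homotopy_group[OF \<alpha>(1)]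
      unfolding \<alpha>(2) whitehead_kernel_def mem_Collect_eq by (intro conjI) (assumption, rule iffD2)
  qed
  have kg: "whitehead_kernel k m X x0 (sphere_class k X x0 f) \<subseteq> gottlieb_along m (nsphere k) sphere_pt X x0 f"
  proof
    fix c assume c: "c \<in> whitehead_kernel k m X x0 (sphere_class k X x0 f)"
    then obtain \<alpha> where \<alpha>: "sphere_map m X x0 \<alpha>" "c = sphere_class m X x0 \<alpha>"
      unfolding whitehead_kernel_def mem_Collect_eq by (elim conjE homotopy_groupE) (rule that)
    then have "axes_extend k m X f \<alpha>"
      using c whitehead_product_trivial_iff[OF k m f \<alpha>(1)] unfolding whitehead_kernel_def by simp
    then obtain F where "continuous_map (prod_topology (nsphere k) (nsphere m)) X F"
      "\<forall>x\<in>topspace (nsphere k). F (x, sphere_pt) = f x" "\<forall>y\<in>topspace (nsphere m). F (sphere_pt, y) = \<alpha> y"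
      by (auto simp: axes_extend_def)
    then show "c \<in> gottlieb_along m (nsphere k) sphere_pt X x0 f"
      unfolding \<alpha>(2) using \<alpha>(1) f'(2) sphere_pt_in by (intro sphere_class_in_gottlieb_alongI[of _ _ _ _ _ _ _ F]) auto
  qed
  show "gottlieb_along m (nsphere k) sphere_pt X x0 f = whitehead_along m (nsphere k) sphere_pt X x0 f"
    "whitehead_along m (nsphere k) sphere_pt X x0 f = whitehead_kernel k m X x0 (sphere_class k X x0 f)"
    using gw wk kg by blast+
qed

section \<open>Coverings and the lifting of homotopies\<close>

lemma open_map_prod_right:
  assumes "open_map X Y f"
  shows "open_map (prod_topology Z X) (prod_topology Z Y) (\<lambda>(z, x). (z, f x))"
  unfolding open_map_def
proof (intro allI impI)
  fix U assume U: "openin (prod_topology Z X) U"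
  show "openin (prod_topology Z Y) ((\<lambda>(z, x). (z, f x)) ` U)"
    unfolding openin_prod_topology_alt
  proof (intro allI impI)
    fix z y assume "(z, y) \<in> (\<lambda>(z, x). (z, f x)) ` U"
    then obtain x where x: "(z, x) \<in> U" "y = f x" by auto
    then obtain A B where AB: "openin Z A" "openin X B" "z \<in> A" "x \<in> B" "A \<times> B \<subseteq> U"
      using U x(1) unfolding openin_prod_topology_alt by meson
    show "\<exists>A B. openin Z A \<and> openin Y B \<and> z \<in> A \<and> y \<in> B \<and> A \<times> B \<subseteq> (\<lambda>(z, x). (z, f x)) ` U"
    proof (intro exI conjI)
      show "openin Y (f ` B)" using assms AB(2) by (simp add: open_map_def)
      show "y \<in> f ` B" using x(2) AB(4) by simp
      show "A \<times> f ` B \<subseteq> (\<lambda>(z, x). (z, f x)) ` U" using AB(5) by force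
    qed (use AB in auto)
  qed
qed

text \<open>
  A covering is presented by a relation \<open>W\<close> of nearness between points of its total space, such as
  "at distance less than \<open>\<epsilon>\<close>" for a group acting by isometries that moves every point by at least
  \<open>2\<epsilon>\<close>.  Near a given point there is at most one point in each fibre, and the fibres that meet the
  neighbourhood of a point are the same for all points of its fibre.  A nearby fibre thus has a
  canonical point, which replaces the choice of an evenly covered neighbourhood and makes lifting by
  small steps possible over an arbitrary compact space at once.
\<close>

locale nearness_covering =
  fixes E :: "'a topology" and B :: "'b topology" and p :: "'a \<Rightarrow> 'b" and W :: "('a \<times> 'a) set"
  assumes p_continuous: "continuous_map E B p" and p_open: "open_map E B p"
    and p_onto: "p ` topspace E = topspace B"
    and E_Hausdorff: "Hausdorff_space E"
    and W_open: "openin (prod_topology E E) W"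
    and W_refl: "x \<in> topspace E \<Longrightarrow> (x, x) \<in> W"
    and W_unique: "\<lbrakk>(x, y) \<in> W; (x, z) \<in> W; p y = p z\<rbrakk> \<Longrightarrow> y = z"
    and W_transport: "\<lbrakk>(x, y) \<in> W; x' \<in> topspace E; p x' = p x\<rbrakk> \<Longrightarrow> \<exists>y'. (x', y') \<in> W \<and> p y' = p y"
begin

lemma W_sub: "(x, y) \<in> W \<Longrightarrow> x \<in> topspace E \<and> y \<in> topspace E"
  using openin_subset[OF W_open] by auto

text \<open>
  The set where two lifts agree is closed because \<open>E\<close> is Hausdorff, and open because it is the set
  where the two lifts are near each other.
\<close>

lemma lift_unique:
  assumes X: "connected_space X" and f: "continuous_map X E f" and g: "continuous_map X E g"
    and pfg: "\<And>x. x \<in> topspace X \<Longrightarrow> p (f x) = p (g x)"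
    and a: "a \<in> topspace X" "f a = g a" and x: "x \<in> topspace X"
  shows "f x = g x"
proof -
  let ?A = "{x \<in> topspace X. f x = g x}"
  have fE: "f x \<in> topspace E" "g x \<in> topspace E" if "x \<in> topspace X" for x
    using that f g by (auto simp: continuous_map_def)
  have "f x = g x" if "x \<in> topspace X" "(f x, g x) \<in> W" for x
    using W_unique[OF that(2) W_refl[OF fE(1)]] pfg that by metis
  then have "?A = {x \<in> topspace X. (f x, g x) \<in> W}"
    using W_refl fE by auto
  moreover have "openin X {x \<in> topspace X. (f x, g x) \<in> W}"
    using continuous_map_pairedI[OF f g] W_open by (rule openin_continuous_map_preimage)
  ultimately have "openin X ?A" by simp
  moreover have "closedin X ?A"
    using E_Hausdorff f g by (rule closedin_continuous_maps_eq)
  ultimately have "?A = topspace X" using X a by (auto simp: connected_space_clopen_in)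
  then show ?thesis using x by blast
qed

lemma lift_const:
  assumes "connected_space X" "continuous_map X E f" "\<And>x. x \<in> topspace X \<Longrightarrow> p (f x) = b"
    and "a \<in> topspace X" "x \<in> topspace X"
  shows "f x = f a"
  using lift_unique[of X f "\<lambda>_. f a" a x] assms by (auto simp: continuous_map_def)

text \<open>
  The lift \<open>h x\<close> is the point of the fibre of \<open>g x\<close> that is near \<open>f x\<close>.  It is continuous because the
  pairs of a point of \<open>E\<close> and a fibre whose nearby point lies in an open set \<open>U\<close> form an open set: the
  image of \<open>W \<inter> (E \<times> U)\<close> under the open map \<open>id \<times> p\<close>.
\<close>

lemma lift_near:
  assumes f: "continuous_map X E f" and g: "continuous_map X B g"
    and near: "\<And>x. x \<in> topspace X \<Longrightarrow> \<exists>y. (f x, y) \<in> W \<and> p y = g x"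
  obtains h where "continuous_map X E h" "\<And>x. x \<in> topspace X \<Longrightarrow> p (h x) = g x"
    "\<And>x. x \<in> topspace X \<Longrightarrow> (f x, h x) \<in> W"
proof -
  define h where "h = (\<lambda>x. SOME y. (f x, y) \<in> W \<and> p y = g x)"
  have h: "(f x, h x) \<in> W" "p (h x) = g x" if "x \<in> topspace X" for x
    using someI_ex[OF near[OF that]] by (auto simp: h_def)
  have "openin X {x \<in> topspace X. h x \<in> U}" if U: "openin E U" for U
  proof -
    let ?V = "(\<lambda>(z, x). (z, p x)) ` (W \<inter> (topspace E \<times> U))"
    have "openin (prod_topology E E) (W \<inter> (topspace E \<times> U))"
      using W_open U by (auto simp: openin_prod_Times_iff)
    then have V: "openin (prod_topology E B) ?V"
      using open_map_prod_right[OF p_open, of E] by (auto simp: open_map_def)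
    have "h x \<in> U \<longleftrightarrow> (f x, g x) \<in> ?V" if "x \<in> topspace X" for x
    proof
      assume "h x \<in> U"
      then show "(f x, g x) \<in> ?V" using h[OF that] W_sub[of "f x" "h x"] by force
    next
      assume "(f x, g x) \<in> ?V"
      then obtain y where "(f x, y) \<in> W" "y \<in> U" "p y = g x" by auto
      then show "h x \<in> U" using W_unique[of "f x" y "h x"] h[OF that] by simp
    qed
    then have "{x \<in> topspace X. h x \<in> U} = {x \<in> topspace X. (f x, g x) \<in> ?V}" by blast
    moreover have "openin X {x \<in> topspace X. (f x, g x) \<in> ?V}"
      using continuous_map_pairedI[OF f g] V by (rule openin_continuous_map_preimage)
    ultimately show ?thesis by simp
  qed
  moreover have "h x \<in> topspace E" if "x \<in> topspace X" for x
    using W_sub[OF h(1)[OF that]] by blast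
  ultimately have "continuous_map X E h" by (simp add: continuous_map_def)
  then show ?thesis using that h by blast
qed

text \<open>
  By compactness \<open>h (s, x)\<close> and \<open>h (t, x)\<close> are near each other, uniformly in \<open>x\<close>, when \<open>s\<close> and \<open>t\<close>
  are.  The homotopies \<open>h (min t (i / N), x)\<close> are therefore lifted one after the other, for \<open>i\<close> from
  \<open>0\<close> to \<open>N\<close>, each as a map near the previous lift.
\<close>

theorem homotopy_lifting:
  assumes X: "compact_space X" and h: "continuous_map (prod_topology (top_of_set {0..1::real}) X) B h"
    and f: "continuous_map X E f" and f0: "\<And>x. x \<in> topspace X \<Longrightarrow> p (f x) = h (0, x)"
  obtains k where "continuous_map (prod_topology (top_of_set {0..1}) X) E k"
    "\<And>t x. \<lbrakk>t \<in> {0..1}; x \<in> topspace X\<rbrakk> \<Longrightarrow> p (k (t, x)) = h (t, x)"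
    "\<And>x. x \<in> topspace X \<Longrightarrow> k (0, x) = f x"
proof -
  let ?I = "top_of_set {0..1::real}"
  let ?P = "prod_topology ?I X"
  \<comment> \<open>Nearness of fibres.\<close>
  let ?N = "(\<lambda>(x, y). (p x, p y)) ` W"
  let ?T = "prod_topology ?I ?P"
  have pp: "(\<lambda>(x, y). (p x, p y)) = (\<lambda>(z, x). (z, p x)) \<circ> (\<lambda>(x, y). (p x, y))" by auto
  have N: "openin (prod_topology B B) ?N"
  proof -
    have "openin (prod_topology E B) ((\<lambda>(z, x). (z, p x)) ` W)"
      using open_map_prod_right[OF p_open] W_open by (auto simp: open_map_def)
    then have "openin (prod_topology B E) ((\<lambda>(x, y). (y, x)) ` (\<lambda>(z, x). (z, p x)) ` W)"
      using homeomorphic_map_swap homeomorphic_imp_open_map unfolding open_map_def by blast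
    then have "openin (prod_topology B B) ((\<lambda>(z, x). (z, p x)) ` (\<lambda>(x, y). (y, x)) ` (\<lambda>(z, x). (z, p x)) ` W)"
      using open_map_prod_right[OF p_open] by (auto simp: open_map_def)
    then have "openin (prod_topology B B) ((\<lambda>(x, y). (y, x)) ` (\<lambda>(z, x). (z, p x)) ` (\<lambda>(x, y). (y, x)) ` (\<lambda>(z, x). (z, p x)) ` W)"
      using homeomorphic_map_swap homeomorphic_imp_open_map unfolding open_map_def by blast
    moreover have "(\<lambda>(x, y). (y, x)) ` (\<lambda>(z, x). (z, p x)) ` (\<lambda>(x, y). (y, x)) ` (\<lambda>(z, x). (z, p x)) ` W = ?N"
      by (auto simp: image_image case_prod_unfold)
    ultimately show ?thesis by simp
  qed
  have hB: "h (t, x) \<in> topspace B" if "t \<in> {0..1}" "x \<in> topspace X" for t x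
    using that h by (auto simp: continuous_map_def)
  have diag: "(b, b) \<in> ?N" if "b \<in> topspace B" for b
    using that p_onto W_refl by force
  have ch: "continuous_map ?T (prod_topology B B) (\<lambda>q. (h (fst q, snd (snd q)), h (snd q)))"
  proof (intro continuous_map_pairedI)
    have "continuous_map ?T ?P (\<lambda>q. (fst q, snd (snd q)))"
      using continuous_map_compose[OF continuous_map_snd continuous_map_snd, of ?I ?I X]
      by (intro continuous_map_pairedI continuous_map_fst) (simp add: o_def)
    from continuous_map_compose[OF this h]
    show "continuous_map ?T B (\<lambda>q. h (fst q, snd (snd q)))" by (simp add: o_def)
    from continuous_map_compose[OF continuous_map_snd h]
    show "continuous_map ?T B (\<lambda>q. h (snd q))" by (simp add: o_def)
  qed
  obtain \<delta> where \<delta>: "\<delta> > 0"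
    "\<And>s t x. \<lbrakk>s \<in> {0..1}; t \<in> {0..1}; x \<in> topspace X; \<bar>s - t\<bar> < \<delta>\<rbrakk> \<Longrightarrow> (h (s, x), h (t, x)) \<in> ?N"
  proof -
    let ?C = "{q \<in> topspace ?T. (h (fst q, snd (snd q)), h (snd q)) \<in> topspace (prod_topology B B) - ?N}"
    have "closedin ?T ?C"
      by (rule closedin_continuous_map_preimage[OF ch closedin_diff[OF closedin_topspace N]])
    moreover have "compact_space ?T"
      using X by (intro compact_space_unit_prod)
    ultimately have cC: "compactin ?T ?C" using closedin_compact_space by blast
    let ?d = "\<lambda>q::real \<times> real \<times> 'c. \<bar>fst q - fst (snd q)\<bar>"
    note fst = continuous_map_interval_fst[of ?P]
    have fst2: "continuous_map ?T euclideanreal (\<lambda>q. fst (snd q))"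
      using continuous_map_compose[OF continuous_map_snd continuous_map_fst, of ?I ?I X]
        continuous_map_in_subtopology by (fastforce simp: o_def)
    have cd: "continuous_map ?T euclideanreal ?d"
      by (intro continuous_intros fst fst2)
    have "compact (?d ` ?C)"
      using image_compactin[OF cC cd] by (simp only: compactin_euclidean_iff)
    moreover have "0 \<notin> ?d ` ?C" using diag hB by fastforce
    ultimately obtain \<delta> where \<delta>: "\<delta> > 0" "\<forall>x\<in>?d ` ?C. \<delta> \<le> dist 0 x"
      using separate_point_closed[of "?d ` ?C" 0] compact_imp_closed by blast
    show ?thesis
    proof (rule that[OF \<delta>(1)])
      fix s t x assume st: "s \<in> {0..1}" "t \<in> {0..1}" "x \<in> topspace X" "\<bar>s - t\<bar> < \<delta>"
      show "(h (s, x), h (t, x)) \<in> ?N"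
      proof (rule ccontr)
        assume "(h (s, x), h (t, x)) \<notin> ?N"
        then have "(s, t, x) \<in> ?C" using st hB by auto
        then have "?d (s, t, x) \<in> ?d ` ?C" by (rule imageI)
        then have "\<delta> \<le> dist 0 (?d (s, t, x))" by (rule bspec[OF \<delta>(2)])
        then show False using st(4) by simp
      qed
    qed
  qed
  obtain n :: nat where n: "inverse (Suc n) < \<delta>" using reals_Archimedean[OF \<delta>(1)] by blast
  \<comment> \<open>Stage \<open>i\<close> of the homotopy stops at time \<open>i / (n + 1)\<close>.\<close>
  define c where "c = (\<lambda>i (t::real). min t (real i * inverse (Suc n)))"
  have c01: "c i t \<in> {0..1}" if "t \<in> {0..1}" for i t using that by (auto simp: c_def)
  have cc: "continuous_map ?P ?P (\<lambda>q. (c i (fst q), snd q))" for i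
  proof (intro continuous_map_pairedI continuous_map_snd)
    have "continuous_map ?P euclideanreal (\<lambda>q. c i (fst q))"
    proof -
      note fst = continuous_map_interval_fst[of X]
      have "c i t = - max (- t) (- (real i * inverse (Suc n)))" for t by (auto simp: c_def)
      then show ?thesis
        by (simp only:) (intro continuous_intros continuous_map_max fst)
    qed
    then show "continuous_map ?P ?I (\<lambda>q. c i (fst q))"
      using c01 by (auto simp: continuous_map_in_subtopology)
  qed
  have "\<exists>k. continuous_map ?P E k \<and> (\<forall>t\<in>{0..1}. \<forall>x\<in>topspace X. p (k (t, x)) = h (c i t, x)) \<and>
      (\<forall>x\<in>topspace X. k (0, x) = f x)" for i
  proof (induction i)
    case 0
    have "continuous_map ?P E (\<lambda>q. f (snd q))"
      using continuous_map_compose[OF continuous_map_snd f, of ?I] by (simp add: o_def)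
    then show ?case using f0 by (intro exI[of _ "\<lambda>q. f (snd q)"]) (auto simp: c_def min_def)
  next
    case (Suc i)
    then obtain k where k: "continuous_map ?P E k"
      "\<And>t x. \<lbrakk>t \<in> {0..1}; x \<in> topspace X\<rbrakk> \<Longrightarrow> p (k (t, x)) = h (c i t, x)"
      "\<And>x. x \<in> topspace X \<Longrightarrow> k (0, x) = f x" by blast
    have g: "continuous_map ?P B (\<lambda>q. h (c (Suc i) (fst q), snd q))"
      using continuous_map_compose[OF cc h] by (simp add: o_def)
    have kE: "k q \<in> topspace E" if "q \<in> topspace ?P" for q
      using k(1) that by (auto simp: continuous_map_def)
    have near: "\<exists>y. (k q, y) \<in> W \<and> p y = h (c (Suc i) (fst q), snd q)" if q: "q \<in> topspace ?P" for q
    proof -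
      have t: "fst q \<in> {0..1}" "snd q \<in> topspace X" using q by auto
      have "real (Suc i) * inverse (Suc n) = real i * inverse (Suc n) + inverse (Suc n)"
        by (simp add: algebra_simps)
      moreover have "inverse (real (Suc n)) \<ge> 0" by simp
      ultimately have "\<bar>c i (fst q) - c (Suc i) (fst q)\<bar> \<le> inverse (Suc n)"
        unfolding c_def by linarith
      then have "(h (c i (fst q), snd q), h (c (Suc i) (fst q), snd q)) \<in> ?N"
        using n t c01 by (intro \<delta>(2)) auto
      then obtain x y where "(x, y) \<in> W" "p x = h (c i (fst q), snd q)" "p y = h (c (Suc i) (fst q), snd q)"
        by auto
      then show ?thesis using W_transport[of x y "k q"] kE[OF q] k(2)[OF t] by auto
    qed
    obtain k' where k': "continuous_map ?P E k'" "\<And>q. q \<in> topspace ?P \<Longrightarrow> p (k' q) = h (c (Suc i) (fst q), snd q)"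
      "\<And>q. q \<in> topspace ?P \<Longrightarrow> (k q, k' q) \<in> W"
      using lift_near[OF k(1) g near] by blast
    have "k' (0, x) = f x" if x: "x \<in> topspace X" for x
    proof -
      have q: "(0, x) \<in> topspace ?P" using x by auto
      have "c (Suc i) 0 = 0" by (simp add: c_def)
      then have "p (k' (0, x)) = p (k (0, x))" using k'(2)[OF q] k(3)[OF x] f0[OF x] by simp
      then show ?thesis using W_unique[OF k'(3)[OF q] W_refl[OF kE[OF q]]] k(3)[OF x] by simp
    qed
    then show ?case using k' by (intro exI[of _ k']) auto
  qed
  from this[of "Suc n"] obtain k where k: "continuous_map ?P E k"
    "\<And>t x. \<lbrakk>t \<in> {0..1}; x \<in> topspace X\<rbrakk> \<Longrightarrow> p (k (t, x)) = h (c (Suc n) t, x)"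
    "\<And>x. x \<in> topspace X \<Longrightarrow> k (0, x) = f x" by blast
  have "c (Suc n) t = t" if "t \<in> {0..1}" for t using that by (auto simp: c_def)
  then show ?thesis using that[OF k(1)] k(2,3) by simp
qed

end

section \<open>Paths in spheres\<close>

definition dotp :: "nat \<Rightarrow> (nat \<Rightarrow> real) \<Rightarrow> (nat \<Rightarrow> real) \<Rightarrow> real" where
  "dotp n x y = (\<Sum>i<n. x i * y i)"

lemma dotp_self: "dotp n x x = (enorm n x)\<^sup>2"
  unfolding dotp_def sum_sq_enorm [symmetric] by (simp add: power2_eq_square)

lemma dotp_simps:
  "dotp n (\<lambda>i. x i + y i) z = dotp n x z + dotp n y z"
  "dotp n z (\<lambda>i. x i + y i) = dotp n z x + dotp n z y"
  "dotp n (\<lambda>i. x i - y i) z = dotp n x z - dotp n y z"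
  "dotp n z (\<lambda>i. x i - y i) = dotp n z x - dotp n z y"
  "dotp n (\<lambda>i. a * x i) z = a * dotp n x z"
  "dotp n z (\<lambda>i. a * x i) = a * dotp n z x"
  "dotp n (\<lambda>i. x i / a) z = dotp n x z / a"
  "dotp n z (\<lambda>i. x i / a) = dotp n z x / a"
  by (simp_all add: dotp_def sum.distrib sum_subtractf algebra_simps sum_distrib_left sum_divide_distrib)

lemma dotp_commute: "dotp n x y = dotp n y x"
  by (simp add: dotp_def mult.commute)

abbreviation path_homotopic :: "'a topology \<Rightarrow> 'a \<Rightarrow> 'a \<Rightarrow> (real \<Rightarrow> 'a) \<Rightarrow> (real \<Rightarrow> 'a) \<Rightarrow> bool" where
  "path_homotopic X a b \<equiv> homotopic_with (\<lambda>h. h 0 = a \<and> h 1 = b) (top_of_set {0..1}) X"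

lemma continuous_map_normalize:
  assumes "\<And>i. continuous_map X euclideanreal (\<lambda>x. f x i)"
    and "\<And>x. x \<in> topspace X \<Longrightarrow> enorm (Suc p) (f x) \<noteq> 0"
    and "\<And>x i. \<lbrakk>x \<in> topspace X; i > p\<rbrakk> \<Longrightarrow> f x i = 0"
  shows "continuous_map X (nsphere p) (\<lambda>x i. f x i / enorm (Suc p) (f x))"
  unfolding continuous_map_coordinatewise(1)
proof (intro conjI allI Pi_I)
  fix i show "continuous_map X euclideanreal (\<lambda>x. f x i / enorm (Suc p) (f x))"
    using assms(1,2) by (intro continuous_map_real_divide continuous_map_enorm) auto
next
  fix x assume x: "x \<in> topspace X"
  show "(\<lambda>i. f x i / enorm (Suc p) (f x)) \<in> topspace (nsphere p)"
    using assms(2,3)[OF x] by (simp add: topspace_nsphere_iff enorm_divide)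
qed

text \<open>
  The straight line homotopy from \<open>f\<close> to a map at distance less than \<open>1\<close> avoids the origin and can be
  projected back to the sphere.
\<close>

lemma path_homotopic_normalize:
  assumes f: "continuous_map (top_of_set {0..1}) (nsphere p) f"
    and P: "\<And>i. continuous_on {0..1} (\<lambda>t. P t i)" "\<And>t i. \<lbrakk>t \<in> {0..1}; i > p\<rbrakk> \<Longrightarrow> P t i = 0"
    and near: "\<And>t. t \<in> {0..1} \<Longrightarrow> enorm (Suc p) (\<lambda>i. f t i - P t i) < 1"
    and ends: "P 0 = f 0" "P 1 = f 1"
  shows "path_homotopic (nsphere p) (f 0) (f 1) f (\<lambda>t i. P t i / enorm (Suc p) (P t))"
    and "\<And>t. t \<in> {0..1} \<Longrightarrow> enorm (Suc p) (P t) > 0"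
proof -
  let ?I = "top_of_set {0..1::real}"
  let ?Q = "\<lambda>q i. (1 - fst q) * f (snd q) i + fst q * P (snd q) i"
  let ?e = "enorm (Suc p)"
  have fS: "?e (f t) = 1" "i > p \<Longrightarrow> f t i = 0" if "t \<in> {0..1}" for t i
    using continuous_map_in_topspace[OF f, of t] that by (simp_all add: topspace_nsphere_iff)
  have pos: "?e (\<lambda>i. (1 - s) * f t i + s * P t i) > 0" if "s \<in> {0..1}" "t \<in> {0..1}" for s t
  proof -
    have "f t = (\<lambda>i. ((1 - s) * f t i + s * P t i) + s * (f t i - P t i))"
      by (auto simp: algebra_simps)
    then have "1 \<le> ?e (\<lambda>i. (1 - s) * f t i + s * P t i) + ?e (\<lambda>i. s * (f t i - P t i))"
      using enorm_triangle[of "Suc p" "\<lambda>i. (1 - s) * f t i + s * P t i" "\<lambda>i. s * (f t i - P t i)"] fS(1)[OF that(2)]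
      by simp
    moreover have "?e (\<lambda>i. s * (f t i - P t i)) \<le> 1 * ?e (\<lambda>i. f t i - P t i)"
      unfolding enorm_scale using that(1) by (intro mult_right_mono) auto
    ultimately show ?thesis using near[OF that(2)] by linarith
  qed
  note fst = continuous_map_interval_fst[of ?I]
  have snd: "continuous_map (prod_topology ?I ?I) euclideanreal (\<lambda>q. g (snd q))" if "continuous_map ?I euclideanreal g" for g
    using continuous_map_compose[OF continuous_map_snd that, of ?I] by (simp add: o_def)
  have cP: "continuous_map ?I euclideanreal (\<lambda>t. P t i)" for i using P(1) by simp
  have c: "continuous_map (prod_topology ?I ?I) (nsphere p) (\<lambda>q i. ?Q q i / ?e (?Q q))"
  proof (rule continuous_map_normalize)
    show "continuous_map (prod_topology ?I ?I) euclideanreal (\<lambda>q. ?Q q i)" for i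
      by (intro continuous_intros fst snd cP continuous_map_coordinate(1)[OF f])
    show "?e (?Q q) \<noteq> 0" if "q \<in> topspace (prod_topology ?I ?I)" for q
      using pos[of "fst q" "snd q"] that by (auto simp: less_le)
    show "?Q q i = 0" if "q \<in> topspace (prod_topology ?I ?I)" "i > p" for q i
      using fS(2)[of "snd q" i] P(2)[of "snd q" i] that by auto
  qed
  show "?e (P t) > 0" if "t \<in> {0..1}" for t using pos[of 1 t] that by simp
  show "path_homotopic (nsphere p) (f 0) (f 1) f (\<lambda>t i. P t i / ?e (P t))"
  proof (subst homotopic_with)
    show "\<exists>h. continuous_map (prod_topology ?I ?I) (nsphere p) h \<and> (\<forall>x\<in>topspace ?I. h (0, x) = f x) \<and>
      (\<forall>x\<in>topspace ?I. h (1, x) = (\<lambda>i. P x i / ?e (P x))) \<and>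
      (\<forall>t\<in>{0..1}. h (t, 0) = f 0 \<and> h (t, 1) = f 1)"
    proof (intro exI[of _ "\<lambda>q i. ?Q q i / ?e (?Q q)"] conjI ballI c)
      fix t :: real assume "t \<in> {0..1}"
      have "(\<lambda>i. (1 - t) * f j i + t * f j i) = f j" for j by (auto simp: algebra_simps)
      then show "(\<lambda>i. ?Q (t, 0) i / ?e (?Q (t, 0))) = f 0" "(\<lambda>i. ?Q (t, 1) i / ?e (?Q (t, 1))) = f 1"
        by (simp_all add: ends fS(1))
    qed (simp_all add: fS(1))
  qed auto
qed

text \<open>
  Stereographic projection from \<open>c\<close> onto the hyperplane orthogonal to \<open>c\<close>, without a choice of
  coordinates there.
\<close>

definition stereo :: "nat \<Rightarrow> (nat \<Rightarrow> real) \<Rightarrow> (nat \<Rightarrow> real) \<Rightarrow> nat \<Rightarrow> real" where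
  "stereo n c x = (\<lambda>i. (x i - dotp n x c * c i) / (1 - dotp n x c))"

definition stereo_inv :: "nat \<Rightarrow> (nat \<Rightarrow> real) \<Rightarrow> (nat \<Rightarrow> real) \<Rightarrow> nat \<Rightarrow> real" where
  "stereo_inv n c u = (\<lambda>i. (2 * u i + (dotp n u u - 1) * c i) / (dotp n u u + 1))"

lemma dotp_less_1:
  assumes "x \<in> topspace (nsphere p)" "c \<in> topspace (nsphere p)" "x \<noteq> c"
  shows "dotp (Suc p) x c < 1"
proof -
  have "enorm (Suc p) (\<lambda>i. x i - c i) \<noteq> 0"
  proof
    assume *: "enorm (Suc p) (\<lambda>i. x i - c i) = 0"
    have "x i = c i" for i
      using enorm_eq_0[OF *, of i] assms(1,2) by (cases "i < Suc p") (auto simp: topspace_nsphere_iff)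
    then show False using assms(3) by blast
  qed
  then have "0 < dotp (Suc p) (\<lambda>i. x i - c i) (\<lambda>i. x i - c i)" by (simp add: dotp_self)
  also have "\<dots> = 2 - 2 * dotp (Suc p) x c"
    using assms(1,2) by (simp add: dotp_simps dotp_commute[of _ c x] dotp_self topspace_nsphere_iff)
  finally show ?thesis by simp
qed

lemma dotp_stereo:
  assumes "x \<in> topspace (nsphere p)" "c \<in> topspace (nsphere p)" "x \<noteq> c"
  shows "dotp (Suc p) (stereo (Suc p) c x) c = 0"
  using assms by (simp add: stereo_def dotp_simps dotp_self topspace_nsphere_iff)

lemma stereo_inv_stereo:
  assumes "x \<in> topspace (nsphere p)" "c \<in> topspace (nsphere p)" "x \<noteq> c"
  shows "stereo_inv (Suc p) c (stereo (Suc p) c x) = x"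
proof -
  let ?a = "dotp (Suc p) x c"
  have a: "1 - ?a > 0" using dotp_less_1[OF assms] by simp
  have 1: "dotp (Suc p) x x = 1" "dotp (Suc p) c c = 1"
    using assms(1,2) by (simp_all add: dotp_self topspace_nsphere_iff)
  have "dotp (Suc p) (\<lambda>i. x i - ?a * c i) (\<lambda>i. x i - ?a * c i) = 1 - ?a\<^sup>2"
    unfolding dotp_simps 1 dotp_commute[of _ c x] by (simp add: power2_eq_square)
  then have "dotp (Suc p) (stereo (Suc p) c x) (stereo (Suc p) c x) = (1 - ?a\<^sup>2) / (1 - ?a) / (1 - ?a)"
    by (simp add: stereo_def dotp_simps(7,8))
  also have "\<dots> = (1 + ?a) / (1 - ?a)"
  proof -
    have "1 - ?a\<^sup>2 = (1 + ?a) * (1 - ?a)" by (simp add: power2_eq_square algebra_simps)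
    then show ?thesis using a by simp
  qed
  finally have d: "dotp (Suc p) (stereo (Suc p) c x) (stereo (Suc p) c x) = (1 + ?a) / (1 - ?a)" .
  have d1: "(1 + ?a) / (1 - ?a) + 1 = 2 / (1 - ?a)" and d2: "(1 + ?a) / (1 - ?a) - 1 = 2 * ?a / (1 - ?a)"
    using a by (simp_all add: field_simps)
  show ?thesis
  proof
    fix i
    have "stereo_inv (Suc p) c (stereo (Suc p) c x) i =
       (2 * ((x i - ?a * c i) / (1 - ?a)) + 2 * ?a / (1 - ?a) * c i) / (2 / (1 - ?a))"
      unfolding stereo_inv_def d d1 d2 by (simp add: stereo_def)
    also have "\<dots> = x i"
    proof -
      have "(2 * ((y - r * z) / b) + 2 * r / b * z) / (2 / b) = y" if "b > 0" for y r z b :: real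
        using that by (simp add: field_simps)
      then show ?thesis using a by blast
    qed
    finally show "stereo_inv (Suc p) c (stereo (Suc p) c x) i = x i" .
  qed
qed

lemma stereo_inv_in:
  assumes c: "c \<in> topspace (nsphere p)" and u: "dotp (Suc p) u c = 0" "\<And>i. i > p \<Longrightarrow> u i = 0"
  shows "stereo_inv (Suc p) c u \<in> topspace (nsphere p)"
proof -
  let ?r = "dotp (Suc p) u u"
  have r: "?r + 1 > 0" by (simp add: dotp_self add_nonneg_pos)
  have "dotp (Suc p) (\<lambda>i. 2 * u i + (?r - 1) * c i) (\<lambda>i. 2 * u i + (?r - 1) * c i) = 4 * ?r + (?r - 1)\<^sup>2"
  proof -
    have 1: "dotp (Suc p) c c = 1" using c by (simp add: dotp_self topspace_nsphere_iff)
    show ?thesis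
      unfolding dotp_simps 1 dotp_commute[of _ c u] u(1) by (simp add: power2_eq_square)
  qed
  also have "\<dots> = (?r + 1)\<^sup>2" by (simp add: power2_eq_square algebra_simps)
  finally have e: "dotp (Suc p) (\<lambda>i. 2 * u i + (?r - 1) * c i) (\<lambda>i. 2 * u i + (?r - 1) * c i) = (?r + 1)\<^sup>2" .
  have "(enorm (Suc p) (stereo_inv (Suc p) c u))\<^sup>2 = (?r + 1)\<^sup>2 / (?r + 1) / (?r + 1)"
    unfolding dotp_self [symmetric] stereo_inv_def dotp_simps(7,8) e ..
  also have "\<dots> = 1" using r by (simp add: power2_eq_square)
  finally have "(enorm (Suc p) (stereo_inv (Suc p) c u))\<^sup>2 = 1" .
  then have "enorm (Suc p) (stereo_inv (Suc p) c u) = 1"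
    using enorm_nonneg[of "Suc p" "stereo_inv (Suc p) c u"] by (simp add: power2_eq_1_iff)
  then show ?thesis using c u(2) by (simp add: topspace_nsphere_iff stereo_inv_def)
qed

lemma continuous_map_dotp:
  assumes "\<And>i. continuous_map X euclideanreal (\<lambda>x. f x i)" "\<And>i. continuous_map X euclideanreal (\<lambda>x. g x i)"
  shows "continuous_map X euclideanreal (\<lambda>x. dotp n (f x) (g x))"
  unfolding dotp_def by (intro continuous_map_sum continuous_map_real_mult assms) auto

text \<open>
  The complement of \<open>c\<close> in the sphere is homeomorphic to a vector space, where paths with the same
  ends are homotopic along straight lines.
\<close>

lemma path_homotopic_avoiding:
  assumes c: "c \<in> topspace (nsphere p)"
    and f: "continuous_map (top_of_set {0..1}) (nsphere p) f" "\<And>t. t \<in> {0..1} \<Longrightarrow> f t \<noteq> c"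
    and g: "continuous_map (top_of_set {0..1}) (nsphere p) g" "\<And>t. t \<in> {0..1} \<Longrightarrow> g t \<noteq> c"
    and ends: "f 0 = g 0" "f 1 = g 1"
  shows "path_homotopic (nsphere p) (f 0) (f 1) f g"
proof -
  let ?I = "top_of_set {0..1::real}"
  let ?s = "stereo (Suc p) c"
  let ?U = "\<lambda>q i. (1 - fst q) * ?s (f (snd q)) i + fst q * ?s (g (snd q)) i"
  let ?H = "\<lambda>q. stereo_inv (Suc p) c (?U q)"
  have fS: "f t \<in> topspace (nsphere p)" "g t \<in> topspace (nsphere p)" if "t \<in> {0..1}" for t
    using continuous_map_in_topspace[OF f(1), of t] continuous_map_in_topspace[OF g(1), of t] that by simp_all
  note fst = continuous_map_interval_fst[of ?I]
  have cs: "continuous_map (prod_topology ?I ?I) euclideanreal (\<lambda>q. ?s (h (snd q)) i)"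
    if h: "continuous_map ?I (nsphere p) h" "\<And>t. t \<in> {0..1} \<Longrightarrow> h t \<noteq> c" for h i
  proof -
    have ch: "continuous_map (prod_topology ?I ?I) euclideanreal (\<lambda>q. h (snd q) i)" for i
      using continuous_map_compose[OF continuous_map_snd continuous_map_coordinate(1)[OF h(1), of i], of ?I]
      by (simp add: o_def)
    have "1 - dotp (Suc p) (h (snd q)) c \<noteq> 0" if "q \<in> topspace (prod_topology ?I ?I)" for q
    proof -
      have "snd q \<in> {0..1}" using that by auto
      then show ?thesis
        using dotp_less_1[OF _ c h(2)] continuous_map_in_topspace[OF h(1)] by fastforce
    qed
    then show ?thesis unfolding stereo_def
      by (intro continuous_map_real_divide continuous_intros continuous_map_dotp ch) auto
  qed
  have cU: "continuous_map (prod_topology ?I ?I) euclideanreal (\<lambda>q. ?U q i)" for i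
    by (intro continuous_intros fst cs f g)
  have cH: "continuous_map (prod_topology ?I ?I) (nsphere p) ?H"
    unfolding continuous_map_coordinatewise(1)
  proof (intro conjI allI Pi_I)
    fix i
    have nz: "dotp n u u + 1 \<noteq> 0" for n u using zero_le_power2[of "enorm n u"] unfolding dotp_self by linarith
    have cd: "continuous_map (prod_topology ?I ?I) euclideanreal (\<lambda>q. dotp (Suc p) (?U q) (?U q))"
      by (rule continuous_map_dotp[OF cU cU])
    have "continuous_map (prod_topology ?I ?I) euclideanreal (\<lambda>q. 2 * ?U q i + (dotp (Suc p) (?U q) (?U q) - 1) * c i)"
      by (intro continuous_map_add continuous_map_diff continuous_map_real_mult cU cd) simp_all
    moreover have "continuous_map (prod_topology ?I ?I) euclideanreal (\<lambda>q. dotp (Suc p) (?U q) (?U q) + 1)"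
      by (intro continuous_map_add cd) simp
    ultimately show "continuous_map (prod_topology ?I ?I) euclideanreal (\<lambda>q. ?H q i)"
      unfolding stereo_inv_def by (rule continuous_map_real_divide) (rule nz)
  next
    fix q assume "q \<in> topspace (prod_topology ?I ?I)"
    then have q: "snd q \<in> {0..1}" by auto
    have "dotp (Suc p) (?s (f (snd q))) c = 0" "dotp (Suc p) (?s (g (snd q))) c = 0"
      using dotp_stereo[OF _ c] fS[OF q] f(2)[OF q] g(2)[OF q] by auto
    then have "dotp (Suc p) (?U q) c = 0" by (simp add: dotp_simps)
    moreover have "?U q i = 0" if "i > p" for i
      using fS[OF q] c that by (simp add: stereo_def topspace_nsphere_iff)
    ultimately show "?H q \<in> topspace (nsphere p)" using stereo_inv_in[OF c] by blast
  qed
  have inv: "stereo_inv (Suc p) c (?s (f t)) = f t" "stereo_inv (Suc p) c (?s (g t)) = g t" if "t \<in> {0..1}" for t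
    using stereo_inv_stereo[OF _ c] fS[OF that] f(2)[OF that] g(2)[OF that] by auto
  show ?thesis
  proof (subst homotopic_with)
    show "\<exists>h. continuous_map (prod_topology ?I ?I) (nsphere p) h \<and> (\<forall>x\<in>topspace ?I. h (0, x) = f x) \<and>
      (\<forall>x\<in>topspace ?I. h (1, x) = g x) \<and> (\<forall>t\<in>{0..1}. h (t, 0) = f 0 \<and> h (t, 1) = f 1)"
    proof (intro exI[of _ ?H] conjI ballI cH)
      fix t :: real assume "t \<in> {0..1}"
      have "(\<lambda>i. (1 - t) * ?s x i + t * ?s x i) = ?s x" for x by (auto simp: algebra_simps)
      then show "?H (t, 0) = f 0" "?H (t, 1) = f 1"
        using inv(2)[of 0] inv(2)[of 1] by (simp_all add: ends)
    qed (simp_all add: inv)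
  qed auto
qed

text \<open>
  Bernstein polynomials approximate uniformly and agree with the approximated function at \<open>0\<close> and
  at \<open>1\<close>, so the homotopy to the approximation keeps the ends fixed.
\<close>

lemma Bernstein_path:
  fixes f :: "real \<Rightarrow> nat \<Rightarrow> real"
  assumes f: "continuous_map (top_of_set {0..1}) (nsphere p) f"
  obtains P where "\<And>i t. (\<lambda>t. P t i) differentiable at t" "\<And>t i. i > p \<Longrightarrow> P t i = 0"
    "\<And>t. t \<in> {0..1} \<Longrightarrow> enorm (Suc p) (\<lambda>i. f t i - P t i) < 1" "P 0 = f 0" "P 1 = f 1"
proof -
  have cf: "continuous_on {0..1} (\<lambda>t. f t i)" for i
    using continuous_map_coordinate(1)[OF f, of i] by simp
  \<comment> \<open>There are \<open>p + 1\<close> coordinates, and the sum of the errors has to be less than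
    \<open>1\<close>.\<close>
  let ?e = "1 / real (p + 2)"
  have "\<exists>N. \<forall>n x. N \<le> n \<and> x \<in> {0..1} \<longrightarrow> \<bar>f x i - (\<Sum>k\<le>n. f (k / n) i * Bernstein n k x)\<bar> < ?e" for i
    using Bernstein_Weierstrass[OF cf[of i], of ?e] by simp
  then obtain N where N: "\<And>i n x. \<lbrakk>N i \<le> n; x \<in> {0..1}\<rbrakk> \<Longrightarrow> \<bar>f x i - (\<Sum>k\<le>n. f (k / n) i * Bernstein n k x)\<bar> < ?e"
    by metis
  define n where "n = Suc (\<Sum>i\<le>p. N i)"
  have n: "n \<ge> 1" "N i \<le> n" if "i \<le> p" for i
    using member_le_sum[of i "{..p}" N] that by (auto simp: n_def)
  then have n1: "n \<ge> 1" by blast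
  define P where "P = (\<lambda>t i. \<Sum>k\<le>n. f (k / n) i * Bernstein n k t)"
  show ?thesis
  proof
    show "(\<lambda>t. P t i) differentiable at t" for i t
      unfolding P_def Bernstein_def by (intro derivative_intros) auto
    show "P t i = 0" if "i > p" for t i
    proof -
      have "f (k / n) i = 0" if "k \<le> n" for k
        using continuous_map_in_topspace[OF f, of "k / n"] \<open>i > p\<close> n1 that
        by (auto simp: topspace_nsphere_iff)
      then show ?thesis by (simp add: P_def)
    qed
    show "enorm (Suc p) (\<lambda>i. f t i - P t i) < 1" if "t \<in> {0..1}" for t
    proof -
      have "enorm (Suc p) (\<lambda>i. f t i - P t i) \<le> (\<Sum>i<Suc p. \<bar>f t i - P t i\<bar>)"
        unfolding enorm_L2_set by (rule L2_set_le_sum_abs)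
      also have "\<dots> \<le> (\<Sum>i<Suc p. ?e)"
        using N n that unfolding P_def by (intro sum_mono) (simp add: less_eq_real_def)
      also have "\<dots> < 1" by (simp add: field_simps)
      finally show ?thesis .
    qed
    have B: "Bernstein n k 0 = (if k = 0 then 1 else 0)" "Bernstein n k 1 = (if k = n then 1 else 0)" if "k \<le> n" for k
      using that by (auto simp: Bernstein_def power_0_left)
    show "P 0 = f 0" "P 1 = f 1"
      using n1 by (auto simp: P_def B fun_eq_iff if_distrib cong: if_cong)
  qed
qed

text \<open>
  The cone over a differentiable path is the image of a two-dimensional space in \<open>\<real>\<^sup>3\<close> and so is
  negligible.  Hence some direction in the first three coordinates avoids the cones over both paths;
  this is where the sphere must have dimension at least two.
\<close>

lemma missed_direction:
  assumes P: "\<And>i t. (\<lambda>t. P t i) differentiable at (t::real)" and Q: "\<And>i t. (\<lambda>t. Q t i) differentiable at (t::real)"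
    and p: "p \<ge> 2"
  obtains c where "c \<in> topspace (nsphere p)" "\<And>t a. P t \<noteq> (\<lambda>i. a * c i) \<or> a = 0" "\<And>t a. Q t \<noteq> (\<lambda>i. a * c i) \<or> a = 0"
proof -
  \<comment> \<open>The cone over a path, in the first three coordinates.\<close>
  let ?F = "\<lambda>R::real \<Rightarrow> nat \<Rightarrow> real. \<lambda>q::real \<times> real. (fst q * R (snd q) 0, fst q * R (snd q) 1, fst q * R (snd q) 2)"
  have neg: "negligible (range (?F R))" if R: "\<And>i t. (\<lambda>t. R t i) differentiable at t" for R
  proof (rule negligible_differentiable_image_lowdim)
    have s: "(\<lambda>q::real \<times> real. R (snd q) i) differentiable at q" for i q
      using differentiable_chain_at[OF bounded_linear_imp_differentiable[OF bounded_linear_snd] R, of i q]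
      unfolding o_def .
    have m: "(\<lambda>q::real \<times> real. fst q * R (snd q) i) differentiable at q" for i q
      by (rule differentiable_mult[OF bounded_linear_imp_differentiable[OF bounded_linear_fst] s])
    have "?F R differentiable at q" for q
      by (rule differentiable_Pair[OF m differentiable_Pair[OF m m]])
    then show "?F R differentiable_on UNIV"
      unfolding differentiable_on_def by (simp add: differentiable_at_withinI)
  qed simp
  have "negligible (range (?F P) \<union> range (?F Q))" by (intro negligible_Un neg P Q)
  then have "range (?F P) \<union> range (?F Q) \<noteq> UNIV" using non_negligible_UNIV by metis
  then obtain d where d: "d \<notin> range (?F P) \<union> range (?F Q)" by blast
  obtain x y z where xyz: "d = (x, y, z)" by (cases d) auto
  define v where "v = (\<lambda>i::nat. if i = 0 then x else if i = 1 then y else if i = 2 then z else 0)"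
  let ?r = "enorm (Suc p) v"
  have dv: "d = (v 0, v 1, v 2)" by (simp add: xyz v_def)
  have "?r \<noteq> 0"
  proof
    assume "?r = 0"
    then have "v 0 = 0" "v 1 = 0" "v 2 = 0" using enorm_eq_0 p by auto
    then have "d = ?F P (0, 0)" by (simp add: dv)
    then show False using d by blast
  qed
  then have r: "?r > 0" using enorm_nonneg[of "Suc p" v] by linarith
  define c where "c = (\<lambda>i. v i / ?r)"
  have key: "R t \<noteq> (\<lambda>i. a * c i) \<or> a = 0" if "d \<notin> range (?F R)" for R t a
  proof (rule ccontr)
    assume "\<not> (R t \<noteq> (\<lambda>i. a * c i) \<or> a = 0)"
    then have "R t = (\<lambda>i. a * c i)" "a \<noteq> 0" by auto
    then have "d = ?F R (?r / a, t)" using r by (simp add: dv c_def)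
    then show False using that by blast
  qed
  show ?thesis
  proof
    show "c \<in> topspace (nsphere p)"
      using r p by (auto simp: topspace_nsphere_iff c_def enorm_divide v_def)
  qed (use key d in blast)+
qed

text \<open>
  Both paths are deformed to smooth ones, which together miss a point of the sphere; in the complement
  of that point they are homotopic.
\<close>

theorem nsphere_path_homotopic:
  assumes p: "p \<ge> 2"
    and f: "continuous_map (top_of_set {0..1}) (nsphere p) f" and g: "continuous_map (top_of_set {0..1}) (nsphere p) g"
    and ends: "f 0 = g 0" "f 1 = g 1"
  shows "path_homotopic (nsphere p) (f 0) (f 1) f g"
proof -
  let ?e = "enorm (Suc p)"
  obtain P where P: "\<And>i t. (\<lambda>t. P t i) differentiable at t" "\<And>t i. i > p \<Longrightarrow> P t i = 0"
    "\<And>t. t \<in> {0..1} \<Longrightarrow> ?e (\<lambda>i. f t i - P t i) < 1" "P 0 = f 0" "P 1 = f 1"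
    by (rule Bernstein_path[OF f]) (rule that)
  obtain Q where Q: "\<And>i t. (\<lambda>t. Q t i) differentiable at t" "\<And>t i. i > p \<Longrightarrow> Q t i = 0"
    "\<And>t. t \<in> {0..1} \<Longrightarrow> ?e (\<lambda>i. g t i - Q t i) < 1" "Q 0 = g 0" "Q 1 = g 1"
    by (rule Bernstein_path[OF g]) (rule that)
  have co: "continuous_on {0..1} (\<lambda>t. R t i)" if "\<And>i t. (\<lambda>t. R t i) differentiable at t" for R :: "real \<Rightarrow> nat \<Rightarrow> real" and i
    by (intro continuous_at_imp_continuous_on ballI differentiable_imp_continuous_within that)
  have hf: "path_homotopic (nsphere p) (f 0) (f 1) f (\<lambda>t i. P t i / ?e (P t))"
    "\<And>t. t \<in> {0..1} \<Longrightarrow> ?e (P t) > 0"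
    using path_homotopic_normalize[where f = f and P = P and p = p, OF f] co[of P] P by simp_all
  have hg: "path_homotopic (nsphere p) (g 0) (g 1) g (\<lambda>t i. Q t i / ?e (Q t))"
    "\<And>t. t \<in> {0..1} \<Longrightarrow> ?e (Q t) > 0"
    using path_homotopic_normalize[where f = g and P = Q and p = p, OF g] co[of Q] Q by simp_all
  let ?f = "\<lambda>t i. P t i / ?e (P t)" and ?g = "\<lambda>t i. Q t i / ?e (Q t)"
  obtain c where c: "c \<in> topspace (nsphere p)" "\<And>t a. P t \<noteq> (\<lambda>i. a * c i) \<or> a = 0" "\<And>t a. Q t \<noteq> (\<lambda>i. a * c i) \<or> a = 0"
    by (rule missed_direction[OF P(1) Q(1) p]) (rule that)
  have avoid: "(\<lambda>i. R i / r) \<noteq> c" if "r > 0" "\<And>a. R \<noteq> (\<lambda>i. a * c i) \<or> a = 0" for R r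
  proof
    assume "(\<lambda>i. R i / r) = c"
    then have "R = (\<lambda>i. r * c i)" using that(1) by auto
    then show False using that by blast
  qed
  have "path_homotopic (nsphere p) (?f 0) (?f 1) ?f ?g"
  proof (rule path_homotopic_avoiding[OF c(1)])
    show "continuous_map (top_of_set {0..1}) (nsphere p) ?f" "continuous_map (top_of_set {0..1}) (nsphere p) ?g"
      using hf(1) hg(1) homotopic_with_imp_continuous_maps by blast+
    show "?f t \<noteq> c" "?g t \<noteq> c" if "t \<in> {0..1}" for t
      using avoid[OF hf(2)[OF that]] avoid[OF hg(2)[OF that]] c(2,3) by blast+
  qed (simp_all add: P Q ends)
  moreover have "?f 0 = f 0" "?f 1 = f 1"
    using homotopic_with_imp_property[OF hf(1)] by auto
  ultimately show ?thesis
    using homotopic_with_trans[OF homotopic_with_trans[OF hf(1)] homotopic_with_symD[OF hg(1)[folded ends]]]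
    by simp
qed

section \<open>Loops as paths, and lifting maps of spheres\<close>

lemma disc_path_connected: "path_connected_space (disc k)"
  unfolding path_connected_space_def pathin_def
proof (intro ballI)
  fix x y assume x: "x \<in> topspace (disc k)" and y: "y \<in> topspace (disc k)"
  have c: "continuous_map (top_of_set {0..1}) (disc k) (\<lambda>t i. (1 - t) * x i + t * y i)"
    unfolding continuous_map_coordinatewise(2)
  proof (intro conjI allI Pi_I)
    fix i show "continuous_map (top_of_set {0..1}) euclideanreal (\<lambda>t. (1 - t) * x i + t * y i)"
      by (auto intro!: continuous_intros)
  next
    fix t :: real assume "t \<in> topspace (top_of_set {0..1})"
    then show "(\<lambda>i. (1 - t) * x i + t * y i) \<in> topspace (disc k)"
      using x y by (intro convex_disc) auto
  qed
  show "\<exists>g. continuous_map (top_of_set {0..1::real}) (disc k) g \<and> g 0 = x \<and> g 1 = y"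
    by (rule exI, rule conjI, rule c) simp
qed

text \<open>
  A sphere of positive dimension is the image of a convex disc under \<open>ball_collapse\<close>.
\<close>

lemma connected_space_nsphere: "k \<ge> 1 \<Longrightarrow> connected_space (nsphere k)"
  using connected_space_quotient_map_image[OF continuous_imp_quotient_map[OF continuous_map_ball_collapse
        compact_space_disc Hausdorff_space_nsphere ball_collapse_image]]
    path_connected_imp_connected_space[OF disc_path_connected] by blast

lemma connected_space_unit_interval: "connected_space (top_of_set {0..1::real})"
  by (simp add: connected_space_subtopology)

lemma axes_extend_cong:
  assumes "axes_extend k m X \<alpha> \<beta>" "\<And>x. x \<in> topspace (nsphere k) \<Longrightarrow> \<alpha> x = \<alpha>' x"
    "\<And>y. y \<in> topspace (nsphere m) \<Longrightarrow> \<beta> y = \<beta>' y"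
  shows "axes_extend k m X \<alpha>' \<beta>'"
  using assms unfolding axes_extend_def by auto

lemma whitehead_map_compose: "whitehead_map k m (p \<circ> \<alpha>) (p \<circ> \<beta>) z = p (whitehead_map k m \<alpha> \<beta> z)"
  by (simp add: whitehead_map_def Let_def)

lemma sphere_class_cong:
  assumes f: "sphere_map m X x0 f" and fg: "\<And>x. x \<in> topspace (nsphere m) \<Longrightarrow> f x = g x"
  shows "sphere_class m X x0 f = sphere_class m X x0 g"
proof (rule based_homotopic_imp_class_eq, rule homotopic_with_equal)
  show "f sphere_pt = x0" "g sphere_pt = x0" using f fg[OF sphere_pt_in] by (auto simp: sphere_map_def)
qed (use f fg in \<open>auto simp: sphere_map_def\<close>)

definition circle_path :: "real \<Rightarrow> nat \<Rightarrow> real" where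
  "circle_path t = (\<lambda>i. if i = 0 then cos (2 * pi * t) else if i = 1 then sin (2 * pi * t) else 0)"

lemma circle_path_in: "circle_path t \<in> topspace (nsphere 1)"
  by (simp add: topspace_nsphere_iff enorm_def circle_path_def)

lemma continuous_map_circle_path: "continuous_map euclideanreal (nsphere 1) circle_path"
  unfolding continuous_map_coordinatewise(1) circle_path_def[abs_def]
proof (intro conjI allI)
  fix i show "continuous_map euclideanreal euclideanreal
      (\<lambda>x. (if i = 0 then cos (2 * pi * x) else if i = 1 then sin (2 * pi * x) else 0))"
    by (cases "i = 0"; cases "i = 1"; simp; intro continuous_intros)
qed (use circle_path_in in \<open>auto simp: circle_path_def[abs_def]\<close>)

lemma circle_path_0 [simp]: "circle_path 0 = sphere_pt"
  and circle_path_1 [simp]: "circle_path 1 = sphere_pt"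
  by (auto simp: circle_path_def sphere_pt_def)

lemma circle_path_eqD:
  assumes "circle_path s = circle_path t" "s \<in> {0..1}" "t \<in> {0..1}"
  shows "s = t \<or> {s, t} = {0, 1}"
proof -
  have "circle_path s 0 = circle_path t 0" "circle_path s 1 = circle_path t 1" using assms(1) by simp_all
  then have "sin (2 * pi * s) = sin (2 * pi * t) \<and> cos (2 * pi * s) = cos (2 * pi * t)"
    by (simp add: circle_path_def)
  then obtain n :: int where "2 * pi * s = 2 * pi * t + 2 * pi * n" unfolding sin_cos_eq_iff by blast
  then have "2 * pi * s = 2 * pi * (t + n)" by (simp add: algebra_simps)
  then have st: "s = t + n" by simp
  then have "\<bar>real_of_int n\<bar> \<le> 1" using assms(2,3) by auto
  then have "n = -1 \<or> n = 0 \<or> n = 1" by linarith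
  then show ?thesis using st assms(2,3) by (elim disjE) auto
qed

lemma circle_path_surj:
  assumes "y \<in> topspace (nsphere 1)"
  obtains t where "t \<in> {0..1}" "circle_path t = y"
proof -
  have "(enorm (Suc 1) y)\<^sup>2 = 1" using assms by (simp add: topspace_nsphere_iff)
  then have "(y 0)\<^sup>2 + (y 1)\<^sup>2 = 1" unfolding sum_sq_enorm [symmetric] by simp
  then obtain \<theta> where \<theta>: "0 \<le> \<theta>" "\<theta> < 2 * pi" "y 0 = cos \<theta>" "y 1 = sin \<theta>" by (rule sincos_total_2pi)
  have "circle_path (\<theta> / (2 * pi)) = y"
  proof
    fix i show "circle_path (\<theta> / (2 * pi)) i = y i"
      using \<theta>(3,4) assms by (cases "i = 0"; cases "i = 1") (auto simp: circle_path_def topspace_nsphere_iff)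
  qed
  then show ?thesis using that[of "\<theta> / (2 * pi)"] \<theta> by simp
qed

lemma quotient_map_circle_path:
  assumes X: "compact_space X" "Hausdorff_space X"
  shows "quotient_map (prod_topology X (top_of_set {0..1})) (prod_topology X (nsphere 1)) (\<lambda>(x, t). (x, circle_path t))"
proof (rule continuous_imp_quotient_map)
  let ?I = "top_of_set {0..1::real}"
  have "continuous_map ?I (nsphere 1) circle_path"
    using continuous_map_from_subtopology[OF continuous_map_circle_path] .
  from continuous_map_compose[OF continuous_map_snd this, of X]
  have "continuous_map (prod_topology X ?I) (nsphere 1) (\<lambda>q. circle_path (snd q))"
    unfolding o_def .
  then show "continuous_map (prod_topology X ?I) (prod_topology X (nsphere 1)) (\<lambda>(x, t). (x, circle_path t))"
    unfolding case_prod_unfold by (intro continuous_map_pairedI continuous_map_fst)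
  show "compact_space (prod_topology X ?I)" using X by (simp add: compact_space_prod_topology compact_space_subtopology)
  show "Hausdorff_space (prod_topology X (nsphere 1))" using X by (simp add: Hausdorff_space_prod_topology Hausdorff_space_nsphere)
  show "(\<lambda>(x, t). (x, circle_path t)) ` topspace (prod_topology X ?I) = topspace (prod_topology X (nsphere 1))"
  proof
    show "(\<lambda>(x, t). (x, circle_path t)) ` topspace (prod_topology X ?I) \<subseteq> topspace (prod_topology X (nsphere 1))"
      using circle_path_in by auto
    show "topspace (prod_topology X (nsphere 1)) \<subseteq> (\<lambda>(x, t). (x, circle_path t)) ` topspace (prod_topology X ?I)"
    proof
      fix q assume "q \<in> topspace (prod_topology X (nsphere 1))"
      then have "fst q \<in> topspace X" "snd q \<in> topspace (nsphere 1)" by auto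
      moreover from this(2) obtain t where "t \<in> {0..1}" "circle_path t = snd q" by (rule circle_path_surj)
      ultimately show "q \<in> (\<lambda>(x, t). (x, circle_path t)) ` topspace (prod_topology X ?I)"
        by (intro image_eqI[of _ _ "(fst q, t)"]) auto
    qed
  qed
qed

text \<open>
  In terms of paths, \<open>sphere_mult\<close> is the concatenation at double speed.
\<close>

lemma sphere_mult_circle_path:
  assumes "t \<in> {0..1}" "f sphere_pt = g sphere_pt"
  shows "sphere_mult f g (circle_path t) = (if t \<le> 1/2 then f (circle_path (2 * t)) else g (circle_path (2 * t - 1)))"
proof -
  have c: "cos (4 * pi * t) = 1 - 2 * (sin (2 * pi * t))\<^sup>2" "sin (4 * pi * t) = 2 * sin (2 * pi * t) * cos (2 * pi * t)"
  proof -
    have d: "4 * pi * t = 2 * (2 * pi * t)" by simp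
    show "cos (4 * pi * t) = 1 - 2 * (sin (2 * pi * t))\<^sup>2"
      "sin (4 * pi * t) = 2 * sin (2 * pi * t) * cos (2 * pi * t)"
      unfolding d by (rule cos_double_sin, rule sin_double)
  qed
  have f: "sphere_fold (circle_path t) = circle_path (2 * t)"
  proof
    have e: "2 * pi * (2 * t) = 4 * pi * t" by simp
    show "sphere_fold (circle_path t) i = circle_path (2 * t) i" for i
      unfolding sphere_fold_def circle_path_def e c by simp
  qed
  have per: "circle_path (2 * t - 1) = circle_path (2 * t)"
  proof -
    have "2 * pi * (2 * t - 1) = 2 * pi * (2 * t) - 2 * pi" by (simp add: algebra_simps)
    then show ?thesis
      unfolding circle_path_def by (simp only: cos_diff sin_diff cos_two_pi sin_two_pi) (simp add: fun_eq_iff)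
  qed
  show ?thesis
  proof (cases "t \<le> 1/2")
    case True
    then have "sin (2 * pi * t) \<ge> 0" using assms by (intro sin_ge_zero) auto
    then show ?thesis using True f by (simp add: sphere_mult_def circle_path_def)
  next
    case False
    show ?thesis
    proof (cases "t = 1")
      case True
      then show ?thesis using f assms(2) per by (simp add: sphere_mult_def)
    next
      case nt: False
      have "sin (2 * pi * t - pi) > 0" using False nt assms by (intro sin_gt_zero) (auto simp: field_simps)
      then have "sin (2 * pi * t) < 0" by (simp add: sin_diff)
      then show ?thesis using False f per by (simp add: sphere_mult_def circle_path_def)
    qed
  qed
qed

context nearness_covering
begin

text \<open>
  A map of \<open>S\<^sup>m\<close> is a map of the disc \<open>D\<^sup>m\<close> that is constant on its boundary.  It is lifted as a
  contraction of the disc to a boundary point.  On the boundary, which is connected for \<open>m \<ge> 2\<close>, the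
  lift stays in one fibre and so is constant; hence it factors through \<open>S\<^sup>m\<close>.
\<close>

lemma lift_sphere_map:
  assumes m: "m \<ge> 2" and a: "sphere_map m B b0 \<alpha>" and e: "e0 \<in> topspace E" "p e0 = b0"
  obtains \<alpha>' where "sphere_map m E e0 \<alpha>'" "\<And>x. x \<in> topspace (nsphere m) \<Longrightarrow> p (\<alpha>' x) = \<alpha> x"
proof -
  let ?I = "top_of_set {0..1::real}"
  let ?c = "\<lambda>q i. (1 - fst q) * sphere_pt i + fst q * snd q i"
  have m1: "m \<ge> 1" using m by simp
  have ca: "continuous_map (nsphere m) B \<alpha>" "\<alpha> sphere_pt = b0" using a by (auto simp: sphere_map_def)
  note bp = ball_collapse_sphere_pt[OF m1]
  note fst = continuous_map_interval_fst[of "disc m"]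
  have "continuous_map (prod_topology ?I (disc m)) (disc m) ?c"
    unfolding continuous_map_coordinatewise(2)
    using sphere_pt_in_disc[OF m1]
    by (intro conjI allI Pi_I continuous_intros fst continuous_map_coordinate(2)[OF continuous_map_snd] convex_disc) auto
  from continuous_map_compose[OF continuous_map_compose[OF this continuous_map_ball_collapse] ca(1)]
  have h: "continuous_map (prod_topology ?I (disc m)) B (\<lambda>q. \<alpha> (ball_collapse m (?c q)))" by (simp add: o_def)
  obtain k where k: "continuous_map (prod_topology ?I (disc m)) E k"
    "\<And>t x. \<lbrakk>t \<in> {0..1}; x \<in> topspace (disc m)\<rbrakk> \<Longrightarrow> p (k (t, x)) = \<alpha> (ball_collapse m (?c (t, x)))"
    "\<And>x. x \<in> topspace (disc m) \<Longrightarrow> k (0, x) = e0"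
    by (rule homotopy_lifting[OF compact_space_disc h, of "\<lambda>_. e0"]) (use e bp ca in auto)
  have k1: "continuous_map (disc m) E (\<lambda>x. k (1, x))"
    using continuous_map_compose[OF _ k(1), of "disc m" "\<lambda>x. (1, x)"] by (simp add: o_def continuous_map_paired)
  have pk1: "p (k (1, x)) = \<alpha> (ball_collapse m x)" if "x \<in> topspace (disc m)" for x
    using k(2)[of 1 x] that by simp
  have base: "k (1, sphere_pt) = e0"
  proof -
    have "continuous_map ?I E (\<lambda>t. k (t, sphere_pt))"
      using continuous_map_compose[OF _ k(1), of ?I "\<lambda>t. (t, sphere_pt)"] sphere_pt_in_disc[OF m1]
      by (simp add: o_def continuous_map_paired)
    moreover have "p (k (t, sphere_pt)) = b0" if "t \<in> topspace ?I" for t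
    proof -
      have "?c (t, sphere_pt) = sphere_pt" by (auto simp: algebra_simps)
      then show ?thesis using k(2)[of t sphere_pt] that sphere_pt_in_disc[OF m1] bp ca(2) by simp
    qed
    ultimately have "k (1, sphere_pt) = k (0, sphere_pt)"
      by (intro lift_const[of ?I "\<lambda>t. k (t, sphere_pt)" b0 0 1] connected_space_unit_interval) auto
    then show ?thesis using k(3) sphere_pt_in_disc[OF m1] by simp
  qed
  have bd: "k (1, x) = e0" if x: "x \<in> topspace (disc m)" "enorm m x = 1" for x
  proof -
    let ?S = "nsphere (m - 1)"
    have S: "y \<in> topspace ?S \<longleftrightarrow> enorm m y = 1 \<and> (\<forall>i\<ge>m. y i = 0)" for y
      using m by (auto simp: topspace_nsphere_iff)
    have "continuous_map ?S (disc m) (\<lambda>y. y)"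
      unfolding continuous_map_coordinatewise(2)
      by (intro conjI allI Pi_I continuous_map_nsphere_projection) (unfold S topspace_disc_iff, simp)
    from continuous_map_compose[OF this k1] have "continuous_map ?S E (\<lambda>y. k (1, y))" by (simp add: o_def)
    moreover have "p (k (1, y)) = b0" if "y \<in> topspace ?S" for y
      using pk1[of y] that ca(2) unfolding S by (simp add: topspace_disc_iff ball_collapse_boundary)
    moreover have "x \<in> topspace ?S" using x unfolding S by (simp add: topspace_disc_iff)
    moreover have "connected_space ?S" using m by (intro connected_space_nsphere) simp
    ultimately have "k (1, x) = k (1, sphere_pt)"
      using sphere_pt_in by (intro lift_const[of ?S "\<lambda>y. k (1, y)" b0]) auto
    then show ?thesis using base by simp
  qed
  obtain \<alpha>' where \<alpha>': "continuous_map (nsphere m) E \<alpha>'" "\<And>x. x \<in> topspace (disc m) \<Longrightarrow> \<alpha>' (ball_collapse m x) = k (1, x)"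
  proof (rule compact_quotient_factor[OF continuous_map_ball_collapse compact_space_disc Hausdorff_space_nsphere ball_collapse_image[OF m1] k1])
    fix x y assume xy: "x \<in> topspace (disc m)" "y \<in> topspace (disc m)" "ball_collapse m x = ball_collapse m y"
    then consider "x = y" | "enorm m x = 1" "enorm m y = 1" using ball_collapse_eq_iff by blast
    then show "k (1, x) = k (1, y)" using bd xy by cases auto
  qed (rule that)
  show ?thesis
  proof
    show "sphere_map m E e0 \<alpha>'"
      using \<alpha>' base bp sphere_pt_in_disc[OF m1] unfolding sphere_map_def by metis
    fix x assume "x \<in> topspace (nsphere m)"
    then obtain y where "y \<in> topspace (disc m)" "ball_collapse m y = x" using ball_collapse_surj[OF m1] by blast
    then show "p (\<alpha>' x) = \<alpha> x" using \<alpha>'(2) pk1 by auto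
  qed
qed

text \<open>
  The Whitehead product of \<open>\<alpha>\<close> and \<open>\<beta>\<close> lifts that of \<open>p \<circ> \<alpha>\<close> and \<open>p \<circ> \<beta>\<close>, and the lift of a
  null-homotopy ends in a single fibre, hence at a constant map.
\<close>

lemma axes_extend_lift:
  assumes km: "k \<ge> 1" "m \<ge> 1" and a: "sphere_map k E e0 \<alpha>" and b: "sphere_map m E e0 \<beta>"
    and ext: "axes_extend k m B (p \<circ> \<alpha>) (p \<circ> \<beta>)"
  shows "axes_extend k m E \<alpha> \<beta>"
proof -
  let ?I = "top_of_set {0..1::real}" and ?S = "nsphere (k + m - 1)"
  have pt: "\<alpha> sphere_pt = e0" "\<beta> sphere_pt = e0" using a b by (auto simp: sphere_map_def)
  have "based_homotopic (k + m - 1) B (p e0) (whitehead_map k m (p \<circ> \<alpha>) (p \<circ> \<beta>)) (\<lambda>_. p e0)"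
    using km ext by (rule nullhomotopic_of_axes_extend) (simp add: pt)
  then obtain h where h: "continuous_map (prod_topology ?I ?S) B h"
    "\<And>x. h (0, x) = whitehead_map k m (p \<circ> \<alpha>) (p \<circ> \<beta>) x" "\<And>x. h (1, x) = p e0"
    "\<And>t. t \<in> {0..1} \<Longrightarrow> h (t, sphere_pt) = p e0"
    unfolding homotopic_with_def by blast
  have w: "sphere_map (k + m - 1) E e0 (whitehead_map k m \<alpha> \<beta>)"
    using whitehead_map_homotopic[OF km based_homotopic_refl[OF a] based_homotopic_refl[OF b]]
    by (rule based_homotopic_imp_sphere_map)
  then have w': "continuous_map ?S E (whitehead_map k m \<alpha> \<beta>)" "whitehead_map k m \<alpha> \<beta> sphere_pt = e0"
    by (auto simp: sphere_map_def)
  obtain j where j: "continuous_map (prod_topology ?I ?S) E j"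
    "\<And>t x. \<lbrakk>t \<in> {0..1}; x \<in> topspace ?S\<rbrakk> \<Longrightarrow> p (j (t, x)) = h (t, x)"
    "\<And>x. x \<in> topspace ?S \<Longrightarrow> j (0, x) = whitehead_map k m \<alpha> \<beta> x"
    by (rule homotopy_lifting[OF compact_space_nsphere h(1) w'(1)]) (auto simp: h(2) whitehead_map_compose)
  have jt: "j (t, sphere_pt) = e0" if t: "t \<in> {0..1}" for t
  proof -
    have "continuous_map ?I E (\<lambda>t. j (t, sphere_pt))"
      using continuous_map_compose[OF _ j(1), of ?I "\<lambda>t. (t, sphere_pt)"] sphere_pt_in
      by (simp add: o_def continuous_map_paired)
    then have "j (t, sphere_pt) = j (0, sphere_pt)"
      using j(2) h(4) sphere_pt_in t
      by (intro lift_const[of ?I "\<lambda>t. j (t, sphere_pt)" "p e0" 0 t] connected_space_unit_interval) auto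
    then show ?thesis using j(3)[OF sphere_pt_in] w'(2) by simp
  qed
  have j1: "j (1, x) = e0" if x: "x \<in> topspace ?S" for x
  proof -
    have "continuous_map ?S E (\<lambda>x. j (1, x))"
      using continuous_map_compose[OF _ j(1), of ?S "\<lambda>x. (1, x)"] by (simp add: o_def continuous_map_paired)
    moreover have "connected_space ?S" using km by (intro connected_space_nsphere) simp
    ultimately have "j (1, x) = j (1, sphere_pt)"
      using j(2) h(3) sphere_pt_in x by (intro lift_const[of ?S "\<lambda>x. j (1, x)" "p e0"]) auto
    then show ?thesis using jt[of 1] by simp
  qed
  have "based_homotopic (k + m - 1) E e0 (whitehead_map k m \<alpha> \<beta>) (\<lambda>_. e0)"
  proof (subst homotopic_with)
    show "\<exists>h. continuous_map (prod_topology ?I ?S) E h \<and> (\<forall>x\<in>topspace ?S. h (0, x) = whitehead_map k m \<alpha> \<beta> x) \<and>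
      (\<forall>x\<in>topspace ?S. h (1, x) = e0) \<and> (\<forall>t\<in>{0..1}. h (t, sphere_pt) = e0)"
      using j(1,3) j1 jt by blast
  qed (use sphere_pt_in in auto)
  with km pt show ?thesis by (rule axes_extend_of_nullhomotopic)
qed

end

section \<open>Whitehead centers of a covering\<close>

lemma continuous_map_slice:
  assumes k: "continuous_map (prod_topology X Y) Z k"
  shows "x \<in> topspace X \<Longrightarrow> continuous_map Y Z (\<lambda>y. k (x, y))"
    and "y \<in> topspace Y \<Longrightarrow> continuous_map X Z (\<lambda>x. k (x, y))"
proof -
  assume "x \<in> topspace X"
  then have "continuous_map Y (prod_topology X Y) (\<lambda>y. (x, y))"
    by (intro continuous_map_pairedI) simp_all
  from continuous_map_compose[OF this k] show "continuous_map Y Z (\<lambda>y. k (x, y))" unfolding o_def .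
next
  assume "y \<in> topspace Y"
  then have "continuous_map X (prod_topology X Y) (\<lambda>x. (x, y))"
    by (intro continuous_map_pairedI) simp_all
  from continuous_map_compose[OF this k] show "continuous_map X Z (\<lambda>x. k (x, y))" unfolding o_def .
qed

context nearness_covering
begin

lemma sphere_map_lift_compose:
  assumes "e0 \<in> topspace E" "p e0 = b0" "sphere_map k E e0 \<beta>"
  shows "sphere_map k B b0 (p \<circ> \<beta>)"
  using p_continuous assms(2,3) by (rule sphere_map_compose)

text \<open>
  From degree two on all classes of \<open>B\<close> come from \<open>E\<close>, and a product of classes of \<open>E\<close> is trivial if
  and only if its image in \<open>B\<close> is.
\<close>

theorem whitehead_along_covering:
  assumes m: "m \<ge> 2" and e: "e0 \<in> topspace E" "p e0 = b0"
  shows "whitehead_along m E e0 B b0 p = homotopy_induced m B b0 p ` whitehead_center m E e0"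
proof (rule equalityI; rule subsetI)
  have m1: "m \<ge> 1" using m by simp
  note along = sphere_class_in_whitehead_along_iff[where f = p and ?a0.0 = e0, OF m1 p_continuous e(2)]
  have center: "sphere_class m E e0 \<alpha> \<in> whitehead_center m E e0 \<longleftrightarrow>
      (\<forall>k\<ge>1. \<forall>\<beta>. sphere_map k E e0 \<beta> \<longrightarrow> axes_extend m k E \<alpha> (id \<circ> \<beta>))" if "sphere_map m E e0 \<alpha>" for \<alpha>
    unfolding whitehead_center_def
    using m1 continuous_map_id id_apply that by (rule sphere_class_in_whitehead_along_iff)
  {
    fix c assume c: "c \<in> whitehead_along m E e0 B b0 p"
    then have "c \<in> carrier (homotopy_group m B b0)" by (simp add: whitehead_along_def)
    then obtain \<alpha> where \<alpha>: "sphere_map m B b0 \<alpha>" "c = sphere_class m B b0 \<alpha>" by (rule homotopy_groupE)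
    obtain \<alpha>' where \<alpha>': "sphere_map m E e0 \<alpha>'" "\<And>x. x \<in> topspace (nsphere m) \<Longrightarrow> p (\<alpha>' x) = \<alpha> x"
      by (rule lift_sphere_map[OF m \<alpha>(1) e]) (rule that)
    have c': "c = sphere_class m B b0 (p \<circ> \<alpha>')"
      unfolding \<alpha>(2) by (rule sphere_class_cong[OF \<alpha>(1)]) (simp add: \<alpha>'(2))
    note ext = iffD1[OF along[OF sphere_map_lift_compose[OF e \<alpha>'(1)]] c[unfolded c'], rule_format]
    have "axes_extend m k E \<alpha>' (id \<circ> \<beta>)" if k: "k \<ge> 1" "sphere_map k E e0 \<beta>" for k \<beta>
      unfolding id_o by (rule axes_extend_lift[OF m1 k(1) \<alpha>'(1) k(2) ext[OF k]])
    then have "sphere_class m E e0 \<alpha>' \<in> whitehead_center m E e0"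
      by (intro iffD2[OF center[OF \<alpha>'(1)]] allI impI)
    moreover have "c = homotopy_induced m B b0 p (sphere_class m E e0 \<alpha>')"
      unfolding c' by (rule homotopy_induced_class[OF p_continuous e(2) \<alpha>'(1), symmetric])
    ultimately show "c \<in> homotopy_induced m B b0 p ` whitehead_center m E e0" by (rule rev_image_eqI)
  }
  fix c assume "c \<in> homotopy_induced m B b0 p ` whitehead_center m E e0"
  then obtain d where d: "d \<in> whitehead_center m E e0" "c = homotopy_induced m B b0 p d" by (rule imageE)
  then have "d \<in> carrier (homotopy_group m E e0)" by (simp add: whitehead_center_def whitehead_along_def)
  then obtain \<alpha> where \<alpha>: "sphere_map m E e0 \<alpha>" "d = sphere_class m E e0 \<alpha>" by (rule homotopy_groupE)
  have c: "c = sphere_class m B b0 (p \<circ> \<alpha>)"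
    unfolding d(2) \<alpha>(2) by (rule homotopy_induced_class[OF p_continuous e(2) \<alpha>(1)])
  have "axes_extend m k B (p \<circ> \<alpha>) (p \<circ> \<beta>)" if k: "k \<ge> 1" "sphere_map k E e0 \<beta>" for k \<beta>
  proof -
    have "axes_extend m k E \<alpha> (id \<circ> \<beta>)"
      by (rule iffD1[OF center[OF \<alpha>(1)] d(1)[unfolded \<alpha>(2)], rule_format, OF k])
    then obtain F where F: "continuous_map (prod_topology (nsphere m) (nsphere k)) E F"
      "\<forall>x\<in>topspace (nsphere m). F (x, sphere_pt) = \<alpha> x" "\<forall>y\<in>topspace (nsphere k). F (sphere_pt, y) = \<beta> y"
      by (auto simp: axes_extend_def)
    show ?thesis
      unfolding axes_extend_def
      by (rule exI[of _ "p \<circ> F"]) (simp add: continuous_map_compose[OF F(1) p_continuous] F(2,3))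
  qed
  then show "c \<in> whitehead_along m E e0 B b0 p"
    unfolding c by (intro iffD2[OF along[OF sphere_map_lift_compose[OF e \<alpha>(1)]]] allI impI)
qed

text \<open>
  The Whitehead center of \<open>B\<close> tests more classes than the center along \<open>p\<close>, but only in degree one,
  where the hypothesis on \<open>\<pi>\<^sub>1\<close> and the symmetry of the extension problem apply.
\<close>

theorem whitehead_along_covering_eq_center:
  assumes m: "m \<ge> 2" and e: "e0 \<in> topspace E" "p e0 = b0"
    and pi1: "carrier (homotopy_group 1 B b0) \<subseteq> whitehead_center 1 B b0"
  shows "whitehead_along m E e0 B b0 p = whitehead_center m B b0"
proof
  have m1: "m \<ge> 1" using m by simp
  have center: "sphere_class j B b0 \<alpha> \<in> whitehead_center j B b0 \<longleftrightarrow>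
      (\<forall>k\<ge>1. \<forall>\<beta>. sphere_map k B b0 \<beta> \<longrightarrow> axes_extend j k B \<alpha> (id \<circ> \<beta>))"
    if "j \<ge> 1" "sphere_map j B b0 \<alpha>" for j \<alpha>
    unfolding whitehead_center_def
    using that(1) continuous_map_id id_apply that(2) by (rule sphere_class_in_whitehead_along_iff)
  note along = sphere_class_in_whitehead_along_iff[where f = p and ?a0.0 = e0, OF m1 p_continuous e(2)]
  show "whitehead_center m B b0 \<subseteq> whitehead_along m E e0 B b0 p"
    using m1 p_continuous e(2) by (rule whitehead_center_subset_whitehead_along)
  show "whitehead_along m E e0 B b0 p \<subseteq> whitehead_center m B b0"
  proof
    fix c assume c: "c \<in> whitehead_along m E e0 B b0 p"
    then have "c \<in> carrier (homotopy_group m B b0)" by (simp add: whitehead_along_def)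
    then obtain \<alpha> where \<alpha>: "sphere_map m B b0 \<alpha>" "c = sphere_class m B b0 \<alpha>" by (rule homotopy_groupE)
    have "axes_extend m k B \<alpha> (id \<circ> \<beta>)" if k: "k \<ge> 1" and \<beta>: "sphere_map k B b0 \<beta>" for k \<beta>
    proof (cases "k = 1")
      case True
      have "sphere_class 1 B b0 \<beta> \<in> whitehead_center 1 B b0"
        using \<beta> unfolding True by (intro subsetD[OF pi1] sphere_class_in_homotopy_group)
      then have "axes_extend 1 m B \<beta> (id \<circ> \<alpha>)"
        using \<beta> unfolding True by (intro iffD1[OF center, rule_format, OF order_refl _ _ m1 \<alpha>(1)])
      then show ?thesis unfolding id_o True by (rule axes_extend_sym)
    next
      case False
      then have "k \<ge> 2" using k by simp
      then obtain \<beta>' where \<beta>': "sphere_map k E e0 \<beta>'" "\<And>x. x \<in> topspace (nsphere k) \<Longrightarrow> p (\<beta>' x) = \<beta> x"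
        by (rule lift_sphere_map[OF _ \<beta> e]) (rule that)
      have "axes_extend m k B \<alpha> (p \<circ> \<beta>')"
        by (rule iffD1[OF along[OF \<alpha>(1)] c[unfolded \<alpha>(2)], rule_format, OF k \<beta>'(1)])
      then show ?thesis by (rule axes_extend_cong) (simp_all add: \<beta>'(2))
    qed
    then show "c \<in> whitehead_center m B b0"
      unfolding \<alpha>(2) by (intro iffD2[OF center[OF m1 \<alpha>(1)]] allI impI)
  qed
qed

definition path_lift :: "((nat \<Rightarrow> real) \<Rightarrow> 'b) \<Rightarrow> (real \<Rightarrow> 'a) \<Rightarrow> bool" where
  "path_lift f u \<longleftrightarrow> continuous_map (top_of_set {0..1}) E u \<and> (\<forall>t\<in>{0..1}. p (u t) = f (circle_path t))"

lemma circle_loop_continuous: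
  assumes "continuous_map (nsphere 1) X f"
  shows "continuous_map (top_of_set {0..1}) X (\<lambda>t. f (circle_path t))"
  using continuous_map_from_subtopology[OF continuous_map_compose[OF continuous_map_circle_path assms], of "{0..1}"]
  unfolding o_def .

lemma path_lift_exists:
  assumes f: "sphere_map 1 B b0 f" and e: "e0 \<in> topspace E" "p e0 = b0"
  obtains u where "path_lift f u" "u 0 = e0"
proof -
  let ?I = "top_of_set {0..1::real}"
  have cf: "continuous_map (nsphere 1) B f" "f sphere_pt = b0" using f by (auto simp: sphere_map_def)
  have "continuous_map (prod_topology ?I ?I) B (\<lambda>q. f (circle_path (fst q)))"
    using continuous_map_compose[OF continuous_map_fst circle_loop_continuous[OF cf(1)], of ?I] unfolding o_def .
  then obtain k where k: "continuous_map (prod_topology ?I ?I) E k"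
    "\<And>t x. \<lbrakk>t \<in> {0..1}; x \<in> topspace ?I\<rbrakk> \<Longrightarrow> p (k (t, x)) = f (circle_path (fst (t, x)))"
    "\<And>x. x \<in> topspace ?I \<Longrightarrow> k (0, x) = e0"
    by (rule homotopy_lifting[of ?I _ "\<lambda>_. e0", rotated]) (use e cf in \<open>auto simp: compact_space_subtopology\<close>)
  have "continuous_map ?I E (\<lambda>t. k (t, 0))"
    by (rule continuous_map_slice(2)[OF k(1)]) simp
  then show ?thesis
    using k(2,3) by (intro that[of "\<lambda>t. k (t, 0)"]) (auto simp: path_lift_def)
qed

lemma path_lift_unique:
  assumes "path_lift f u" "path_lift f v" "u 0 = v 0" "t \<in> {0..1}"
  shows "u t = v t"
proof (rule lift_unique[where X = "top_of_set {0..1}" and f = u and g = v and a = 0 and x = t])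
  show "p (u s) = p (v s)" if "s \<in> topspace (top_of_set {0..1})" for s
    using assms(1,2) that by (simp add: path_lift_def)
qed (use assms connected_space_unit_interval in \<open>simp_all add: path_lift_def\<close>)

text \<open>
  In the lift of a based homotopy of loops the end points move within one fibre.
\<close>

lemma path_lift_homotopic_ends:
  assumes fg: "based_homotopic 1 B b0 f g" and u: "path_lift f u" "u 0 = e0" and v: "path_lift g v" "v 0 = e0"
  shows "u 1 = v 1"
proof -
  let ?I = "top_of_set {0..1::real}"
  obtain K where K: "continuous_map (prod_topology ?I (nsphere 1)) B K"
    "\<And>x. K (0, x) = f x" "\<And>x. K (1, x) = g x" "\<And>t. t \<in> {0..1} \<Longrightarrow> K (t, sphere_pt) = b0"
    using fg unfolding homotopic_with_def by blast
  have "continuous_map (prod_topology ?I ?I) (prod_topology ?I (nsphere 1)) (\<lambda>q. (fst q, circle_path (snd q)))"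
    using continuous_map_compose[OF continuous_map_snd circle_loop_continuous[OF continuous_map_id], of ?I]
    by (intro continuous_map_pairedI continuous_map_fst) (simp add: o_def)
  from continuous_map_compose[OF this K(1)]
  have h: "continuous_map (prod_topology ?I ?I) B (\<lambda>q. K (fst q, circle_path (snd q)))" unfolding o_def .
  have cu: "continuous_map ?I E u" using u by (simp add: path_lift_def)
  obtain k where k: "continuous_map (prod_topology ?I ?I) E k"
    "\<And>t x. \<lbrakk>t \<in> {0..1}; x \<in> topspace ?I\<rbrakk> \<Longrightarrow> p (k (t, x)) = K (fst (t, x), circle_path (snd (t, x)))"
    "\<And>x. x \<in> topspace ?I \<Longrightarrow> k (0, x) = u x"
    by (rule homotopy_lifting[OF _ h cu]) (use u in \<open>auto simp: path_lift_def K(2) compact_space_subtopology\<close>)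
  have sl: "continuous_map ?I E (\<lambda>s. k (s, x))" if "x \<in> {0..1}" for x
    by (rule continuous_map_slice(2)[OF k(1)]) (use that in simp)
  have side: "k (s, x) = u x" if "x = 0 \<or> x = 1" "s \<in> {0..1}" for s x
  proof -
    have x: "x \<in> {0..1}" "circle_path x = sphere_pt" using that by auto
    then have "k (s, x) = k (0, x)"
    proof (intro lift_const[of ?I "\<lambda>s. k (s, x)" b0 0 s] connected_space_unit_interval sl)
      show "p (k (r, x)) = b0" if "r \<in> topspace ?I" for r
        using k(2)[of r x] K(4)[of r] x that by simp
    qed (use that(2) x in auto)
    then show ?thesis using k(3) x by simp
  qed
  have "path_lift g (\<lambda>t. k (1, t))"
    using continuous_map_slice(1)[OF k(1), of 1] k(2) by (simp add: path_lift_def K(3))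
  then have "k (1, 1) = v 1"
    using v side[of 0 1] u(2) path_lift_unique[of g "\<lambda>t. k (1, t)" v 1] by simp
  then show ?thesis using side[of 1 1] by simp
qed

text \<open>
  The image of a homotopy with fixed ends between the lifts is constant on the two vertical sides of
  the square and so descends to a homotopy of loops.
\<close>

lemma based_homotopic_of_path_lifts:
  assumes f: "sphere_map 1 B b0 f" and g: "sphere_map 1 B b0 g"
    and u: "path_lift f u" and v: "path_lift g v" and h: "path_homotopic E (u 0) (u 1) u v"
  shows "based_homotopic 1 B b0 f g"
proof -
  let ?I = "top_of_set {0..1::real}"
  obtain H where H: "continuous_map (prod_topology ?I ?I) E H"
    "\<And>t. H (0, t) = u t" "\<And>t. H (1, t) = v t" "\<And>s. s \<in> {0..1} \<Longrightarrow> H (s, 0) = u 0 \<and> H (s, 1) = u 1"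
    using h unfolding homotopic_with_def by blast
  have fg: "f sphere_pt = b0" "g sphere_pt = b0" using f g by (auto simp: sphere_map_def)
  have pu: "p (u 0) = b0" "p (u 1) = b0" using u fg by (auto simp: path_lift_def)
  have q: "quotient_map (prod_topology ?I ?I) (prod_topology ?I (nsphere 1)) (\<lambda>(x, t). (x, circle_path t))"
    by (rule quotient_map_circle_path) (auto simp: compact_space_subtopology Hausdorff_space_subtopology)
  have c: "continuous_map (prod_topology ?I ?I) B (p \<circ> H)" by (rule continuous_map_compose[OF H(1) p_continuous])
  have fib: "(p \<circ> H) x = (p \<circ> H) y"
    if "x \<in> topspace (prod_topology ?I ?I)" "y \<in> topspace (prod_topology ?I ?I)"
      "(case x of (x, t) \<Rightarrow> (x, circle_path t)) = (case y of (x, t) \<Rightarrow> (x, circle_path t))" for x y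
  proof -
    obtain s t where x: "x = (s, t)" by (cases x)
    obtain s' t' where y: "y = (s', t')" by (cases y)
    have s: "s = s'" "s \<in> {0..1}" and t: "t = t' \<or> {t, t'} = {0, 1}"
      using that circle_path_eqD[of t t'] by (auto simp: x y)
    then show ?thesis using H(4)[OF s(2)] pu by (auto simp: x y doubleton_eq_iff)
  qed
  obtain K where K: "continuous_map (prod_topology ?I (nsphere 1)) B K"
    "\<And>x. x \<in> topspace (prod_topology ?I ?I) \<Longrightarrow> K (case x of (x, t) \<Rightarrow> (x, circle_path t)) = (p \<circ> H) x"
    by (rule quotient_map_lift_exists[OF q c fib]) auto
  have Kv: "K (s, circle_path t) = p (H (s, t))" if "s \<in> {0..1}" "t \<in> {0..1}" for s t
    using K(2)[of "(s, t)"] that by simp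
  show ?thesis
  proof (subst homotopic_with)
    show "\<exists>h. continuous_map (prod_topology ?I (nsphere 1)) B h \<and> (\<forall>x\<in>topspace (nsphere 1). h (0, x) = f x) \<and>
      (\<forall>x\<in>topspace (nsphere 1). h (1, x) = g x) \<and> (\<forall>t\<in>{0..1}. h (t, sphere_pt) = b0)"
    proof (intro exI[of _ K] conjI ballI K(1))
      fix x assume "x \<in> topspace (nsphere 1)"
      then obtain t where t: "t \<in> {0..1}" "circle_path t = x" by (rule circle_path_surj)
      show "K (0, x) = f x" using Kv[of 0 t] t u H(2) by (auto simp: path_lift_def)
      show "K (1, x) = g x" using Kv[of 1 t] t v H(3) by (auto simp: path_lift_def)
    next
      fix s :: real assume "s \<in> {0..1}"
      then show "K (s, sphere_pt) = b0" using Kv[of s 0] H(4) pu(1) by simp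
    qed
  qed (use sphere_pt_in in auto)
qed

end

section \<open>The circle action on an odd sphere\<close>

definition weight :: "(nat \<Rightarrow> int) \<Rightarrow> nat \<Rightarrow> int" where
  "weight q j = (if j = 0 then 1 else q j)"

text \<open>
  The complex coordinates of the sphere in \<open>\<complex>\<^sup>n\<^sup>+\<^sup>1\<close>; \<open>of_cplx\<close> is the inverse of \<open>cplx_coord\<close>.
\<close>

definition cplx_coord :: "(nat \<Rightarrow> real) \<Rightarrow> nat \<Rightarrow> complex" where
  "cplx_coord x j = Complex (x (2 * j)) (x (2 * j + 1))"

definition of_cplx :: "(nat \<Rightarrow> complex) \<Rightarrow> nat \<Rightarrow> real" where
  "of_cplx z = (\<lambda>i. if even i then Re (z (i div 2)) else Im (z (i div 2)))"

lemma cplx_coord_of_cplx [simp]: "cplx_coord (of_cplx z) j = z j"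
  by (simp add: cplx_coord_def of_cplx_def)

lemma of_cplx_cplx_coord [simp]: "of_cplx (cplx_coord x) = x"
  by (auto simp: cplx_coord_def of_cplx_def fun_eq_iff elim!: evenE oddE)

lemma cplx_coord_inject: "cplx_coord x = cplx_coord y \<longleftrightarrow> x = y"
  by (metis of_cplx_cplx_coord)

lemma enorm_cplx_coord: "(enorm (2 * n) x)\<^sup>2 = (\<Sum>j<n. (cmod (cplx_coord x j))\<^sup>2)"
  unfolding sum_sq_enorm [symmetric]
  by (induction n) (simp_all add: cplx_coord_def cmod_def)

lemma in_nsphere_cplx_iff:
  "x \<in> topspace (nsphere (Suc (2 * n))) \<longleftrightarrow>
     (\<Sum>j\<le>n. (cmod (cplx_coord x j))\<^sup>2) = 1 \<and> (\<forall>j>n. cplx_coord x j = 0)"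
proof -
  have "(enorm (Suc (Suc (2 * n))) x)\<^sup>2 = (\<Sum>j\<le>n. (cmod (cplx_coord x j))\<^sup>2)"
  proof -
    have "2 * Suc n = Suc (Suc (2 * n))" by simp
    then show ?thesis using enorm_cplx_coord[of "Suc n" x] by (simp only: lessThan_Suc_atMost)
  qed
  moreover have "(enorm (Suc (Suc (2 * n))) x)\<^sup>2 = 1\<^sup>2 \<longleftrightarrow> enorm (Suc (Suc (2 * n))) x = 1"
    by (rule power2_eq_iff_nonneg) simp_all
  ultimately have "enorm (Suc (Suc (2 * n))) x = 1 \<longleftrightarrow> (\<Sum>j\<le>n. (cmod (cplx_coord x j))\<^sup>2) = 1"
    by simp
  moreover have "(\<forall>i>Suc (2 * n). x i = 0) \<longleftrightarrow> (\<forall>j>n. cplx_coord x j = 0)"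
  proof
    assume *: "\<forall>j>n. cplx_coord x j = 0"
    show "\<forall>i>Suc (2 * n). x i = 0"
    proof (intro allI impI)
      fix i assume "i > Suc (2 * n)"
      then have "i div 2 > n" by linarith
      then have "of_cplx (cplx_coord x) i = 0" using * by (simp add: of_cplx_def)
      then show "x i = 0" by simp
    qed
  qed (auto simp: cplx_coord_def complex_eq_iff)
  ultimately show ?thesis unfolding topspace_nsphere_iff by simp
qed

text \<open>
  The flow of the circle action that contains the action of the cyclic group: time \<open>2\<pi> / l\<close> is the
  generator and time \<open>2\<pi>\<close> is the identity.
\<close>

definition rot :: "(nat \<Rightarrow> int) \<Rightarrow> real \<Rightarrow> (nat \<Rightarrow> real) \<Rightarrow> nat \<Rightarrow> real" where
  "rot q \<tau> x = of_cplx (\<lambda>j. cis (\<tau> * weight q j) * cplx_coord x j)"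

lemma cplx_coord_rot: "cplx_coord (rot q \<tau> x) j = cis (\<tau> * weight q j) * cplx_coord x j"
  by (simp add: rot_def)

lemma lens_generator_eq_rot: "lens_generator l q = rot q (2 * pi / l)"
proof
  fix x
  have "exp (2 * of_real pi * \<i> * of_int w / of_nat l) = cis (2 * pi / l * of_int w)" for w
    by (simp add: cis_conv_exp mult_ac)
  then show "lens_generator l q x = rot q (2 * pi / l) x"
    by (simp add: lens_generator_def rot_def of_cplx_def weight_def cplx_coord_def Let_def fun_eq_iff)
qed

lemma rot_rot: "rot q s (rot q t x) = rot q (s + t) x"
  by (subst cplx_coord_inject [symmetric]) (simp add: fun_eq_iff cplx_coord_rot distrib_right flip: cis_mult)

lemma rot_0 [simp]: "rot q 0 x = x"
  by (subst cplx_coord_inject [symmetric]) (simp add: fun_eq_iff cplx_coord_rot)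

lemma rot_2pi: "rot q (2 * pi * of_int k) x = x"
proof -
  have "cis (2 * pi * of_int k * of_int w) = 1" for w
    using cis_multiple_2pi[of "of_int (k * w)"] by (simp add: mult_ac)
  then show ?thesis by (subst cplx_coord_inject [symmetric]) (simp add: fun_eq_iff cplx_coord_rot)
qed

lemma lens_generator_funpow: "(lens_generator l q ^^ k) x = rot q (2 * pi * real k / l) x"
  by (induction k) (simp_all add: lens_generator_eq_rot rot_rot add_divide_distrib algebra_simps)

lemma rot_in_nsphere:
  "x \<in> topspace (nsphere (Suc (2 * n))) \<Longrightarrow> rot q \<tau> x \<in> topspace (nsphere (Suc (2 * n)))"
  unfolding in_nsphere_cplx_iff by (simp add: cplx_coord_rot norm_mult)

lemma rot_mod:
  assumes "l > 0"
  shows "rot q (2 * pi * of_int (k mod int l) / l) x = rot q (2 * pi * of_int k / l) x"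
proof -
  have "real_of_int (k mod int l + int l * (k div int l)) = real_of_int k" by (simp only: mod_mult_div_eq)
  then have "real_of_int (k mod int l) + l * real_of_int (k div int l) = real_of_int k"
    by (simp only: of_int_add of_int_mult of_int_of_nat_eq)
  note k = this [symmetric]
  have "2 * pi * of_int k / l = 2 * pi * of_int (k mod int l) / l + 2 * pi * of_int (k div int l)"
    by (subst k) (use assms in \<open>simp add: field_simps\<close>)
  then have "rot q (2 * pi * of_int k / l) x = rot q (2 * pi * of_int (k mod int l) / l) (rot q (2 * pi * of_int (k div int l)) x)"
    by (simp only: rot_rot)
  then show ?thesis by (simp only: rot_2pi)
qed

text \<open>
  Powers with arbitrary integer exponents are easier to shift than those with exponents below \<open>l\<close>.
\<close>

lemma lens_proj_eq_range:
  assumes "l > 0"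
  shows "lens_proj l q x = range (\<lambda>k::int. rot q (2 * pi * of_int k / l) x)"
proof
  show "lens_proj l q x \<subseteq> range (\<lambda>k::int. rot q (2 * pi * of_int k / l) x)"
  proof
    fix y assume "y \<in> lens_proj l q x"
    then obtain k :: nat where "y = rot q (2 * pi * of_int (int k) / l) x"
      by (auto simp: lens_proj_def lens_generator_funpow)
    then show "y \<in> range (\<lambda>k::int. rot q (2 * pi * of_int k / l) x)" by blast
  qed
  show "range (\<lambda>k::int. rot q (2 * pi * of_int k / l) x) \<subseteq> lens_proj l q x"
  proof
    fix y assume "y \<in> range (\<lambda>k::int. rot q (2 * pi * of_int k / l) x)"
    then obtain k :: int where k: "y = rot q (2 * pi * of_int k / l) x" by blast
    define j where "j = nat (k mod int l)"
    have j: "int j = k mod int l" "j < l" using assms by (auto simp: j_def nat_less_iff)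
    have "y = (lens_generator l q ^^ j) x"
      using rot_mod[OF assms, of q k x] k by (simp add: lens_generator_funpow j(1) [symmetric])
    then show "y \<in> lens_proj l q x" using j(2) by (auto simp: lens_proj_def)
  qed
qed

lemma lens_proj_rot:
  assumes "l > 0"
  shows "lens_proj l q (rot q (2 * pi * of_int k / l) x) = lens_proj l q x"
proof -
  have "range (\<lambda>j::int. rot q (2 * pi * of_int j / l) (rot q (2 * pi * of_int k / l) x)) =
    range (\<lambda>j::int. rot q (2 * pi * of_int (j + k) / l) x)"
    by (simp add: rot_rot algebra_simps add_divide_distrib)
  also have "\<dots> = (\<lambda>j::int. rot q (2 * pi * of_int j / l) x) ` range (\<lambda>j. j + k)"
    by (simp only: image_image)
  also have "range (\<lambda>j. j + k) = UNIV" by (simp add: surj_plus_right)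
  finally show ?thesis by (simp add: lens_proj_eq_range[OF assms])
qed

lemma lens_proj_eq_iff:
  assumes "l > 0"
  shows "lens_proj l q x = lens_proj l q y \<longleftrightarrow> (\<exists>k::int. 0 \<le> k \<and> k < l \<and> y = rot q (2 * pi * of_int k / l) x)"
proof
  assume "lens_proj l q x = lens_proj l q y"
  moreover have "rot q (2 * pi * of_int 0 / l) y \<in> lens_proj l q y"
    unfolding lens_proj_eq_range[OF assms] by (rule rangeI)
  ultimately obtain k :: int where "y = rot q (2 * pi * of_int k / l) x"
    unfolding lens_proj_eq_range[OF assms] by auto
  then have "y = rot q (2 * pi * of_int (k mod int l) / l) x" using rot_mod[OF assms] by simp
  then show "\<exists>k::int. 0 \<le> k \<and> k < l \<and> y = rot q (2 * pi * of_int k / l) x"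
    using assms by (intro exI[of _ "k mod int l"]) simp
qed (use lens_proj_rot[OF assms] in auto)

text \<open>
  The flow commutes with the cyclic group and so descends to the lens space.
\<close>

lemma lens_proj_rot_eq:
  assumes "l > 0" "lens_proj l q x = lens_proj l q y"
  shows "lens_proj l q (rot q \<tau> x) = lens_proj l q (rot q \<tau> y)"
proof -
  obtain k :: int where "y = rot q (2 * pi * of_int k / l) x"
    using assms lens_proj_eq_iff by blast
  then have "rot q \<tau> y = rot q (2 * pi * of_int k / l) (rot q \<tau> x)" by (simp add: rot_rot add.commute)
  then show ?thesis using lens_proj_rot[OF assms(1)] by simp
qed

lemma continuous_map_rot_coord:
  assumes \<tau>: "continuous_map X euclideanreal \<tau>" and x: "\<And>i. continuous_map X euclideanreal (\<lambda>p. x p i)"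
  shows "continuous_map X euclideanreal (\<lambda>p. rot q (\<tau> p) (x p) i)"
proof -
  have c: "continuous_map X euclideanreal (\<lambda>p. cos (\<tau> p * w))" "continuous_map X euclideanreal (\<lambda>p. sin (\<tau> p * w))" for w
  proof -
    have "continuous_map X euclideanreal (\<lambda>p. \<tau> p * w)" by (intro continuous_map_real_mult \<tau>) simp
    moreover have "continuous_map euclideanreal euclideanreal cos" "continuous_map euclideanreal euclideanreal sin"
      by (auto intro: continuous_intros)
    ultimately show "continuous_map X euclideanreal (\<lambda>p. cos (\<tau> p * w))" "continuous_map X euclideanreal (\<lambda>p. sin (\<tau> p * w))"
      using continuous_map_compose[of X euclideanreal "\<lambda>p. \<tau> p * w"] unfolding o_def by blast+
  qed
  show ?thesis
  proof (cases "even i")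
    case True
    have "rot q (\<tau> p) (x p) i = cos (\<tau> p * weight q (i div 2)) * x p (2 * (i div 2)) - sin (\<tau> p * weight q (i div 2)) * x p (2 * (i div 2) + 1)" for p
      using True by (simp add: rot_def of_cplx_def cplx_coord_def)
    then show ?thesis by (simp only:) (intro continuous_map_diff continuous_map_real_mult c x)
  next
    case False
    have "rot q (\<tau> p) (x p) i = cos (\<tau> p * weight q (i div 2)) * x p (2 * (i div 2) + 1) + sin (\<tau> p * weight q (i div 2)) * x p (2 * (i div 2))" for p
      using False by (simp add: rot_def of_cplx_def cplx_coord_def)
    then show ?thesis by (simp only:) (intro continuous_map_add continuous_map_real_mult c x)
  qed
qed

lemma continuous_map_rot:
  assumes "continuous_map X euclideanreal \<tau>" and x: "continuous_map X (nsphere (Suc (2 * n))) x"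
  shows "continuous_map X (nsphere (Suc (2 * n))) (\<lambda>p. rot q (\<tau> p) (x p))"
  unfolding continuous_map_coordinatewise(1)
proof (intro conjI allI Pi_I)
  show "continuous_map X euclideanreal (\<lambda>p. rot q (\<tau> p) (x p) i)" for i
    by (intro continuous_map_rot_coord assms(1) continuous_map_coordinate(1)[OF x])
  show "rot q (\<tau> p) (x p) \<in> topspace (nsphere (Suc (2 * n)))" if "p \<in> topspace X" for p
    by (intro rot_in_nsphere continuous_map_in_topspace[OF x] that)
qed

text \<open>
  This is where the weights must be prime to \<open>l\<close>: it makes the action free.
\<close>

lemma cis_weight_ne_1:
  assumes "coprime w (int l)" "0 < k" "k < int l"
  shows "cis (2 * pi * of_int k / l * of_int w) \<noteq> 1"
proof
  have l: "l > 0" using assms by simp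
  assume "cis (2 * pi * of_int k / l * of_int w) = 1"
  then have "cos (2 * pi * of_int k / l * of_int w) = 1" by (metis cis.simps(1) one_complex.simps(1))
  then obtain m :: int where "2 * pi * of_int k / l * of_int w = of_int m * 2 * pi"
    unfolding cos_one_2pi_int by blast
  then have "2 * pi * (of_int k * of_int w) = 2 * pi * (of_int m * l)" using l by (simp add: field_simps)
  then have "real_of_int (k * w) = of_int (m * int l)" by simp
  then have "k * w = m * int l" by linarith
  then have "int l dvd k * w" by simp
  then have "int l dvd k" using assms(1) by (metis coprime_commute coprime_dvd_mult_left_iff)
  then show False using assms zdvd_imp_le by fastforce
qed

section \<open>Lens spaces and their fundamental group\<close>

locale lens =
  fixes n l :: nat and q :: "nat \<Rightarrow> int"
  assumes n_pos: "n \<ge> 1" and l_ge_2: "l \<ge> 2"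
    and weights_coprime: "\<And>j. \<lbrakk>1 \<le> j; j \<le> n\<rbrakk> \<Longrightarrow> coprime (q j) (int l)"
begin

abbreviation S where "S \<equiv> nsphere (Suc (2 * n))"
abbreviation L where "L \<equiv> lens_space n l q"
abbreviation \<gamma> where "\<gamma> \<equiv> lens_proj l q"
abbreviation x0 where "x0 \<equiv> \<gamma> sphere_pt"
abbreviation deck where "deck k \<equiv> rot q (2 * pi * of_int k / l)"

lemma quotient_map_lens: "quotient_map S L \<gamma>"
  using quotient_map_lens_proj[of n l q] by simp

lemma l_pos: "l > 0" using l_ge_2 by simp

lemma deck_add: "deck j (deck k x) = deck (j + k) x"
  by (simp add: rot_rot algebra_simps add_divide_distrib)

lemma \<gamma>_deck [simp]: "\<gamma> (deck k x) = \<gamma> x"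
  by (rule lens_proj_rot[OF l_pos])

lemma \<gamma>_eqD:
  assumes "\<gamma> x = \<gamma> y" obtains k where "0 \<le> k" "k < int l" "y = deck k x"
  using assms lens_proj_eq_iff[OF l_pos] by auto

lemma deck_rotation_ne_1:
  assumes "0 < k" "k < int l" "j \<le> n" shows "cis (2 * pi * of_int k / l * weight q j) \<noteq> 1"
  by (rule cis_weight_ne_1[OF _ assms(1,2)]) (use assms(3) weights_coprime in \<open>simp add: weight_def\<close>)

text \<open>
  Each nontrivial element of the group multiplies each coordinate by a root of unity other than \<open>1\<close>, and
  only finitely many such factors occur.
\<close>

lemma deck_gap:
  obtains \<epsilon> where "\<epsilon> > 0"
    "\<And>k j. \<lbrakk>0 < k; k < int l; j \<le> n\<rbrakk> \<Longrightarrow> \<epsilon> \<le> cmod (1 - cis (2 * pi * of_int k / l * weight q j))"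
proof -
  define C where "C = (\<lambda>(k, j). cmod (1 - cis (2 * pi * of_int k / l * weight q j))) ` ({0<..<int l} \<times> {..n})"
  \<comment> \<open>The element \<open>1\<close> makes the set visibly nonempty.\<close>
  have C: "finite (insert 1 C)" "insert 1 C \<noteq> {}" by (auto simp: C_def)
  have "x > 0" if "x \<in> insert 1 C" for x
    using that deck_rotation_ne_1 by (auto simp: C_def)
  then have "Min (insert 1 C) > 0" using C by simp
  moreover have "Min (insert 1 C) \<le> cmod (1 - cis (2 * pi * of_int k / l * weight q j))"
    if "0 < k" "k < int l" "j \<le> n" for k j
    using that by (intro Min_le C(1)) (force simp: C_def)
  ultimately show ?thesis by (rule that)
qed

abbreviation sdist where "sdist x y \<equiv> enorm (2 * Suc n) (\<lambda>i. x i - y i)"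

lemma sdist_rot: "sdist (rot q \<tau> x) (rot q \<tau> y) = sdist x y"
proof -
  have d: "cplx_coord (\<lambda>i. x i - y i) j = cplx_coord x j - cplx_coord y j" for x y j
    by (simp add: cplx_coord_def complex_eq_iff)
  have "(sdist (rot q \<tau> x) (rot q \<tau> y))\<^sup>2 = (sdist x y)\<^sup>2"
    unfolding enorm_cplx_coord d cplx_coord_rot right_diff_distrib [symmetric] norm_mult by simp
  then show ?thesis by simp
qed

lemma sdist_deck:
  assumes x: "x \<in> topspace S" and \<epsilon>: "\<And>j. j \<le> n \<Longrightarrow> \<epsilon> \<le> cmod (1 - cis (2 * pi * of_int k / l * weight q j))" "\<epsilon> > 0"
  shows "\<epsilon> \<le> sdist x (deck k x)"
proof -
  have d: "cplx_coord (\<lambda>i. x i - deck k x i) j = (1 - cis (2 * pi * of_int k / l * weight q j)) * cplx_coord x j" for j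
  proof -
    have "cplx_coord (\<lambda>i. x i - deck k x i) j = cplx_coord x j - cplx_coord (deck k x) j"
      by (simp add: cplx_coord_def complex_eq_iff)
    then show ?thesis by (simp add: cplx_coord_rot algebra_simps)
  qed
  have "\<epsilon>\<^sup>2 = (\<Sum>j\<le>n. \<epsilon>\<^sup>2 * (cmod (cplx_coord x j))\<^sup>2)"
    using x unfolding in_nsphere_cplx_iff sum_distrib_left [symmetric] by simp
  also have "\<dots> \<le> (\<Sum>j\<le>n. (cmod (1 - cis (2 * pi * of_int k / l * weight q j)))\<^sup>2 * (cmod (cplx_coord x j))\<^sup>2)"
    using \<epsilon> by (intro sum_mono mult_right_mono power_mono) auto
  also have "\<dots> = (sdist x (deck k x))\<^sup>2"
    unfolding enorm_cplx_coord d norm_mult power_mult_distrib lessThan_Suc_atMost ..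
  finally show ?thesis by (rule power2_le_imp_le) simp
qed

text \<open>
  Two points of an orbit are at distance at least \<open>\<epsilon>\<close>, the gap above.  Being at distance less than
  \<open>\<epsilon> / 2\<close> therefore determines a point within its orbit, and the group preserves distances.
\<close>

theorem lens_nearness_covering: "\<exists>W. nearness_covering S L \<gamma> W"
proof -
  obtain \<epsilon> where \<epsilon>: "\<epsilon> > 0"
    "\<And>k j. \<lbrakk>0 < k; k < int l; j \<le> n\<rbrakk> \<Longrightarrow> \<epsilon> \<le> cmod (1 - cis (2 * pi * of_int k / l * weight q j))"
    by (rule deck_gap) (rule that)
  define W where "W = {p \<in> topspace (prod_topology S S). sdist (fst p) (snd p) \<in> {..<\<epsilon> / 2}}"
  note qm = quotient_map_lens
  have "nearness_covering S L \<gamma> W"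
  proof
    show "continuous_map S L \<gamma>" using qm by (rule quotient_imp_continuous_map)
    show "\<gamma> ` topspace S = topspace L" using qm by (rule quotient_imp_surjective_map)
    show "Hausdorff_space S" by (rule Hausdorff_space_nsphere)
    show "open_map S L \<gamma>"
      unfolding open_map_def
    proof (intro allI impI)
      fix U assume U: "openin S U"
      have US: "U \<subseteq> topspace S" using U by (rule openin_subset)
      have "{x \<in> topspace S. \<gamma> x \<in> \<gamma> ` U} = (\<Union>k\<in>UNIV. {x \<in> topspace S. deck k x \<in> U})"
      proof (intro equalityI subsetI)
        fix x assume "x \<in> {x \<in> topspace S. \<gamma> x \<in> \<gamma> ` U}"
        then obtain y where y: "x \<in> topspace S" "y \<in> U" "\<gamma> x = \<gamma> y" by auto
        obtain k where "y = deck k x" by (rule \<gamma>_eqD[OF y(3)])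
        then show "x \<in> (\<Union>k\<in>UNIV. {x \<in> topspace S. deck k x \<in> U})" using y by auto
      next
        fix x assume "x \<in> (\<Union>k\<in>UNIV. {x \<in> topspace S. deck k x \<in> U})"
        then obtain k where k: "x \<in> topspace S" "deck k x \<in> U" by auto
        then have "\<gamma> (deck k x) \<in> \<gamma> ` U" by (intro imageI)
        then show "x \<in> {x \<in> topspace S. \<gamma> x \<in> \<gamma> ` U}" using k(1) by simp
      qed
      moreover have "openin S {x \<in> topspace S. deck k x \<in> U}" for k
      proof (rule openin_continuous_map_preimage[OF _ U])
        have "continuous_map S S (\<lambda>x. x)" using continuous_map_id by (simp add: id_def)
        then show "continuous_map S S (deck k)"
          by (intro continuous_map_rot[of S "\<lambda>_. 2 * pi * of_int k / l"]) simp
      qed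
      ultimately have "openin S {x \<in> topspace S. \<gamma> x \<in> \<gamma> ` U}" by auto
      then show "openin L (\<gamma> ` U)" using US unfolding openin_lens_space by auto
    qed
    have "continuous_map (prod_topology S S) euclideanreal (\<lambda>p. fst p i - snd p i)" for i
      by (intro continuous_map_diff continuous_map_coordinate(1)[OF continuous_map_fst]
          continuous_map_coordinate(1)[OF continuous_map_snd])
    then have "continuous_map (prod_topology S S) euclideanreal (\<lambda>p. sdist (fst p) (snd p))"
      by (rule continuous_map_enorm)
    then show "openin (prod_topology S S) W"
      unfolding W_def by (rule openin_continuous_map_preimage) simp
    have W: "(x, y) \<in> W \<longleftrightarrow> x \<in> topspace S \<and> y \<in> topspace S \<and> sdist x y < \<epsilon> / 2" for x y
      by (auto simp: W_def)
    show "(x, x) \<in> W" if "x \<in> topspace S" for x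
      using that \<epsilon>(1) unfolding W by (simp add: enorm_def)
    show "y = z" if xy: "(x, y) \<in> W" and xz: "(x, z) \<in> W" and yz: "\<gamma> y = \<gamma> z" for x y z
    proof -
      obtain k where k: "0 \<le> k" "k < int l" "z = deck k y" by (rule \<gamma>_eqD[OF yz])
      have "sdist y x = sdist x y"
        unfolding enorm_def by (simp add: power2_commute)
      moreover have "sdist y z \<le> sdist y x + sdist x z"
        using enorm_triangle[of "2 * Suc n" "\<lambda>i. y i - x i" "\<lambda>i. x i - z i"] by simp
      ultimately have "sdist y z < \<epsilon>" using xy xz unfolding W by linarith
      then have "\<not> 0 < k" using sdist_deck[of y \<epsilon> k] \<epsilon> xy k unfolding W by force
      then have "k = 0" using k(1) by simp
      then show "y = z" using k(3) by simp
    qed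
    show "\<exists>y'. (x', y') \<in> W \<and> \<gamma> y' = \<gamma> y" if xy: "(x, y) \<in> W" and x': "x' \<in> topspace S" "\<gamma> x' = \<gamma> x" for x y x'
    proof -
      obtain k where k: "x' = deck k x" by (rule \<gamma>_eqD[OF x'(2)[symmetric]])
      have "(x', deck k y) \<in> W" using xy unfolding W k sdist_rot by (simp add: rot_in_nsphere)
      then show ?thesis by (intro exI[of _ "deck k y"]) simp
    qed
  qed
  then show ?thesis by blast
qed

definition W where "W = (SOME W. nearness_covering S L \<gamma> W)"

sublocale nearness_covering S L \<gamma> W
  unfolding W_def by (rule someI_ex[OF lens_nearness_covering])

lemma pt_in: "sphere_pt \<in> topspace S" by (rule sphere_pt_in)

lemma deck_pt_eqD:
  assumes "deck j sphere_pt = deck k sphere_pt" shows "j mod int l = k mod int l"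
proof (rule ccontr)
  assume ne: "j mod int l \<noteq> k mod int l"
  let ?d = "(j - k) mod int l"
  have "?d \<noteq> 0" using ne by (simp add: mod_eq_dvd_iff dvd_eq_mod_eq_0)
  moreover have "0 \<le> ?d" "?d < int l" using l_pos by simp_all
  ultimately have d: "0 < ?d" "?d < int l" by linarith+
  have "deck ?d sphere_pt = deck (j - k) sphere_pt" by (rule rot_mod[OF l_pos])
  also have "deck (j - k) sphere_pt = deck (- k) (deck j sphere_pt)" by (simp only: deck_add) simp
  also have "\<dots> = sphere_pt" unfolding assms deck_add by simp
  finally have "cplx_coord (deck ?d sphere_pt) 0 = cplx_coord sphere_pt 0" by simp
  moreover have "cplx_coord sphere_pt 0 = 1" by (simp add: cplx_coord_def sphere_pt_def complex_eq_iff)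
  ultimately show False using deck_rotation_ne_1[OF d, of 0] by (simp add: cplx_coord_rot)
qed

text \<open>
  The end point of a lifted loop, as an element of the cyclic group, given by an integer modulo \<open>l\<close>.
\<close>

definition has_monodromy :: "((nat \<Rightarrow> real) \<Rightarrow> (nat \<Rightarrow> real) set) \<Rightarrow> int \<Rightarrow> bool" where
  "has_monodromy f k \<longleftrightarrow> (\<exists>u. path_lift f u \<and> u 0 = sphere_pt \<and> u 1 = deck k sphere_pt)"

lemma has_monodromy_exists:
  assumes f: "sphere_map 1 L x0 f"
  shows "\<exists>k. 0 \<le> k \<and> k < int l \<and> has_monodromy f k"
proof -
  obtain u where u: "path_lift f u" "u 0 = sphere_pt" using path_lift_exists[OF f pt_in refl] .
  then have "\<gamma> (u 1) = f (circle_path 1)" by (simp add: path_lift_def)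
  then have "x0 = \<gamma> (u 1)" using f by (simp add: sphere_map_def)
  then obtain k where "0 \<le> k" "k < int l" "u 1 = deck k sphere_pt" by (rule \<gamma>_eqD)
  then show ?thesis using u by (auto simp: has_monodromy_def)
qed

lemma has_monodromy_unique:
  assumes "has_monodromy f j" "has_monodromy f k" shows "j mod int l = k mod int l"
proof -
  obtain u v where u: "path_lift f u" "u 0 = sphere_pt" "u 1 = deck j sphere_pt"
    and v: "path_lift f v" "v 0 = sphere_pt" "v 1 = deck k sphere_pt"
    using assms by (auto simp: has_monodromy_def)
  have "u 1 = v 1" by (rule path_lift_unique[OF u(1) v(1)]) (simp_all add: u v)
  then show ?thesis unfolding u(3) v(3) by (rule deck_pt_eqD)
qed

lemma has_monodromy_mod: "has_monodromy f k \<longleftrightarrow> has_monodromy f (k mod int l)"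
  unfolding has_monodromy_def rot_mod[OF l_pos] ..

lemma homotopic_imp_same_monodromy:
  assumes fg: "based_homotopic 1 L x0 f g" and f: "has_monodromy f k"
  shows "has_monodromy g k"
proof -
  obtain u where u: "path_lift f u" "u 0 = sphere_pt" "u 1 = deck k sphere_pt"
    using f by (auto simp: has_monodromy_def)
  obtain v where v: "path_lift g v" "v 0 = sphere_pt"
    using path_lift_exists[OF based_homotopic_imp_sphere_map(2)[OF fg] pt_in refl] .
  have "u 1 = v 1" using fg u(1,2) v by (rule path_lift_homotopic_ends)
  then show ?thesis using u v by (auto simp: has_monodromy_def)
qed

text \<open>
  The lifts have the same ends, and the sphere has dimension at least three.
\<close>

lemma same_monodromy_imp_homotopic:
  assumes f: "sphere_map 1 L x0 f" "has_monodromy f k" and g: "sphere_map 1 L x0 g" "has_monodromy g k"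
  shows "based_homotopic 1 L x0 f g"
proof -
  obtain u v where u: "path_lift f u" "u 0 = sphere_pt" "u 1 = deck k sphere_pt"
    and v: "path_lift g v" "v 0 = sphere_pt" "v 1 = deck k sphere_pt"
    using f(2) g(2) by (auto simp: has_monodromy_def)
  have "path_homotopic S (u 0) (u 1) u v"
    using n_pos u v by (intro nsphere_path_homotopic) (auto simp: path_lift_def)
  then show ?thesis using based_homotopic_of_path_lifts[OF f(1) g(1) u(1) v(1)] by simp
qed

lemma sphere_map_of_path_lift:
  assumes u: "continuous_map (top_of_set {0..1}) S u" "\<And>t. t \<in> {0..1} \<Longrightarrow> \<gamma> (u t) = f (circle_path t)"
    and u0: "u 0 = sphere_pt"
  shows "sphere_map 1 L x0 f" "path_lift f u"
proof -
  let ?I = "top_of_set {0..1::real}"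
  show "path_lift f u" using u by (simp add: path_lift_def)
  have "quotient_map ?I (nsphere 1) circle_path"
  proof (rule continuous_imp_quotient_map)
    show "continuous_map ?I (nsphere 1) circle_path"
      by (rule continuous_map_from_subtopology[OF continuous_map_circle_path])
    show "circle_path ` topspace ?I = topspace (nsphere 1)"
    proof
      show "circle_path ` topspace ?I \<subseteq> topspace (nsphere 1)" using circle_path_in by blast
      show "topspace (nsphere 1) \<subseteq> circle_path ` topspace ?I"
      proof
        fix y assume "y \<in> topspace (nsphere 1)"
        then obtain t where "t \<in> {0..1}" "circle_path t = y" by (rule circle_path_surj)
        then show "y \<in> circle_path ` topspace ?I" by auto
      qed
    qed
  qed (simp_all add: compact_space_subtopology Hausdorff_space_nsphere)
  moreover have "continuous_map ?I L (f \<circ> circle_path)"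
    by (rule continuous_map_eq[OF continuous_map_compose[OF u(1) p_continuous]]) (simp add: u(2))
  ultimately have "continuous_map (nsphere 1) L f" by (rule continuous_compose_quotient_map)
  moreover have "f sphere_pt = x0" using u(2)[of 0] u0 by simp
  ultimately show "sphere_map 1 L x0 f" by (simp add: sphere_map_def)
qed

text \<open>
  The lift of the second loop must start where the first one ends, and so is translated by the group
  element of the first loop.
\<close>

lemma sphere_mult_monodromy:
  assumes f: "sphere_map 1 L x0 f" "has_monodromy f j" and g: "sphere_map 1 L x0 g" "has_monodromy g k"
  shows "sphere_map 1 L x0 (sphere_mult f g)" "has_monodromy (sphere_mult f g) (j + k)"
proof -
  let ?I = "top_of_set {0..1::real}"
  obtain u v where u: "path_lift f u" "u 0 = sphere_pt" "u 1 = deck j sphere_pt"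
    and v: "path_lift g v" "v 0 = sphere_pt" "v 1 = deck k sphere_pt"
    using f(2) g(2) by (auto simp: has_monodromy_def)
  have cu: "continuous_map ?I S u" and cv: "continuous_map ?I S v"
    using u(1) v(1) by (simp_all add: path_lift_def)
  define w where "w = (\<lambda>t. if t \<le> 1/2 then u (2 * t) else deck j (v (2 * t - 1)))"
  have "continuous_map ?I S w"
    unfolding w_def
  proof (rule continuous_map_cases_le)
    have "continuous_map (subtopology ?I {x \<in> topspace ?I. x \<le> 1/2}) ?I (\<lambda>t. 2 * t)"
      unfolding subtopology_subtopology continuous_map_in_subtopology
      by (auto intro!: continuous_intros)
    from continuous_map_compose[OF this cu]
    show "continuous_map (subtopology ?I {x \<in> topspace ?I. x \<le> 1/2}) S (\<lambda>t. u (2 * t))" unfolding o_def .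
    have "continuous_map (subtopology ?I {x \<in> topspace ?I. 1/2 \<le> x}) ?I (\<lambda>t. 2 * t - 1)"
      unfolding subtopology_subtopology continuous_map_in_subtopology
      by (auto intro!: continuous_intros)
    from continuous_map_compose[OF this cv]
    have "continuous_map (subtopology ?I {x \<in> topspace ?I. 1/2 \<le> x}) S (\<lambda>t. v (2 * t - 1))" unfolding o_def .
    then show "continuous_map (subtopology ?I {x \<in> topspace ?I. 1/2 \<le> x}) S (\<lambda>t. deck j (v (2 * t - 1)))"
      by (intro continuous_map_rot) simp_all
    show "u (2 * x) = deck j (v (2 * x - 1))" if "x = 1/2" for x :: real
      unfolding that using u(3) v(2) by simp
  qed (auto intro: continuous_intros)
  moreover have "\<gamma> (w t) = sphere_mult f g (circle_path t)" if t: "t \<in> {0..1}" for t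
  proof -
    have "f sphere_pt = g sphere_pt" using f(1) g(1) by (simp add: sphere_map_def)
    then have "sphere_mult f g (circle_path t) = (if t \<le> 1/2 then f (circle_path (2 * t)) else g (circle_path (2 * t - 1)))"
      using t by (intro sphere_mult_circle_path)
    then show ?thesis
      using t u(1) v(1) unfolding w_def by (auto simp: path_lift_def)
  qed
  moreover have "w 0 = sphere_pt" using u(2) by (simp add: w_def)
  ultimately have "sphere_map 1 L x0 (sphere_mult f g)" "path_lift (sphere_mult f g) w"
    using sphere_map_of_path_lift by blast+
  then show "sphere_map 1 L x0 (sphere_mult f g)" "has_monodromy (sphere_mult f g) (j + k)"
    using \<open>w 0 = sphere_pt\<close> v(3) by (auto simp: has_monodromy_def w_def deck_add intro!: exI[of _ w])
qed

text \<open>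
  At time \<open>1\<close> the flow is an element of the group, so on the lens space it closes up to a map
  on \<open>L \<times> S\<^sup>1\<close>.
\<close>

lemma circle_action:
  fixes k :: int
  obtains F where "continuous_map (prod_topology L (nsphere 1)) L F"
    "\<And>z t. \<lbrakk>z \<in> topspace S; t \<in> {0..1}\<rbrakk> \<Longrightarrow> F (\<gamma> z, circle_path t) = \<gamma> (rot q (2 * pi * of_int k / l * t) z)"
proof -
  let ?I = "top_of_set {0..1::real}"
  have q1: "quotient_map (prod_topology S ?I) (prod_topology S (nsphere 1)) (\<lambda>(x, t). (x, circle_path t))"
    by (rule quotient_map_circle_path[OF compact_space_nsphere Hausdorff_space_nsphere])
  have q2: "quotient_map (prod_topology S (nsphere 1)) (prod_topology L (nsphere 1)) (\<lambda>(x, y). (\<gamma> x, y))"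
    by (intro quotient_map_prod_left quotient_map_lens disjI1 Hausdorff_space_nsphere
        compact_imp_locally_compact_space compact_space_nsphere)
  have Q: "quotient_map (prod_topology S ?I) (prod_topology L (nsphere 1)) (\<lambda>(x, t). (\<gamma> x, circle_path t))"
    using quotient_map_compose[OF q1 q2] by (simp add: o_def case_prod_unfold)
  have fst: "continuous_map (prod_topology S ?I) euclideanreal snd"
    using continuous_map_snd[of S ?I] continuous_map_in_subtopology by blast
  have "continuous_map (prod_topology S ?I) S (\<lambda>p. rot q (2 * pi * of_int k / l * snd p) (fst p))"
    by (intro continuous_map_rot continuous_map_fst continuous_map_real_mult fst) simp
  from continuous_map_compose[OF this p_continuous]
  have c: "continuous_map (prod_topology S ?I) L (\<lambda>p. \<gamma> (rot q (2 * pi * of_int k / l * snd p) (fst p)))"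
    unfolding o_def .
  show ?thesis
  proof (rule quotient_map_lift_exists[OF Q c])
    fix x y assume x: "x \<in> topspace (prod_topology S ?I)" and y: "y \<in> topspace (prod_topology S ?I)"
      and eq: "(case x of (x, t) \<Rightarrow> (\<gamma> x, circle_path t)) = (case y of (x, t) \<Rightarrow> (\<gamma> x, circle_path t))"
    have \<gamma>xy: "\<gamma> (fst x) = \<gamma> (fst y)" and c: "circle_path (snd x) = circle_path (snd y)"
      using eq by (simp_all add: case_prod_unfold)
    have t: "snd x = snd y \<or> {snd x, snd y} = {0, 1}"
      using c by (rule circle_path_eqD) (use x y in auto)
    have "\<gamma> (rot q (2 * pi * of_int k / l * s) (fst x)) = \<gamma> (fst y)" "\<gamma> (rot q (2 * pi * of_int k / l * s) (fst y)) = \<gamma> (fst y)"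
      if "s = 0 \<or> s = 1" for s
      using that by (elim disjE; simp add: \<gamma>xy)+
    note ends = this
    from t consider "snd x = snd y" | "snd x = 0 \<or> snd x = 1" "snd y = 0 \<or> snd y = 1"
      unfolding doubleton_eq_iff by blast
    then show "\<gamma> (rot q (2 * pi * of_int k / l * snd x) (fst x)) = \<gamma> (rot q (2 * pi * of_int k / l * snd y) (fst y))"
    proof cases
      case 1
      show ?thesis unfolding 1 by (rule lens_proj_rot_eq[OF l_pos \<gamma>xy])
    next
      case 2
      show ?thesis using ends(1)[OF 2(1)] ends(2)[OF 2(2)] by (rule trans[OF _ sym])
    qed
  next
    fix F assume "continuous_map (prod_topology L (nsphere 1)) L F"
      and F: "\<And>x. x \<in> topspace (prod_topology S ?I) \<Longrightarrow>
        F (case x of (x, t) \<Rightarrow> (\<gamma> x, circle_path t)) = \<gamma> (rot q (2 * pi * of_int k / l * snd x) (fst x))"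
    then show thesis using F[of "(_, _)"] by (intro that[of F]) auto
  qed
qed

lemma loop_with_monodromy:
  fixes k :: int
  obtains f F where "sphere_map 1 L x0 f" "has_monodromy f k"
    "continuous_map (prod_topology L (nsphere 1)) L F"
    "\<And>a. a \<in> topspace L \<Longrightarrow> F (a, sphere_pt) = a" "\<And>y. F (x0, y) = f y"
proof -
  obtain F where F: "continuous_map (prod_topology L (nsphere 1)) L F"
    "\<And>z t. \<lbrakk>z \<in> topspace S; t \<in> {0..1}\<rbrakk> \<Longrightarrow> F (\<gamma> z, circle_path t) = \<gamma> (rot q (2 * pi * of_int k / l * t) z)"
    by (rule circle_action[of k]) (rule that)
  define u where "u = (\<lambda>t. rot q (2 * pi * of_int k / l * t) sphere_pt)"
  define f where "f = (\<lambda>y. F (x0, y))"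
  have "continuous_map (top_of_set {0..1}) S u"
    unfolding u_def using pt_in by (intro continuous_map_rot continuous_map_real_mult) auto
  moreover have "\<gamma> (u t) = f (circle_path t)" if "t \<in> {0..1}" for t
    using F(2)[OF pt_in that] by (simp add: u_def f_def)
  moreover have "u 0 = sphere_pt" "u 1 = deck k sphere_pt" by (simp_all add: u_def)
  ultimately have f: "sphere_map 1 L x0 f" "has_monodromy f k"
    using sphere_map_of_path_lift[of u f] by (auto simp: has_monodromy_def)
  have "F (a, sphere_pt) = a" if "a \<in> topspace L" for a
  proof -
    obtain z where "z \<in> topspace S" "a = \<gamma> z" using \<open>a \<in> topspace L\<close> p_onto by blast
    then show ?thesis using F(2)[of z 0] by simp
  qed
  then show ?thesis using that[OF f F(1)] by (simp add: f_def)
qed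

text \<open>
  Every class of \<open>\<pi>\<^sub>1\<close> is represented by an orbit of the base point under the circle action, and the
  action itself is the required map on \<open>L \<times> S\<^sup>1\<close>.
\<close>

theorem gottlieb_1_lens: "gottlieb 1 L x0 = carrier (homotopy_group 1 L x0)"
proof
  show "gottlieb 1 L x0 \<subseteq> carrier (homotopy_group 1 L x0)"
    unfolding gottlieb_def gottlieb_along_def by blast
  show "carrier (homotopy_group 1 L x0) \<subseteq> gottlieb 1 L x0"
  proof
    fix c assume "c \<in> carrier (homotopy_group 1 L x0)"
    then obtain g where g: "sphere_map 1 L x0 g" "c = sphere_class 1 L x0 g" by (rule homotopy_groupE)
    obtain k where k: "has_monodromy g k" using has_monodromy_exists[OF g(1)] by blast
    obtain f F where f: "sphere_map 1 L x0 f" "has_monodromy f k"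
      and F: "continuous_map (prod_topology L (nsphere 1)) L F"
        "\<And>a. a \<in> topspace L \<Longrightarrow> F (a, sphere_pt) = a" "\<And>y. F (x0, y) = f y"
      by (rule loop_with_monodromy[of k]) (rule that)
    have c: "c = sphere_class 1 L x0 f"
      unfolding g(2) by (rule based_homotopic_imp_class_eq[OF same_monodromy_imp_homotopic[OF g(1) k f]])
    show "c \<in> gottlieb 1 L x0"
      unfolding c gottlieb_def
    proof (rule sphere_class_in_gottlieb_alongI[OF f(1) _ _ F(1)])
      show "x0 \<in> topspace L" using p_onto pt_in by blast
    qed (simp_all add: F)
  qed
qed

text \<open>
  The isomorphism is the monodromy.  It is well defined and injective by the comparison of homotopies
  of loops with end points of lifts, and surjective by the orbits of the circle action.
\<close>

theorem fundamental_group_lens: "homotopy_group 1 L x0 \<cong> integer_mod_group l"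
proof -
  define \<phi> where "\<phi> = (\<lambda>c. SOME k. 0 \<le> k \<and> k < int l \<and> (\<exists>f\<in>c. has_monodromy f k))"
  have \<phi>_eq: "\<phi> (sphere_class 1 L x0 f) = k mod int l" if f: "sphere_map 1 L x0 f" "has_monodromy f k" for f k
  proof -
    have ex: "0 \<le> k mod int l \<and> k mod int l < int l \<and> (\<exists>g\<in>sphere_class 1 L x0 f. has_monodromy g (k mod int l))"
      using l_pos f(2) has_monodromy_mod sphere_class_self[OF f(1)] by auto
    obtain g where \<phi>: "0 \<le> \<phi> (sphere_class 1 L x0 f)" "\<phi> (sphere_class 1 L x0 f) < int l"
      and g: "g \<in> sphere_class 1 L x0 f" "has_monodromy g (\<phi> (sphere_class 1 L x0 f))"
      using someI[of "\<lambda>k. 0 \<le> k \<and> k < int l \<and> (\<exists>g\<in>sphere_class 1 L x0 f. has_monodromy g k)", OF ex]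
      unfolding \<phi>_def by blast
    have "has_monodromy g k" using in_sphere_class_imp(1)[OF g(1)] f(2) by (rule homotopic_imp_same_monodromy)
    then have "\<phi> (sphere_class 1 L x0 f) mod int l = k mod int l" using g(2) has_monodromy_unique by blast
    then show ?thesis using \<phi> by simp
  qed
  have mult: "sphere_class 1 L x0 f \<otimes>\<^bsub>homotopy_group 1 L x0\<^esub> sphere_class 1 L x0 g = sphere_class 1 L x0 (sphere_mult f g)"
    if f: "sphere_map 1 L x0 f" and g: "sphere_map 1 L x0 g" for f g
  proof -
    obtain j where j: "has_monodromy f j" using has_monodromy_exists[OF f] by blast
    obtain k where k: "has_monodromy g k" using has_monodromy_exists[OF g] by blast
    have eq: "sphere_class 1 L x0 (sphere_mult f' g') = sphere_class 1 L x0 (sphere_mult f g)"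
      if "f' \<in> sphere_class 1 L x0 f" "g' \<in> sphere_class 1 L x0 g" for f' g'
    proof -
      note f' = in_sphere_class_imp(2)[OF that(1)] homotopic_imp_same_monodromy[OF in_sphere_class_imp(1)[OF that(1)] j]
      note g' = in_sphere_class_imp(2)[OF that(2)] homotopic_imp_same_monodromy[OF in_sphere_class_imp(1)[OF that(2)] k]
      show ?thesis
        by (rule based_homotopic_imp_class_eq[OF same_monodromy_imp_homotopic[OF
                sphere_mult_monodromy[OF f' g'] sphere_mult_monodromy[OF f j g k]]])
    qed
    have "sphere_class 1 L x0 f \<otimes>\<^bsub>homotopy_group 1 L x0\<^esub> sphere_class 1 L x0 g =
      (\<Union>f'\<in>sphere_class 1 L x0 f. \<Union>g'\<in>sphere_class 1 L x0 g. sphere_class 1 L x0 (sphere_mult f' g'))"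
      by (simp add: homotopy_group_def)
    also have "\<dots> = sphere_class 1 L x0 (sphere_mult f g)"
      by (rule UN2_constant[OF sphere_class_self[OF f] sphere_class_self[OF g]]) (rule eq)
    finally show ?thesis .
  qed
  have carr: "carrier (integer_mod_group l) = {0..<int l}"
    using l_pos by (simp add: carrier_integer_mod_group)
  have "\<phi> \<in> hom (homotopy_group 1 L x0) (integer_mod_group l)"
  proof (rule homI)
    fix c assume "c \<in> carrier (homotopy_group 1 L x0)"
    then obtain f where f: "sphere_map 1 L x0 f" "c = sphere_class 1 L x0 f" by (rule homotopy_groupE)
    obtain k where "has_monodromy f k" using has_monodromy_exists[OF f(1)] by blast
    then show "\<phi> c \<in> carrier (integer_mod_group l)" using \<phi>_eq[OF f(1)] f(2) l_pos by (simp add: carr)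
  next
    fix c d assume "c \<in> carrier (homotopy_group 1 L x0)" "d \<in> carrier (homotopy_group 1 L x0)"
    then obtain f g where f: "sphere_map 1 L x0 f" "c = sphere_class 1 L x0 f"
      and g: "sphere_map 1 L x0 g" "d = sphere_class 1 L x0 g" by (elim homotopy_groupE) (rule that)
    obtain j where j: "has_monodromy f j" using has_monodromy_exists[OF f(1)] by blast
    obtain k where k: "has_monodromy g k" using has_monodromy_exists[OF g(1)] by blast
    note m = sphere_mult_monodromy[OF f(1) j g(1) k]
    show "\<phi> (c \<otimes>\<^bsub>homotopy_group 1 L x0\<^esub> d) = \<phi> c \<otimes>\<^bsub>integer_mod_group l\<^esub> \<phi> d"
      unfolding f(2) g(2) mult[OF f(1) g(1)] \<phi>_eq[OF m] \<phi>_eq[OF f(1) j] \<phi>_eq[OF g(1) k]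
      by (simp add: mult_integer_mod_group mod_add_eq)
  qed
  moreover have "bij_betw \<phi> (carrier (homotopy_group 1 L x0)) (carrier (integer_mod_group l))"
    unfolding bij_betw_def
  proof
    show "inj_on \<phi> (carrier (homotopy_group 1 L x0))"
    proof (rule inj_onI)
      fix c d assume "c \<in> carrier (homotopy_group 1 L x0)" "d \<in> carrier (homotopy_group 1 L x0)" and eq: "\<phi> c = \<phi> d"
      then obtain f g where f: "sphere_map 1 L x0 f" "c = sphere_class 1 L x0 f"
        and g: "sphere_map 1 L x0 g" "d = sphere_class 1 L x0 g" by (elim homotopy_groupE) (rule that)
      obtain j where j: "has_monodromy f j" using has_monodromy_exists[OF f(1)] by blast
      obtain k where k: "has_monodromy g k" using has_monodromy_exists[OF g(1)] by blast
      have "j mod int l = k mod int l"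
        using eq unfolding f(2) g(2) \<phi>_eq[OF f(1) j] \<phi>_eq[OF g(1) k] .
      then have "has_monodromy g j" using k has_monodromy_mod by metis
      then show "c = d"
        unfolding f(2) g(2)
        by (intro based_homotopic_imp_class_eq same_monodromy_imp_homotopic[OF f(1) j g(1)])
    qed
    show "\<phi> ` carrier (homotopy_group 1 L x0) = carrier (integer_mod_group l)"
    proof
      show "\<phi> ` carrier (homotopy_group 1 L x0) \<subseteq> carrier (integer_mod_group l)"
        using \<open>\<phi> \<in> hom _ _\<close> by (auto simp: hom_def)
      show "carrier (integer_mod_group l) \<subseteq> \<phi> ` carrier (homotopy_group 1 L x0)"
      proof
        fix k assume k: "k \<in> carrier (integer_mod_group l)"
        obtain f where f: "sphere_map 1 L x0 f" "has_monodromy f k"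
          by (rule loop_with_monodromy[of k]) (rule that)
        have "k = \<phi> (sphere_class 1 L x0 f)" using k \<phi>_eq[OF f] by (simp add: carr)
        then show "k \<in> \<phi> ` carrier (homotopy_group 1 L x0)"
          using sphere_class_in_homotopy_group[OF f(1)] by (rule image_eqI)
      qed
    qed
  qed
  ultimately show ?thesis unfolding is_iso_def iso_def by blast
qed

end

section \<open>Three-dimensional lens spaces\<close>

text \<open>
  Quaternions \<open>x + y j\<close> as pairs of complex numbers, where \<open>j c = cnj c * j\<close>.
\<close>

definition qmul :: "complex \<times> complex \<Rightarrow> complex \<times> complex \<Rightarrow> complex \<times> complex" where
  "qmul x y = (fst x * fst y - snd x * cnj (snd y), fst x * snd y + snd x * cnj (fst y))"

definition qcnj :: "complex \<times> complex \<Rightarrow> complex \<times> complex" where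
  "qcnj x = (cnj (fst x), - snd x)"

definition qsq :: "complex \<times> complex \<Rightarrow> real" where
  "qsq x = (cmod (fst x))\<^sup>2 + (cmod (snd x))\<^sup>2"

lemma qsq_qmul: "qsq (qmul x y) = qsq x * qsq y"
proof -
  have "complex_of_real (qsq (qmul x y)) = complex_of_real (qsq x * qsq y)"
    unfolding qsq_def qmul_def of_real_add of_real_mult complex_norm_square
    by (simp add: algebra_simps)
  then show ?thesis unfolding of_real_eq_iff .
qed

lemma qsq_qcnj: "qsq (qcnj x) = qsq x"
  by (simp add: qsq_def qcnj_def)

lemma qsq_scaleR: "qsq (a *\<^sub>R x) = a\<^sup>2 * qsq x"
  by (simp add: qsq_def power_mult_distrib algebra_simps)

text \<open>
  The quaternion \<open>C = z\<^sub>0\<^sup>a + z\<^sub>1\<^sup>b j\<close>.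
\<close>

definition monomials :: "nat \<Rightarrow> nat \<Rightarrow> complex \<times> complex \<Rightarrow> complex \<times> complex" where
  "monomials a b z = (fst z ^ a, snd z ^ b)"

text \<open>
  The quaternion \<open>z C w C\<^sup>-\<^sup>1\<close>.
\<close>

definition frame :: "nat \<Rightarrow> nat \<Rightarrow> complex \<times> complex \<Rightarrow> complex \<times> complex \<Rightarrow> complex \<times> complex" where
  "frame a b z w = (1 / qsq (monomials a b z)) *\<^sub>R
      qmul z (qmul (qmul (monomials a b z) w) (qcnj (monomials a b z)))"

lemma qsq_monomials_pos: "z \<noteq> 0 \<Longrightarrow> qsq (monomials a b z) > 0"
proof -
  assume "z \<noteq> 0"
  then have "fst z ^ a \<noteq> 0 \<or> snd z ^ b \<noteq> 0" by (auto simp: prod_eq_iff)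
  then show ?thesis by (auto simp: qsq_def monomials_def add_pos_nonneg add_nonneg_pos)
qed

lemma qsq_frame: "z \<noteq> 0 \<Longrightarrow> qsq (frame a b z w) = qsq z * qsq w"
  using qsq_monomials_pos[of z a b]
  by (simp add: frame_def qsq_scaleR qsq_qmul qsq_qcnj power2_eq_square)

lemma frame_one_right: "z \<noteq> 0 \<Longrightarrow> frame a b z (1, 0) = z"
proof -
  assume "z \<noteq> 0"
  let ?c = "monomials a b z"
  have n: "qsq ?c > 0" using qsq_monomials_pos[OF \<open>z \<noteq> 0\<close>] .
  have "qmul (qmul ?c (1, 0)) (qcnj ?c) = (complex_of_real (qsq ?c), 0)"
    unfolding qsq_def of_real_add complex_norm_square by (simp add: qmul_def qcnj_def)
  then have "frame a b z (1, 0) = (1 / qsq ?c) *\<^sub>R qmul z (complex_of_real (qsq ?c), 0)" by (simp add: frame_def)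
  also have "\<dots> = z"
    using n by (simp add: qmul_def prod_eq_iff scaleR_conv_of_real)
  finally show ?thesis .
qed

lemma frame_one_left: "b \<ge> 1 \<Longrightarrow> frame a b (1, 0) w = w"
  by (simp add: frame_def monomials_def qmul_def qcnj_def qsq_def power_0_left)

text \<open>
  If \<open>z\<^sub>0\<close> and \<open>z\<^sub>1\<close> are multiplied by \<open>s\<close> and \<open>t\<close>, then \<open>C\<close> is multiplied on the left by
  \<open>c = s\<^sup>a = t\<^sup>b\<close>.  This fixes the first complex coordinate of \<open>C w C\<^sup>-\<^sup>1\<close> and multiplies the second one
  by \<open>c\<^sup>2\<close>, and \<open>t = c\<^sup>2 s\<close> is exactly what makes the product with \<open>z\<close> transform like \<open>z\<close>.
\<close>

lemma frame_equivariant: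
  assumes unit: "s * cnj s = 1" and e: "s ^ a = t ^ b" and t: "t = (s ^ a)\<^sup>2 * s"
  shows "frame a b (s * fst z, t * snd z) w = (s * fst (frame a b z w), t * snd (frame a b z w))"
proof -
  define c where "c = s ^ a"
  have c: "c * cnj c = 1" using unit by (simp add: c_def flip: power_mult_distrib)
  have cm: "cmod c = 1" 
  proof -
    have "complex_of_real ((cmod c)\<^sup>2) = 1" using c unfolding complex_norm_square .
    then have "(cmod c)\<^sup>2 = 1" using of_real_eq_1_iff by blast
    then show ?thesis using power2_eq_1_iff[of "cmod c"] norm_ge_zero[of c] by linarith
  qed
  define f g where "f = fst z ^ a" and "g = snd z ^ b"
  have m: "monomials a b z = (f, g)" "monomials a b (s * fst z, t * snd z) = (c * f, c * g)"
    using e by (simp_all add: monomials_def f_def g_def c_def power_mult_distrib)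
  have N: "qsq (c * f, c * g) = qsq (f, g)" by (simp add: qsq_def norm_mult cm)
  define d where "d = qmul (qmul (f, g) w) (qcnj (f, g))"
  have "qmul (qmul (c * f, c * g) w) (qcnj (c * f, c * g)) = ((c * cnj c) * fst d, c * c * snd d)"
    by (simp add: d_def qmul_def qcnj_def algebra_simps)
  then have D: "qmul (qmul (c * f, c * g) w) (qcnj (c * f, c * g)) = (fst d, c\<^sup>2 * snd d)"
    by (simp add: c power2_eq_square)
  have t': "t = c\<^sup>2 * s" using t by (simp add: c_def)
  have "t * cnj (c\<^sup>2) = (c * cnj c)\<^sup>2 * s" by (simp add: t' power2_eq_square)
  then have tc: "t * cnj (c\<^sup>2) = s" by (simp add: c)
  have "snd z * t * (cnj (c\<^sup>2) * cnj (snd d)) = snd z * (t * cnj (c\<^sup>2)) * cnj (snd d)" by (simp only: mult_ac)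
  then have "qmul (s * fst z, t * snd z) (fst d, c\<^sup>2 * snd d) = (s * fst (qmul z d), t * snd (qmul z d))"
    unfolding tc by (simp add: qmul_def t' algebra_simps)
  then show ?thesis
    unfolding frame_def m N D d_def [symmetric] by (simp add: scaleR_conv_of_real)
qed

lemma continuous_on_frame: "continuous_on {p. fst p \<noteq> 0} (\<lambda>p. frame a b (fst p) (snd p))"
proof -
  have "qsq (monomials a b (fst p)) \<noteq> 0" if "p \<in> {p. fst p \<noteq> 0}" for p :: "(complex \<times> complex) \<times> complex \<times> complex"
    using qsq_monomials_pos[of "fst p" a b] that by auto
  then show ?thesis
    unfolding frame_def qmul_def qcnj_def qsq_def monomials_def fst_conv snd_conv
    by (intro continuous_intros) auto
qed

text \<open>
  The exponent \<open>a\<close> must be half of \<open>w - 1\<close> modulo \<open>l\<close>.  If \<open>w\<close> is even then \<open>l\<close> is odd, and \<open>w\<close> may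
  be replaced by \<open>w + l\<close>.  The exponent \<open>b\<close> is then \<open>a / w\<close> modulo \<open>l\<close>; it is taken positive because
  the second component of \<open>C\<close> has to vanish at the base point.
\<close>

lemma frame_exponents:
  fixes w :: int and l :: nat
  assumes l: "l > 0" and w: "coprime w (int l)"
  obtains a b :: nat where "b \<ge> 1" "int l dvd w * int b - int a" "int l dvd 2 * int a + 1 - w"
proof -
  obtain c where c: "int l dvd 2 * c + 1 - w"
  proof (cases "odd w")
    case True
    then obtain c where "w = 2 * c + 1" by (rule oddE)
    then show ?thesis using that[of c] by simp
  next
    case False
    have "odd (int l)" using w False by (meson coprime_common_divisor_int even_abs_add_iff not_coprimeI odd_one)
    then have "odd (w + int l)" using False by simp
    then obtain c where "w + int l = 2 * c + 1" by (rule oddE)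
    then have "2 * c + 1 - w = int l" by simp
    then show ?thesis using that[of c] by simp
  qed
  obtain u v where uv: "u * w + v * int l = 1" using bezout_int[of w "int l"] w by auto
  define a where "a = nat (c mod int l)"
  \<comment> \<open>The summand \<open>l\<close> makes \<open>b\<close> positive; \<open>u\<close> is the
    inverse of \<open>w\<close> modulo \<open>l\<close>.\<close>
  define b where "b = nat (u * c mod int l) + l"
  have a: "int a = c - int l * (c div int l)" using l by (simp add: a_def minus_mult_div_eq_mod)
  have b: "int b = u * c - int l * (u * c div int l) + int l" using l by (simp add: b_def minus_mult_div_eq_mod)
  have "w * int b - int a = c * (u * w - 1) + int l * (w - w * (u * c div int l) + c div int l)"
    unfolding a b by (simp add: algebra_simps)
  also have "u * w - 1 = - v * int l" using uv by simp
  finally have "w * int b - int a = int l * (- c * v + (w - w * (u * c div int l) + c div int l))"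
    by (simp add: algebra_simps)
  then have 1: "int l dvd w * int b - int a" by simp
  have "2 * int a + 1 - w = (2 * c + 1 - w) - int l * (2 * (c div int l))" unfolding a by simp
  then have 2: "int l dvd 2 * int a + 1 - w" using c by (metis dvd_diff dvd_triv_left)
  have "b \<ge> 1" using l by (simp add: b_def)
  then show ?thesis using 1 2 by (rule that)
qed

lemma cis_cong:
  assumes "l > 0" "int l dvd x - y"
  shows "cis (2 * pi * of_int k / l * of_int x) = cis (2 * pi * of_int k / l * of_int y)"
proof -
  obtain m where "x - y = int l * m" using assms(2) by (rule dvdE)
  then have "real_of_int (x - y) = real_of_int (int l * m)" by simp
  then have x: "real_of_int x = of_int y + l * of_int m" by simp
  have "2 * pi * of_int k / l * of_int x = 2 * pi * of_int k / l * of_int y + 2 * pi * of_int (k * m)"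
    unfolding x using assms(1) by (simp add: field_simps)
  then show ?thesis using cis_multiple_2pi[of "of_int (k * m)"] by (simp flip: cis_mult)
qed

definition cplx_pair :: "(nat \<Rightarrow> real) \<Rightarrow> complex \<times> complex" where
  "cplx_pair x = (cplx_coord x 0, cplx_coord x 1)"

definition of_cplx_pair :: "complex \<times> complex \<Rightarrow> nat \<Rightarrow> real" where
  "of_cplx_pair u = of_cplx (\<lambda>j. if j = 0 then fst u else if j = 1 then snd u else 0)"

lemma in_nsphere_3_iff:
  "x \<in> topspace (nsphere 3) \<longleftrightarrow> qsq (cplx_pair x) = 1 \<and> (\<forall>j>1. cplx_coord x j = 0)"
  using in_nsphere_cplx_iff[of x 1] by (simp add: qsq_def cplx_pair_def numeral_3_eq_3)

lemma cplx_pair_of_cplx_pair [simp]: "cplx_pair (of_cplx_pair u) = u"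
  by (simp add: cplx_pair_def of_cplx_pair_def)

lemma of_cplx_pair_in: "qsq u = 1 \<Longrightarrow> of_cplx_pair u \<in> topspace (nsphere 3)"
  by (simp add: in_nsphere_3_iff) (simp add: of_cplx_pair_def)

lemma of_cplx_pair_cplx_pair: "x \<in> topspace (nsphere 3) \<Longrightarrow> of_cplx_pair (cplx_pair x) = x"
  by (subst cplx_coord_inject [symmetric]) (auto simp: fun_eq_iff in_nsphere_3_iff of_cplx_pair_def cplx_pair_def)

lemma cplx_pair_nonzero: "x \<in> topspace (nsphere 3) \<Longrightarrow> cplx_pair x \<noteq> 0"
  by (auto simp: in_nsphere_3_iff qsq_def)

lemma cplx_pair_sphere_pt: "cplx_pair sphere_pt = (1, 0)"
  by (simp add: cplx_pair_def cplx_coord_def sphere_pt_def complex_eq_iff)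

lemma continuous_map_cplx_pair:
  assumes "continuous_map X (nsphere 3) f"
  shows "continuous_map X euclidean (\<lambda>x. cplx_pair (f x))"
proof -
  have c: "continuous_map X euclidean (\<lambda>x. cplx_coord (f x) j)" for j
  proof -
    have "cplx_coord (f x) j = f x (2 * j) *\<^sub>R 1 + f x (2 * j + 1) *\<^sub>R \<i>" for x
      by (simp add: cplx_coord_def complex_eq_iff)
    moreover have "continuous_map X euclidean (\<lambda>x. f x i *\<^sub>R (c::complex))" for i c
    proof -
      have "continuous_map euclideanreal euclidean (\<lambda>r. r *\<^sub>R c)" by (auto intro: continuous_intros)
      from continuous_map_compose[OF continuous_map_coordinate(1)[OF assms] this]
      show ?thesis unfolding o_def .
    qed
    ultimately show ?thesis by (simp add: continuous_map_add)
  qed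
  have "continuous_map X (prod_topology euclidean euclidean) (\<lambda>x. (cplx_coord (f x) 0, cplx_coord (f x) 1))"
    by (intro continuous_map_pairedI c)
  then show ?thesis by (simp add: cplx_pair_def)
qed

lemma continuous_map_of_cplx_pair:
  assumes f: "continuous_map X euclidean f" and u: "\<And>x. x \<in> topspace X \<Longrightarrow> qsq (f x) = 1"
  shows "continuous_map X (nsphere 3) (\<lambda>x. of_cplx_pair (f x))"
  unfolding continuous_map_coordinatewise(1)
proof (intro conjI allI Pi_I)
  fix i
  have "continuous_map euclidean euclideanreal (\<lambda>u. of_cplx_pair u i)"
    unfolding of_cplx_pair_def of_cplx_def
    by (cases "even i"; cases "i div 2 = 0"; cases "i div 2 = 1"; auto intro!: continuous_intros)
  from continuous_map_compose[OF f this] show "continuous_map X euclideanreal (\<lambda>x. of_cplx_pair (f x) i)"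
    unfolding o_def .
qed (use u of_cplx_pair_in in auto)

context lens
begin

text \<open>
  The map \<open>(z, y) \<mapsto> frame z (\<alpha> y)\<close> commutes with the group in the variable \<open>z\<close>.  It descends to a map
  on \<open>L \<times> S\<^sup>m\<close> that is the identity on \<open>L\<close> and \<open>\<gamma> \<circ> \<alpha>\<close> on the sphere.
\<close>

theorem gottlieb_lens_3:
  assumes n1: "n = 1" and \<alpha>: "sphere_map m S sphere_pt \<alpha>"
  shows "sphere_class m L x0 (\<gamma> \<circ> \<alpha>) \<in> gottlieb m L x0"
proof -
  have S3: "S = nsphere 3" using n1 by (simp add: numeral_3_eq_3)
  have "coprime (q 1) (int l)" using weights_coprime[of 1] n1 by simp
  then obtain a b :: nat where b: "b \<ge> 1" and ab: "int l dvd q 1 * int b - int a" "int l dvd 2 * int a + 1 - q 1"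
    by (rule frame_exponents[OF l_pos]) (rule that)
  define \<phi> where "\<phi> = (\<lambda>x w. of_cplx_pair (frame a b (cplx_pair x) (cplx_pair w)))"
  have \<phi>_deck: "\<phi> (deck k x) w = deck k (\<phi> x w)" for k x w
  proof -
    let ?\<theta> = "2 * pi * of_int k / l"
    let ?s = "cis ?\<theta>" and ?t = "cis (?\<theta> * of_int (q 1))"
    have p: "?s ^ a = cis (?\<theta> * of_int (int a))" "?t ^ b = cis (?\<theta> * of_int (q 1 * int b))"
      unfolding Complex.DeMoivre by (simp_all add: mult_ac)
    have e: "?s ^ a = ?t ^ b" unfolding p by (rule cis_cong[OF l_pos ab(1), symmetric])
    have "cis (?\<theta> * of_int (2 * int a + 1)) = ?t" by (rule cis_cong[OF l_pos ab(2)])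
    moreover have "?\<theta> * of_int (2 * int a + 1) = ?\<theta> * of_int (int a) + ?\<theta> * of_int (int a) + ?\<theta>"
      by (simp add: algebra_simps add_divide_distrib)
    ultimately have t: "?t = (?s ^ a)\<^sup>2 * ?s"
      unfolding p by (simp only: power2_eq_square cis_mult)
    have u: "?s * cnj ?s = 1" by (simp add: cis_cnj cis_mult)
    have cp: "cplx_pair (deck k y) = (?s * fst (cplx_pair y), ?t * snd (cplx_pair y))" for y
      by (simp add: cplx_pair_def cplx_coord_rot weight_def)
    have "cplx_coord (\<phi> (deck k x) w) j = cplx_coord (deck k (\<phi> x w)) j" for j
    proof -
      have "cplx_coord (of_cplx_pair v) j = (if j = 0 then fst v else if j = 1 then snd v else 0)" for v
        by (simp add: of_cplx_pair_def)
      then show ?thesis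
        unfolding \<phi>_def cp frame_equivariant[OF u e t] by (simp add: cplx_coord_rot weight_def)
    qed
    then have "cplx_coord (\<phi> (deck k x) w) = cplx_coord (deck k (\<phi> x w))" by (rule ext)
    then show ?thesis unfolding cplx_coord_inject .
  qed
  have c\<alpha>: "continuous_map (nsphere m) (nsphere 3) \<alpha>" "\<alpha> sphere_pt = sphere_pt"
    using \<alpha> unfolding sphere_map_def S3 by auto
  let ?P = "prod_topology (nsphere 3) (nsphere m)"
  have c1: "continuous_map ?P euclidean (\<lambda>p. cplx_pair (fst p))"
    by (rule continuous_map_cplx_pair[OF continuous_map_fst])
  have c2: "continuous_map ?P euclidean (\<lambda>p. cplx_pair (\<alpha> (snd p)))"
    using continuous_map_cplx_pair[OF continuous_map_compose[OF continuous_map_snd c\<alpha>(1)], of "nsphere 3"] by (simp add: o_def)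
  have "continuous_map ?P (prod_topology euclidean euclidean) (\<lambda>p. (cplx_pair (fst p), cplx_pair (\<alpha> (snd p))))"
    by (intro continuous_map_pairedI c1 c2)
  then have "continuous_map ?P (top_of_set {p. fst p \<noteq> 0}) (\<lambda>p. (cplx_pair (fst p), cplx_pair (\<alpha> (snd p))))"
    using cplx_pair_nonzero by (auto simp: continuous_map_in_subtopology)
  moreover have "continuous_map (top_of_set {p. fst p \<noteq> 0}) euclidean (\<lambda>p. frame a b (fst p) (snd p))"
    using continuous_on_frame by simp
  ultimately have "continuous_map ?P euclidean ((\<lambda>p. frame a b (fst p) (snd p)) \<circ> (\<lambda>p. (cplx_pair (fst p), cplx_pair (\<alpha> (snd p)))))"
    by (rule continuous_map_compose)
  then have "continuous_map ?P (nsphere 3) (\<lambda>p. \<phi> (fst p) (\<alpha> (snd p)))"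
    unfolding \<phi>_def o_def fst_conv snd_conv
  proof (rule continuous_map_of_cplx_pair)
    fix p assume "p \<in> topspace ?P"
    then have p: "fst p \<in> topspace (nsphere 3)" "\<alpha> (snd p) \<in> topspace (nsphere 3)"
      using continuous_map_in_topspace[OF c\<alpha>(1)] by auto
    then show "qsq (frame a b (cplx_pair (fst p)) (cplx_pair (\<alpha> (snd p)))) = 1"
      by (simp add: qsq_frame cplx_pair_nonzero) (simp add: in_nsphere_3_iff)
  qed
  from continuous_map_compose[OF this p_continuous[unfolded S3]]
  have c: "continuous_map ?P L (\<lambda>p. \<gamma> (\<phi> (fst p) (\<alpha> (snd p))))" unfolding o_def .
  have Q: "quotient_map ?P (prod_topology L (nsphere m)) (\<lambda>(x, y). (\<gamma> x, y))"
    by (intro quotient_map_prod_left quotient_map_lens[unfolded S3] disjI1 Hausdorff_space_nsphere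
        compact_imp_locally_compact_space compact_space_nsphere)
  obtain F where F: "continuous_map (prod_topology L (nsphere m)) L F"
    "\<And>p. p \<in> topspace ?P \<Longrightarrow> F (case p of (x, y) \<Rightarrow> (\<gamma> x, y)) = \<gamma> (\<phi> (fst p) (\<alpha> (snd p)))"
  proof (rule quotient_map_lift_exists[OF Q c])
    fix x y :: "(nat \<Rightarrow> real) \<times> (nat \<Rightarrow> real)"
    assume "(case x of (x, y) \<Rightarrow> (\<gamma> x, y)) = (case y of (x, y) \<Rightarrow> (\<gamma> x, y))"
    then have e: "\<gamma> (fst x) = \<gamma> (fst y)" "snd x = snd y" by (simp_all add: case_prod_unfold)
    obtain k where k: "fst y = deck k (fst x)" by (rule \<gamma>_eqD[OF e(1)])
    show "\<gamma> (\<phi> (fst x) (\<alpha> (snd x))) = \<gamma> (\<phi> (fst y) (\<alpha> (snd y)))"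
      unfolding k e(2) \<phi>_deck by simp
  qed (rule that)
  have s3: "sphere_pt \<in> topspace (nsphere 3)" by (rule sphere_pt_in)
  have Fv: "F (\<gamma> x, y) = \<gamma> (\<phi> x (\<alpha> y))" if "x \<in> topspace (nsphere 3)" "y \<in> topspace (nsphere m)" for x y
    using F(2)[of "(x, y)"] that by simp
  show ?thesis
    unfolding gottlieb_def
  proof (rule sphere_class_in_gottlieb_alongI[OF sphere_map_lift_compose[OF pt_in refl \<alpha>] _ _ F(1)])
    show "x0 \<in> topspace L" using p_onto pt_in by blast
    show "F (a, sphere_pt) = id a" if "a \<in> topspace L" for a
    proof -
      obtain x where x: "x \<in> topspace (nsphere 3)" "a = \<gamma> x"
        using \<open>a \<in> topspace L\<close> p_onto[unfolded S3] by blast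
      have "\<phi> x sphere_pt = x"
        unfolding \<phi>_def cplx_pair_sphere_pt frame_one_right[OF cplx_pair_nonzero[OF x(1)]]
        by (rule of_cplx_pair_cplx_pair[OF x(1)])
      then show ?thesis using Fv[OF x(1) sphere_pt_in] by (simp add: x(2) c\<alpha>(2))
    qed
    show "F (x0, s) = (\<gamma> \<circ> \<alpha>) s" if s: "s \<in> topspace (nsphere m)" for s
    proof -
      have "\<phi> sphere_pt (\<alpha> s) = \<alpha> s"
        unfolding \<phi>_def cplx_pair_sphere_pt frame_one_left[OF b]
        by (rule of_cplx_pair_cplx_pair[OF continuous_map_in_topspace[OF c\<alpha>(1) s]])
      then show ?thesis using Fv[OF s3 s] by simp
    qed
  qed simp
qed

end

section \<open>Gottlieb and Whitehead center groups of lens spaces\<close>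

theorem proposition4p1:
  fixes n l :: nat and q :: "nat \<Rightarrow> int"
  assumes "n \<ge> 1" and "l \<ge> 2" and "\<And>j. 1 \<le> j \<Longrightarrow> j \<le> n \<Longrightarrow> coprime (q j) (int l)"
  shows
    "let S = nsphere (2 * n + 1); s = sphere_pt;
         L = lens_space n l q; \<gamma> = lens_proj l q; x = \<gamma> s;
         G\<gamma> = (\<lambda>m. gottlieb_along m S s L x \<gamma>);
         P\<gamma> = (\<lambda>m. whitehead_along m S s L x \<gamma>)
     in
       homotopy_group 1 L x \<cong> integer_mod_group l \<and>
       (gottlieb 1 L x = G\<gamma> 1 \<and> G\<gamma> 1 = carrier (homotopy_group 1 L x)) \<and>
       (whitehead_center 1 L x = P\<gamma> 1 \<and> P\<gamma> 1 = carrier (homotopy_group 1 L x)) \<and>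
       (\<forall>m\<ge>1. G\<gamma> m = P\<gamma> m \<and>
          P\<gamma> m = whitehead_kernel (2 * n + 1) m L x (sphere_class (2 * n + 1) L x \<gamma>)) \<and>
       (\<forall>m>1. P\<gamma> m = whitehead_center m L x \<and>
          whitehead_center m L x = homotopy_induced m L x \<gamma> ` gottlieb m S s) \<and>
       (n = 1 \<longrightarrow> (\<forall>m>1. G\<gamma> m = P\<gamma> m \<and> P\<gamma> m = gottlieb m L x \<and>
          gottlieb m L x = whitehead_center m L x \<and>
          whitehead_center m L x = homotopy_induced m L x \<gamma> ` carrier (homotopy_group m S s)))"
proof -
  interpret lens n l q by (rule lens.intro) (fact assms)+
  have dim: "2 * n + 1 = Suc (2 * n)" by simp
  let ?\<gamma> = "lens_proj l q" and ?S = "nsphere (Suc (2 * n))" and ?L = "lens_space n l q"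
  let ?x = "?\<gamma> sphere_pt"
  let ?G = "\<lambda>m. gottlieb_along m ?S sphere_pt ?L ?x ?\<gamma>" and ?P = "\<lambda>m. whitehead_along m ?S sphere_pt ?L ?x ?\<gamma>"
  have x: "?x \<in> topspace ?L" using p_onto pt_in by blast
  have \<gamma>: "sphere_map (Suc (2 * n)) ?L ?x ?\<gamma>" using p_continuous by (simp add: sphere_map_def)
  have GP: "gottlieb m ?L ?x \<subseteq> whitehead_center m ?L ?x" if "m \<ge> 1" for m
    unfolding gottlieb_def whitehead_center_def
    using that continuous_map_id id_apply x by (rule gottlieb_along_subset_whitehead_along)
  have sub: "?G m \<subseteq> carrier (homotopy_group m ?L ?x)" "?P m \<subseteq> carrier (homotopy_group m ?L ?x)" for m
    unfolding gottlieb_along_def whitehead_along_def by blast+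
  have GG: "gottlieb m ?L ?x \<subseteq> ?G m" for m
    using p_continuous refl pt_in by (rule gottlieb_subset_gottlieb_along)
  have PP: "whitehead_center m ?L ?x \<subseteq> ?P m" if "m \<ge> 1" for m
    using that p_continuous refl by (rule whitehead_center_subset_whitehead_along)
  have part1: "gottlieb 1 ?L ?x = ?G 1 \<and> ?G 1 = carrier (homotopy_group 1 ?L ?x)"
    using GG[of 1] sub(1)[of 1] gottlieb_1_lens by simp
  have pi1: "carrier (homotopy_group 1 ?L ?x) \<subseteq> whitehead_center 1 ?L ?x"
    using GP[of 1] gottlieb_1_lens by simp
  have part2: "whitehead_center 1 ?L ?x = ?P 1 \<and> ?P 1 = carrier (homotopy_group 1 ?L ?x)"
    using pi1 PP[OF order_refl] sub(2)[of 1] by blast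
  have part3: "?G m = ?P m" "?P m = whitehead_kernel (Suc (2 * n)) m ?L ?x (sphere_class (Suc (2 * n)) ?L ?x ?\<gamma>)"
    if "m \<ge> 1" for m
    using gottlieb_whitehead_kernel_sphere[OF _ that \<gamma>] by simp_all
  have part4: "?P m = whitehead_center m ?L ?x"
      "whitehead_center m ?L ?x = homotopy_induced m ?L ?x ?\<gamma> ` gottlieb m ?S sphere_pt" if m: "m > 1" for m
  proof -
    have m2: "m \<ge> 2" and m1: "m \<ge> 1" using m by simp_all
    show P: "?P m = whitehead_center m ?L ?x"
      using m2 pt_in refl pi1 by (rule whitehead_along_covering_eq_center)
    have "sphere_map (Suc (2 * n)) ?S sphere_pt id" by (simp add: sphere_map_def)
    then have "gottlieb m ?S sphere_pt = whitehead_center m ?S sphere_pt"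
      unfolding gottlieb_def whitehead_center_def
      using m1 by (intro gottlieb_whitehead_kernel_sphere(1)) simp_all
    then show "whitehead_center m ?L ?x = homotopy_induced m ?L ?x ?\<gamma> ` gottlieb m ?S sphere_pt"
      using whitehead_along_covering[OF m2 pt_in refl] P by simp
  qed
  have part5: "?P m = gottlieb m ?L ?x" "gottlieb m ?L ?x = whitehead_center m ?L ?x"
      "whitehead_center m ?L ?x = homotopy_induced m ?L ?x ?\<gamma> ` carrier (homotopy_group m ?S sphere_pt)"
    if n1: "n = 1" and m: "m > 1" for m
  proof -
    have "gottlieb m ?L ?x \<subseteq> whitehead_center m ?L ?x" using m by (intro GP) simp
    moreover have "whitehead_center m ?L ?x \<subseteq> homotopy_induced m ?L ?x ?\<gamma> ` carrier (homotopy_group m ?S sphere_pt)"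
      unfolding part4(2)[OF m] by (intro image_mono) (auto simp: gottlieb_def gottlieb_along_def)
    moreover have "homotopy_induced m ?L ?x ?\<gamma> ` carrier (homotopy_group m ?S sphere_pt) \<subseteq> gottlieb m ?L ?x"
    proof (rule image_subsetI)
      fix c assume "c \<in> carrier (homotopy_group m ?S sphere_pt)"
      then obtain \<alpha> where \<alpha>: "sphere_map m ?S sphere_pt \<alpha>" "c = sphere_class m ?S sphere_pt \<alpha>" by (rule homotopy_groupE)
      show "homotopy_induced m ?L ?x ?\<gamma> c \<in> gottlieb m ?L ?x"
        unfolding \<alpha>(2) homotopy_induced_class[where f = "?\<gamma>", OF p_continuous refl \<alpha>(1)]
        using n1 \<alpha>(1) by (rule gottlieb_lens_3)
    qed
    ultimately show "gottlieb m ?L ?x = whitehead_center m ?L ?x"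
      and "whitehead_center m ?L ?x = homotopy_induced m ?L ?x ?\<gamma> ` carrier (homotopy_group m ?S sphere_pt)"
      by (simp_all only: set_eq_subset) (iprover intro: subset_trans)+
    then show "?P m = gottlieb m ?L ?x" using part4(1)[OF m] by simp
  qed
  show ?thesis
    unfolding Let_def dim
  proof (intro conjI allI impI)
    show "homotopy_group 1 ?L ?x \<cong> integer_mod_group l" by (rule fundamental_group_lens)
  qed (use part1 part2 in blast | rule part3 part4 part5; simp)+
qed

end
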